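(* Let $\phi\in\mathbb{Q}(x)$ be a rational function of degree $2$ having a $2$-periodic critical point, and suppose that $\operatorname{Aut}(\phi)$ is nontrivial. Then there exists $v\in\mathbb{Q}\setminus\{0,4\}$ such that $\phi$ is linearly conjugate over $\mathbb{Q}$ to \[\psi_v:=\frac{2x-1}{vx^2-1}.\] Moreover, for any such $v$ with $v\neq 1$: (a) if $v\notin\operatorname{Im}\alpha\cup\operatorname{Im}\beta$, then $G_{3,\phi}\cong W$; (b) if $v\in\operatorname{Im}\alpha$, then $G_{3,\phi}\cong A$, $K$, or $M$; (c) if $v\in\operatorname{Im}\beta$, then $G_{3,\phi}\cong B$ or $M$; (d) if $v\in\operatorname{Im}\mu$, then $G_{3,\phi}\cong M$; (e) if $v\in\operatorname{Im}\kappa$, then $G_{3,\phi}\cong K$.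
   Context: The degree of a rational function $p/q$ ($p,q$ coprime) is $\max\{\deg p,\deg q\}$. A point $P\in\mathbb{P}^1(\overline{\mathbb{Q}})$ is $n$-periodic for $\phi$ if $\phi^n(P)=P$ with $n$ minimal. A critical point is a ramification point of $\phi:\mathbb{P}^1\to\mathbb{P}^1$. Two maps $\phi,\psi$ are linearly conjugate over $\mathbb{Q}$ if $\psi=\sigma^{-1}\circ\phi\circ\sigma$ for some degree-one $\sigma\in\mathbb{Q}(x)$. $\operatorname{Aut}(\phi)$ is the group of degree-one $\sigma\in\overline{\mathbb{Q}}(x)$ with $\sigma^{-1}\circ\phi\circ\sigma=\phi$. $G_{3,\phi}=\operatorname{Gal}(\mathbb{Q}_{3,\phi}/\mathbb{Q})$ where $\mathbb{Q}_{3,\phi}$ is the compositum of the fields of definition of all $3$-periodic points of $\phi$ in $\mathbb{P}^1(\overline{\mathbb{Q}})$. For $\rho\in\mathbb{Q}(t)$, $\operatorname{Im}\rho$ denotes the set of values $\rho(u)$ for $u\in\mathbb{Q}$ at which $\rho$ is defined. Set $\alpha(t)=\frac{(1+t)^2}{1-t+t^2}$, $\beta(t)=t^2(3-t)$, $\kappa(t)=\frac{(t^3-3t^2-6t-1)^2}{(1+t+t^2)^3}$, $\mu(t)=\alpha\!\left(\frac{t^3-3t-1}{t^3+3t^2-1}\right)$. Groups: $W$ is the centralizer of $(1,2,3)(4,5,6)$ in $S_6$ (so $W\cong(\mathbb{Z}/3\mathbb{Z})\wr S_2$). Up to conjugacy in $W$, the maximal subgroups of $W$ are $A$ (order $9$),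 $B$ (cyclic of order $6$) and $C$ (non-cyclic of order $6$). Up to conjugacy in $W$, the maximal subgroups of $A$ are $J,K,M$, where $J$ is the one contained in a conjugate of $C$, $M$ is the one contained in a conjugate of $B$, and $K$ is the remaining one. *)

theory Defs
  imports "HOL-Computational_Algebra.Computational_Algebra"
begin

(* P^1 over C: None is the point at infinity. Qbar is the set of algebraic complex numbers. *)
type_synonym p1 = "complex option"

(* a rational function p/q in Q(x), given by numerator and denominator *)
type_synonym ratfun = "rat poly \<times> rat poly"

definition cpoly :: "rat poly \<Rightarrow> complex poly" where
  "cpoly p = map_poly of_rat p"

definition rf_ok :: "ratfun \<Rightarrow> bool" where
  "rf_ok \<phi> \<longleftrightarrow> coprime (fst \<phi>) (snd \<phi>) \<and> snd \<phi> \<noteq> 0"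

definition rf_deg :: "ratfun \<Rightarrow> nat" where
  "rf_deg \<phi> = max (degree (fst \<phi>)) (degree (snd \<phi>))"

definition rf_eval :: "ratfun \<Rightarrow> p1 \<Rightarrow> p1" where
  "rf_eval \<phi> P = (let p = cpoly (fst \<phi>); q = cpoly (snd \<phi>) in
     (case P of
        Some z \<Rightarrow> (if poly q z = 0 then None else Some (poly p z / poly q z))
      | None \<Rightarrow> (if degree p > degree q then None
                 else if degree p = degree q then Some (lead_coeff p / lead_coeff q)
                 else Some 0)))"

(* ramification index e_P: multiplicity of P in the fibre over phi(P) *)
definition rf_ram :: "ratfun \<Rightarrow> p1 \<Rightarrow> nat" where
  "rf_ram \<phi> P = (let p = cpoly (fst \<phi>); q = cpoly (snd \<phi>); d = rf_deg \<phi> in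
     (case (P, rf_eval \<phi> P) of
        (Some a, Some c) \<Rightarrow> order a (p - smult c q)
      | (Some a, None) \<Rightarrow> order a q
      | (None, Some c) \<Rightarrow> d - degree (p - smult c q)
      | (None, None) \<Rightarrow> d - degree q))"

definition critical_pt :: "ratfun \<Rightarrow> p1 \<Rightarrow> bool" where
  "critical_pt \<phi> P \<longleftrightarrow> rf_ram \<phi> P \<ge> 2"

definition alg_pt :: "p1 \<Rightarrow> bool" where
  "alg_pt P \<longleftrightarrow> (\<forall>z. P = Some z \<longrightarrow> algebraic z)"

definition periodic_pt :: "(p1 \<Rightarrow> p1) \<Rightarrow> nat \<Rightarrow> p1 \<Rightarrow> bool" where
  "periodic_pt f n P \<longleftrightarrow> 0 < n \<and> (f ^^ n) P = P \<and> (\<forall>m. 0 < m \<and> m < n \<longrightarrow> (f ^^ m) P \<noteq> P)"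

definition mob :: "complex \<Rightarrow> complex \<Rightarrow> complex \<Rightarrow> complex \<Rightarrow> p1 \<Rightarrow> p1" where
  "mob a b c d P = (case P of
      Some z \<Rightarrow> (if c * z + d = 0 then None else Some ((a * z + b) / (c * z + d)))
    | None \<Rightarrow> (if c = 0 then None else Some (a / c)))"

(* psi = sigma^-1 o phi o sigma for some sigma in PGL_2(Q), i.e. sigma o psi = phi o sigma *)
definition lin_conj_Q :: "ratfun \<Rightarrow> ratfun \<Rightarrow> bool" where
  "lin_conj_Q \<phi> \<psi> \<longleftrightarrow> (\<exists>a b c d :: rat. a * d - b * c \<noteq> 0 \<and>
     (\<forall>P. mob (of_rat a) (of_rat b) (of_rat c) (of_rat d) (rf_eval \<psi> P)
          = rf_eval \<phi> (mob (of_rat a) (of_rat b) (of_rat c) (of_rat d) P)))"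

definition aut_nontrivial :: "ratfun \<Rightarrow> bool" where
  "aut_nontrivial \<phi> \<longleftrightarrow> (\<exists>a b c d. algebraic a \<and> algebraic b \<and> algebraic c \<and> algebraic d \<and>
     a * d - b * c \<noteq> 0 \<and> (\<exists>P. mob a b c d P \<noteq> P) \<and>
     (\<forall>P. mob a b c d (rf_eval \<phi> P) = rf_eval \<phi> (mob a b c d P)))"

definition psi :: "rat \<Rightarrow> ratfun" where
  "psi v = ([:-1, 2:], [:-1, 0, v:])"

definition per3 :: "ratfun \<Rightarrow> p1 set" where
  "per3 \<phi> = {P. alg_pt P \<and> periodic_pt (rf_eval \<phi>) 3 P}"

definition is_subfield :: "complex set \<Rightarrow> bool" where
  "is_subfield F \<longleftrightarrow> 0 \<in> F \<and> 1 \<in> F \<and> (\<forall>x\<in>F. \<forall>y\<in>F. x + y \<in> F \<and> x * y \<in> F) \<and>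
     (\<forall>x\<in>F. - x \<in> F \<and> (x \<noteq> 0 \<longrightarrow> inverse x \<in> F))"

definition gen_field :: "complex set \<Rightarrow> complex set" where
  "gen_field S = \<Inter>{F. is_subfield F \<and> S \<subseteq> F}"

definition Q3 :: "ratfun \<Rightarrow> complex set" where
  "Q3 \<phi> = gen_field {z. Some z \<in> per3 \<phi>}"

(* field automorphisms of K (they fix Q automatically): Gal(K/Q) for K = Q3 *)
definition field_auts :: "complex set \<Rightarrow> (complex \<Rightarrow> complex) set" where
  "field_auts K = {\<sigma>. bij_betw \<sigma> K K \<and>
     (\<forall>x\<in>K. \<forall>y\<in>K. \<sigma> (x + y) = \<sigma> x + \<sigma> y \<and> \<sigma> (x * y) = \<sigma> x * \<sigma> y)}"

definition perm_of_list :: "nat list \<Rightarrow> nat \<Rightarrow> nat" where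
  "perm_of_list xs i = (if i < length xs then xs ! i else i)"

(* (1,2,3)(4,5,6), 0-indexed *)
definition pi6 :: "nat \<Rightarrow> nat" where
  "pi6 = perm_of_list [1,2,0,4,5,3]"

definition W6 :: "(nat \<Rightarrow> nat) set" where
  "W6 = {f. bij_betw f {0..<6} {0..<6} \<and> (\<forall>i\<ge>6. f i = i) \<and> f \<circ> pi6 = pi6 \<circ> f}"

(* A: order 9, generated by (1,2,3) and (4,5,6) *)
definition A6 :: "(nat \<Rightarrow> nat) set" where
  "A6 = {perm_of_list [i, (i+1) mod 3, (i+2) mod 3, 3 + j, 3 + (j+1) mod 3, 3 + (j+2) mod 3]
          | i j. i < 3 \<and> j < 3}"

(* B: cyclic of order 6, generated by (1,5,2,6,3,4) *)
definition B6 :: "(nat \<Rightarrow> nat) set" where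
  "B6 = perm_of_list ` {[0,1,2,3,4,5], [4,5,3,0,1,2], [1,2,0,4,5,3],
                        [5,3,4,1,2,0], [2,0,1,5,3,4], [3,4,5,2,0,1]}"

(* C: non-cyclic of order 6, generated by (1,4)(2,5)(3,6) and (1,2,3)(4,6,5) *)
definition C6 :: "(nat \<Rightarrow> nat) set" where
  "C6 = perm_of_list ` {[0,1,2,3,4,5], [1,2,0,5,3,4], [2,0,1,4,5,3],
                        [3,4,5,0,1,2], [4,5,3,2,0,1], [5,3,4,1,2,0]}"

(* J = <(1,2,3)(4,6,5)> (contained in C) *)
definition J6 :: "(nat \<Rightarrow> nat) set" where
  "J6 = perm_of_list ` {[0,1,2,3,4,5], [1,2,0,5,3,4], [2,0,1,4,5,3]}"

(* K = <(1,2,3)> *)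
definition K6 :: "(nat \<Rightarrow> nat) set" where
  "K6 = perm_of_list ` {[0,1,2,3,4,5], [1,2,0,3,4,5], [2,0,1,3,4,5]}"

(* M = <(1,2,3)(4,5,6)> (contained in B) *)
definition M6 :: "(nat \<Rightarrow> nat) set" where
  "M6 = perm_of_list ` {[0,1,2,3,4,5], [1,2,0,4,5,3], [2,0,1,5,3,4]}"

(* G_{3,phi} is isomorphic to H (as a subgroup of W, up to conjugacy in W):
   for some labelling of the 3-periodic points by 0..5 on which phi acts as pi6,
   the permutations induced by Gal(Q3/Q) form exactly H. *)
definition G3_is :: "ratfun \<Rightarrow> (nat \<Rightarrow> nat) set \<Rightarrow> bool" where
  "G3_is \<phi> H \<longleftrightarrow> (\<exists>lab. bij_betw lab {0..<6} (per3 \<phi>) \<and>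
     (\<forall>i<6. rf_eval \<phi> (lab i) = lab (pi6 i)) \<and>
     (\<lambda>\<sigma> i. if i < 6 then the_inv_into {0..<6} lab (map_option \<sigma> (lab i)) else i)
        ` field_auts (Q3 \<phi>) = H)"

definition alpha :: "rat \<Rightarrow> rat" where "alpha t = (1 + t)^2 / (1 - t + t^2)"
definition beta :: "rat \<Rightarrow> rat" where "beta t = t^2 * (3 - t)"
definition kappa :: "rat \<Rightarrow> rat" where
  "kappa t = (t^3 - 3*t^2 - 6*t - 1)^2 / (1 + t + t^2)^3"
definition mu :: "rat \<Rightarrow> rat" where
  "mu t = alpha ((t^3 - 3*t - 1) / (t^3 + 3*t^2 - 1))"

definition Im_alpha :: "rat set" where "Im_alpha = {alpha u | u. 1 - u + u^2 \<noteq> 0}"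
definition Im_beta :: "rat set" where "Im_beta = range beta"
definition Im_kappa :: "rat set" where "Im_kappa = {kappa u | u. 1 + u + u^2 \<noteq> 0}"
definition Im_mu :: "rat set" where
  "Im_mu = {mu u | u. u^3 + 3*u^2 - 1 \<noteq> 0 \<and>
     (let w = (u^3 - 3*u - 1) / (u^3 + 3*u^2 - 1) in 1 - w + w^2 \<noteq> 0)}"

end

theory Submission
  imports Defs "HOL-Library.Numeral_Type"
begin

text \<open>
  Over \<open>\<complex>\<close> a map \<open>\<phi>\<close> as in the theorem is conjugate to \<open>y \<mapsto> 1/y\<^sup>2\<close>: both critical points lie on
  the 2-cycle. Moving a generic rational point, its image and its second image to \<open>\<infinity>, 0, 1\<close> by a
  rational substitution turns \<open>\<phi>\<close> into \<open>\<psi>\<^sub>v\<close>.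

  The fixed points of \<open>\<psi>\<^sub>v\<close> are the inverses of the roots \<open>t\<^sub>0, t\<^sub>1, t\<^sub>2\<close> of \<open>x\<^sup>3 - 3x\<^sup>2 + v\<close>, and sending
  them to \<open>1, 0, \<infinity>\<close> turns \<open>\<psi>\<^sub>v\<close> into \<open>x \<mapsto> x(x - 2)/(1 - 2x)\<close>, whose 3-periodic points are the roots
  \<open>\<gamma>\<close> of \<open>x\<^sup>3 - 3x + 1\<close> and their inverses. Hence the Galois group acts on the 3-periodic points
  through its actions on the \<open>\<gamma>\<close>, by rotations of \<open>\<int>/3\<close>, and on the \<open>t\<^sub>i\<close>, by affine permutations
  of \<open>\<int>/3\<close>. This identifies \<open>W\<close> with \<open>C\<^sub>3 \<times> S\<^sub>3\<close>.

  The image in \<open>C\<^sub>3\<close> is never trivial because \<open>\<gamma>\<close> is irrational. The image in \<open>S\<^sub>3\<close> is governed by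
  the discriminant \<open>27v(4 - v)\<close>, a square exactly for \<open>v \<in> Im \<alpha>\<close>, and by the rational roots, which
  exist exactly for \<open>v \<in> Im \<beta>\<close>; for \<open>v \<in> Im \<mu>\<close> all \<open>t\<^sub>i\<close> are rational, and for \<open>v \<in> Im \<kappa>\<close> a
  3-periodic point is.
\<close>

section \<open>Subfields of the complex numbers and their embeddings\<close>

lemma subfield_0: "is_subfield F \<Longrightarrow> 0 \<in> F"
  and subfield_1: "is_subfield F \<Longrightarrow> 1 \<in> F"
  and subfield_add: "is_subfield F \<Longrightarrow> x \<in> F \<Longrightarrow> y \<in> F \<Longrightarrow> x + y \<in> F"
  and subfield_mult: "is_subfield F \<Longrightarrow> x \<in> F \<Longrightarrow> y \<in> F \<Longrightarrow> x * y \<in> F"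
  and subfield_uminus: "is_subfield F \<Longrightarrow> x \<in> F \<Longrightarrow> - x \<in> F"
  by (auto simp: is_subfield_def)

lemma subfield_inverse: "is_subfield F \<Longrightarrow> x \<in> F \<Longrightarrow> inverse x \<in> F"
  by (cases "x = 0") (auto simp: is_subfield_def)

lemma subfield_diff: "is_subfield F \<Longrightarrow> x \<in> F \<Longrightarrow> y \<in> F \<Longrightarrow> x - y \<in> F"
  using subfield_add[of F x "-y"] subfield_uminus[of F y] by simp

lemma subfield_divide: "is_subfield F \<Longrightarrow> x \<in> F \<Longrightarrow> y \<in> F \<Longrightarrow> x / y \<in> F"
  by (simp add: divide_inverse subfield_mult subfield_inverse)

lemma subfield_sum: "is_subfield F \<Longrightarrow> (\<And>i. i \<in> A \<Longrightarrow> f i \<in> F) \<Longrightarrow> sum f A \<in> F"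
  by (induction A rule: infinite_finite_induct) (auto simp: subfield_0 subfield_add)

lemma subfield_power: "is_subfield F \<Longrightarrow> x \<in> F \<Longrightarrow> x ^ n \<in> F"
  by (induction n) (auto simp: subfield_1 subfield_mult)

lemma subfield_of_nat: "is_subfield F \<Longrightarrow> of_nat n \<in> F"
  by (induction n) (auto simp: subfield_0 subfield_1 subfield_add)

lemma subfield_of_int: "is_subfield F \<Longrightarrow> of_int n \<in> F"
  by (cases n rule: int_cases2) (auto simp: subfield_of_nat subfield_uminus)

lemma Rats_subset_subfield: "is_subfield F \<Longrightarrow> \<rat> \<subseteq> F"
  by (auto elim!: Rats_cases' intro!: subfield_divide subfield_of_int)

lemma subfield_of_rat: "is_subfield F \<Longrightarrow> of_rat r \<in> F"
  using Rats_subset_subfield[of F] by auto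

lemma subfield_numeral: "is_subfield F \<Longrightarrow> numeral n \<in> F"
  using Rats_subset_subfield[of F] by auto

lemmas subfield_intros = subfield_0 subfield_1 subfield_add subfield_mult subfield_uminus
  subfield_inverse subfield_diff subfield_divide subfield_power subfield_numeral subfield_of_rat

lemma is_subfield_Rats: "is_subfield \<rat>"
  by (auto simp: is_subfield_def)

lemma is_subfield_UNIV: "is_subfield UNIV"
  by (simp add: is_subfield_def)

lemma is_subfield_gen_field: "is_subfield (gen_field S)"
  unfolding is_subfield_def gen_field_def by blast

lemma gen_field_superset: "S \<subseteq> gen_field S"
  unfolding gen_field_def by blast

lemma gen_field_minimal: "is_subfield F \<Longrightarrow> S \<subseteq> F \<Longrightarrow> gen_field S \<subseteq> F"
  unfolding gen_field_def by blast

locale field_hom =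
  fixes F :: "complex set" and \<tau> :: "complex \<Rightarrow> complex"
  assumes subfield: "is_subfield F"
    and hom_1: "\<tau> 1 = 1"
    and hom_add: "x \<in> F \<Longrightarrow> y \<in> F \<Longrightarrow> \<tau> (x + y) = \<tau> x + \<tau> y"
    and hom_mult: "x \<in> F \<Longrightarrow> y \<in> F \<Longrightarrow> \<tau> (x * y) = \<tau> x * \<tau> y"
begin

lemmas closed = subfield_intros[OF subfield]

lemma hom_0: "\<tau> 0 = 0"
  using hom_add[of 0 0] closed by simp

lemma hom_uminus: "x \<in> F \<Longrightarrow> \<tau> (- x) = - \<tau> x"
  using hom_add[of x "- x"] closed by (simp add: hom_0 eq_neg_iff_add_eq_0 add.commute)

lemma hom_diff: "x \<in> F \<Longrightarrow> y \<in> F \<Longrightarrow> \<tau> (x - y) = \<tau> x - \<tau> y"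
  using hom_add[of x "- y"] hom_uminus[of y] closed by simp

lemma hom_inverse: "x \<in> F \<Longrightarrow> \<tau> (inverse x) = inverse (\<tau> x)"
  using hom_mult[of x "inverse x"] closed
  by (cases "x = 0") (auto simp: hom_0 hom_1 inverse_unique)

lemma hom_divide: "x \<in> F \<Longrightarrow> y \<in> F \<Longrightarrow> \<tau> (x / y) = \<tau> x / \<tau> y"
  by (simp add: divide_inverse hom_mult hom_inverse closed)

lemma hom_power: "x \<in> F \<Longrightarrow> \<tau> (x ^ n) = \<tau> x ^ n"
  by (induction n) (auto simp: hom_1 hom_mult closed)

lemma hom_sum: "(\<And>i. i \<in> A \<Longrightarrow> f i \<in> F) \<Longrightarrow> \<tau> (sum f A) = (\<Sum>i\<in>A. \<tau> (f i))"
  by (induction A rule: infinite_finite_induct)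
    (auto simp: hom_0 hom_add subfield_sum[OF subfield])

lemma hom_of_nat: "\<tau> (of_nat n) = of_nat n"
  by (induction n) (auto simp: hom_0 hom_1 hom_add subfield_of_nat[OF subfield] closed)

lemma hom_of_int: "\<tau> (of_int n) = of_int n"
  by (cases n rule: int_cases2) (auto simp: hom_of_nat hom_uminus subfield_of_nat[OF subfield])

lemma hom_Rats: "x \<in> \<rat> \<Longrightarrow> \<tau> x = x"
  by (elim Rats_cases') (auto simp: hom_divide hom_of_int subfield_of_int[OF subfield])

lemma hom_of_rat: "\<tau> (of_rat r) = of_rat r"
  and hom_numeral: "\<tau> (numeral n) = numeral n"
  by (simp_all add: hom_Rats)

lemmas hom_simps = hom_0 hom_1 hom_add hom_mult hom_uminus hom_diff hom_inverse hom_divide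
  hom_power hom_of_rat hom_numeral

lemma hom_eq_0_iff: "x \<in> F \<Longrightarrow> \<tau> x = 0 \<longleftrightarrow> x = 0"
  using hom_mult[of x "inverse x"] closed by (cases "x = 0") (auto simp: hom_0 hom_1)

lemma hom_inj_on: "inj_on \<tau> F"
proof (rule inj_onI)
  fix x y assume "x \<in> F" "y \<in> F" "\<tau> x = \<tau> y"
  then show "x = y" using hom_diff[of x y] hom_eq_0_iff[of "x - y"] closed by simp
qed

lemma field_hom_subfield: "is_subfield K \<Longrightarrow> K \<subseteq> F \<Longrightarrow> field_hom K \<tau>"
  by unfold_locales (simp_all add: hom_1 hom_add hom_mult subset_iff)

lemma is_subfield_image:
  assumes K: "is_subfield K" "K \<subseteq> F"
  shows "is_subfield (\<tau> ` K)"
proof -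
  have "\<exists>z\<in>K. \<tau> x + \<tau> y = \<tau> z" "\<exists>z\<in>K. \<tau> x * \<tau> y = \<tau> z" if "x \<in> K" "y \<in> K" for x y
    using that K hom_add hom_mult subfield_add[OF K(1)] subfield_mult[OF K(1)]
    by (metis subsetD)+
  moreover have "\<exists>z\<in>K. - \<tau> x = \<tau> z" "\<exists>z\<in>K. inverse (\<tau> x) = \<tau> z" if "x \<in> K" for x
    using that K hom_uminus hom_inverse subfield_uminus[OF K(1)] subfield_inverse[OF K(1)]
    by (metis subsetD)+
  moreover have "\<exists>z\<in>K. 0 = \<tau> z" "\<exists>z\<in>K. 1 = \<tau> z"
    using hom_0 hom_1 subfield_0[OF K(1)] subfield_1[OF K(1)] by metis+
  ultimately show ?thesis unfolding is_subfield_def by (auto simp: image_iff)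
qed

lemma is_subfield_preimage:
  assumes "is_subfield K"
  shows "is_subfield {x \<in> F. \<tau> x \<in> K}"
  using subfield_intros[OF assms] closed unfolding is_subfield_def by (auto simp: hom_simps)

lemma image_gen_field:
  assumes "S \<subseteq> F"
  shows "\<tau> ` gen_field S = gen_field (\<tau> ` S)"
proof
  show "gen_field (\<tau> ` S) \<subseteq> \<tau> ` gen_field S"
    using subfield assms gen_field_superset[of S]
    by (intro gen_field_minimal is_subfield_image is_subfield_gen_field image_mono)
  have "gen_field S \<subseteq> {x \<in> F. \<tau> x \<in> gen_field (\<tau> ` S)}"
    using assms gen_field_superset[of "\<tau> ` S"]
    by (intro gen_field_minimal is_subfield_preimage is_subfield_gen_field) blast
  then show "\<tau> ` gen_field S \<subseteq> gen_field (\<tau> ` S)" by auto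
qed

end

lemma field_hom_id: "is_subfield F \<Longrightarrow> field_hom F (\<lambda>x. x)"
  by (simp add: field_hom_def)

lemma field_auts_iff:
  assumes F: "is_subfield F"
  shows "\<tau> \<in> field_auts F \<longleftrightarrow> field_hom F \<tau> \<and> \<tau> ` F = F"
proof
  assume "\<tau> \<in> field_auts F"
  then have bij: "bij_betw \<tau> F F"
    and add: "\<And>x y. x \<in> F \<Longrightarrow> y \<in> F \<Longrightarrow> \<tau> (x + y) = \<tau> x + \<tau> y"
    and mult: "\<And>x y. x \<in> F \<Longrightarrow> y \<in> F \<Longrightarrow> \<tau> (x * y) = \<tau> x * \<tau> y"
    by (auto simp: field_auts_def)
  note zero_one = subfield_0[OF F] subfield_1[OF F]
  have "\<tau> 0 = 0" using add[of 0 0] zero_one by simp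
  then have "\<tau> 1 \<noteq> 0" using bij_betw_imp_inj_on[OF bij] zero_one by (metis inj_on_def zero_neq_one)
  then have "\<tau> 1 = 1" using mult[of 1 1] zero_one by simp
  then show "field_hom F \<tau> \<and> \<tau> ` F = F"
    using F add mult bij by (auto simp: field_hom_def bij_betw_def)
next
  assume "field_hom F \<tau> \<and> \<tau> ` F = F"
  then show "\<tau> \<in> field_auts F"
    using field_hom.hom_inj_on[of F \<tau>] by (auto simp: field_auts_def bij_betw_def field_hom_def)
qed

lemma field_auts_comp: "\<sigma> \<in> field_auts F \<Longrightarrow> \<tau> \<in> field_auts F \<Longrightarrow> \<sigma> \<circ> \<tau> \<in> field_auts F"
  unfolding field_auts_def by (auto simp: bij_betw_trans bij_betw_apply)

lemma field_hom_in_field_auts_gen_field: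
  assumes "field_hom F \<tau>" and S: "S \<subseteq> F" "finite S" "\<tau> ` S \<subseteq> S"
  shows "\<tau> \<in> field_auts (gen_field S)"
proof -
  interpret field_hom F \<tau> by fact
  have "\<tau> ` S = S" using S hom_inj_on by (intro endo_inj_surj) (auto intro: inj_on_subset)
  then have "\<tau> ` gen_field S = gen_field S" using image_gen_field[OF S(1)] by simp
  moreover have "field_hom (gen_field S) \<tau>"
    using S(1) subfield by (intro field_hom_subfield is_subfield_gen_field gen_field_minimal)
  ultimately show ?thesis by (simp add: field_auts_iff is_subfield_gen_field)
qed

section \<open>Minimal polynomials and extension of embeddings\<close>

definition poly_over :: "complex set \<Rightarrow> complex poly \<Rightarrow> bool" where
  "poly_over F p \<longleftrightarrow> (\<forall>i. coeff p i \<in> F)"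

lemma poly_overD: "poly_over F p \<Longrightarrow> coeff p i \<in> F"
  by (simp add: poly_over_def)

context
  fixes F :: "complex set"
  assumes F: "is_subfield F"
begin

lemma poly_over_0: "poly_over F 0"
  and poly_over_add: "poly_over F p \<Longrightarrow> poly_over F q \<Longrightarrow> poly_over F (p + q)"
  and poly_over_diff: "poly_over F p \<Longrightarrow> poly_over F q \<Longrightarrow> poly_over F (p - q)"
  and poly_over_uminus: "poly_over F p \<Longrightarrow> poly_over F (- p)"
  and poly_over_mult: "poly_over F p \<Longrightarrow> poly_over F q \<Longrightarrow> poly_over F (p * q)"
  and poly_over_smult: "c \<in> F \<Longrightarrow> poly_over F p \<Longrightarrow> poly_over F (smult c p)"
  by (auto simp: poly_over_def coeff_mult intro!: subfield_intros[OF F] subfield_sum[OF F])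

lemma poly_over_pCons_iff: "poly_over F (pCons c p) \<longleftrightarrow> c \<in> F \<and> poly_over F p"
  by (auto simp: poly_over_def coeff_pCons split: nat.splits)

lemma poly_over_pderiv: "poly_over F p \<Longrightarrow> poly_over F (pderiv p)"
  by (auto simp: poly_over_def coeff_pderiv simp del: of_nat_Suc
      intro!: subfield_mult[OF F] subfield_of_nat[OF F])

lemma poly_over_div_mod:
  assumes m: "poly_over F m" and p: "poly_over F p"
  shows "poly_over F (p div m) \<and> poly_over F (p mod m)"
  using p
proof (induction p)
  case 0
  then show ?case by (simp add: poly_over_0)
next
  case (pCons a p)
  define c where "c = coeff (pCons a (p mod m)) (degree m) / lead_coeff m"
  have "a \<in> F" and p: "poly_over F (p div m)" "poly_over F (p mod m)"
    using pCons by (simp_all add: poly_over_pCons_iff)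
  then have a: "poly_over F (pCons a (p mod m))" by (simp add: poly_over_pCons_iff)
  then have "c \<in> F" unfolding c_def using m by (intro subfield_divide[OF F]) (auto dest: poly_overD)
  with p a m show ?case
    by (simp add: div_pCons_eq mod_pCons_eq pCons.prems poly_over_0 flip: c_def)
      (simp add: poly_over_pCons_iff poly_over_diff poly_over_smult)
qed

end

definition min_poly_over :: "complex set \<Rightarrow> complex \<Rightarrow> complex poly \<Rightarrow> bool" where
  "min_poly_over F a m \<longleftrightarrow> poly_over F m \<and> m \<noteq> 0 \<and> poly m a = 0 \<and>
     (\<forall>p. poly_over F p \<longrightarrow> poly p a = 0 \<longrightarrow> p \<noteq> 0 \<longrightarrow> degree m \<le> degree p)"

lemma min_poly_overD:
  assumes "min_poly_over F a m"
  shows "poly_over F m" "m \<noteq> 0" "poly m a = 0"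
  using assms by (simp_all add: min_poly_over_def)

lemma min_poly_over_eq_0:
  "min_poly_over F a m \<Longrightarrow> poly_over F p \<Longrightarrow> poly p a = 0 \<Longrightarrow> degree p < degree m \<Longrightarrow> p = 0"
  by (fastforce simp: min_poly_over_def)

lemma min_poly_over_exists:
  assumes "is_subfield F" "algebraic a"
  shows "\<exists>m. min_poly_over F a m"
proof -
  let ?P = "\<lambda>p. poly_over F p \<and> p \<noteq> 0 \<and> poly p a = 0"
  obtain p where "\<forall>i. coeff p i \<in> \<rat>" "p \<noteq> 0" "poly p a = 0"
    using assms(2) by (auto simp: algebraic_altdef)
  then have "?P p" using Rats_subset_subfield[OF assms(1)] by (auto simp: poly_over_def)
  from ex_has_least_nat[of ?P p degree, OF this] show ?thesis by (auto simp: min_poly_over_def)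
qed

lemma min_poly_over_degree_pos:
  assumes "min_poly_over F a m"
  shows "degree m > 0"
  using min_poly_overD[OF assms] by (intro Nat.gr0I) (auto elim: degree_eq_zeroE)

lemma min_poly_over_dvd:
  assumes F: "is_subfield F" and m: "min_poly_over F a m" and p: "poly_over F p" "poly p a = 0"
  shows "p = m * (p div m)"
proof -
  note m' = min_poly_overD[OF m]
  have "poly p a = poly (m * (p div m) + p mod m) a" by simp
  then have "poly (p mod m) a = 0" unfolding poly_add poly_mult using p m' by simp
  moreover have "degree (p mod m) < degree m"
    using degree_mod_less'[of m p] min_poly_over_degree_pos[OF m] m' by force
  ultimately have "p mod m = 0"
    using min_poly_over_eq_0[OF m] poly_over_div_mod[OF F m'(1) p(1)] by blast
  then show ?thesis by (metis add_0_right mult_div_mod_eq)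
qed

text \<open>A multiple root would also be a root of the derivative, against minimality.\<close>

lemma min_poly_over_other_root:
  assumes F: "is_subfield F" and m: "min_poly_over F z m" and z: "z \<notin> F"
  shows "\<exists>b. poly m b = 0 \<and> b \<noteq> z"
proof -
  note m' = min_poly_overD[OF m]
  obtain r where r: "m = [:- z, 1:] * r" using m'(3) by (auto simp: poly_eq_0_iff_dvd)
  have "degree r > 0"
  proof (rule Nat.gr0I)
    assume "degree r = 0"
    then obtain c where "r = [:c:]" by (auto elim: degree_eq_zeroE)
    then have "c \<noteq> 0" "c \<in> F" "- (z * c) \<in> F"
      using r m' by (auto simp: poly_over_pCons_iff[OF F] mult.commute)
    then show False using z subfield_uminus[OF F subfield_divide[OF F, of "- (z * c)" c]] by simp
  qed
  then obtain b where b: "poly r b = 0" using alg_closed_imp_poly_has_root by blast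
  have "b \<noteq> z"
  proof
    assume "b = z"
    then have "poly (pderiv m) z = 0"
      using b unfolding r by (subst pderiv_mult) (simp add: pderiv_pCons)
    then have "pderiv m = 0"
      using min_poly_over_eq_0[OF m poly_over_pderiv[OF F m'(1)]] min_poly_over_degree_pos[OF m]
      by (simp add: degree_pderiv)
    then show False using min_poly_over_degree_pos[OF m] by (simp add: pderiv_eq_0_iff)
  qed
  then show ?thesis using b r by auto
qed

definition simple_extension :: "complex set \<Rightarrow> complex \<Rightarrow> complex set" where
  "simple_extension F a = {poly p a | p. poly_over F p}"

lemma simple_extension_iff: "x \<in> simple_extension F a \<longleftrightarrow> (\<exists>p. poly_over F p \<and> x = poly p a)"
  by (auto simp: simple_extension_def)

lemma simple_extensionI: "poly_over F p \<Longrightarrow> poly p a \<in> simple_extension F a"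
  by (auto simp: simple_extension_iff)

text \<open>Euclid's algorithm: dividing the minimal polynomial by \<open>p\<close> expresses \<open>1 / p(a)\<close> through the
  inverse of the value of a remainder of smaller degree.\<close>

lemma poly_inverse_over:
  assumes F: "is_subfield F" and m: "min_poly_over F a m"
    and "poly_over F p" "poly p a \<noteq> 0" "degree p < degree m"
  shows "\<exists>q. poly_over F q \<and> poly q a * poly p a = 1"
  using assms(3-)
proof (induction "degree p" arbitrary: p rule: less_induct)
  case less
  note m' = min_poly_overD[OF m]
  show ?case
  proof (cases "degree p = 0")
    case True
    then obtain c where "p = [:c:]" by (auto elim: degree_eq_zeroE)
    with less.prems F show ?thesis
      by (intro exI[of _ "[:inverse c:]"])
        (auto simp: poly_over_pCons_iff poly_over_0 subfield_inverse)
  next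
    case False
    have over: "poly_over F (m div p)" "poly_over F (m mod p)"
      using poly_over_div_mod[OF F less.prems(1) m'(1)] by auto
    have deg: "degree (m mod p) < degree p"
      using degree_mod_less'[of p m] False by fastforce
    have "poly (p * (m div p) + m mod p) a = 0" using m'(3) by simp
    then have rem: "poly (m mod p) a = - (poly p a * poly (m div p) a)"
      unfolding poly_add poly_mult by (simp add: add_eq_0_iff)
    have "degree (m div p) < degree m"
      using False less.prems m'(2) by (intro degree_div_less) auto
    moreover have "m div p \<noteq> 0"
      using less.prems m'(2) by (auto simp: div_poly_eq_0_iff)
    ultimately have "poly (m div p) a \<noteq> 0" using min_poly_over_eq_0[OF m over(1)] by blast
    then obtain q where "poly_over F q" "poly q a * poly (m mod p) a = 1"
      using less.hyps[OF deg over(2)] less.prems rem deg by fastforce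
    then show ?thesis
      using over rem
      by (intro exI[of _ "- (q * (m div p))"])
        (simp add: poly_over_uminus[OF F] poly_over_mult[OF F] algebra_simps)
  qed
qed

context
  fixes F :: "complex set" and a :: complex and m :: "complex poly"
  assumes F: "is_subfield F" and m: "min_poly_over F a m"
begin

lemma simple_extension_inverse:
  assumes x: "x \<in> simple_extension F a" "x \<noteq> 0"
  shows "inverse x \<in> simple_extension F a"
proof -
  note m' = min_poly_overD[OF m]
  obtain p where p: "poly_over F p" "x = poly p a" using x by (auto simp: simple_extension_iff)
  have "poly p a = poly (m * (p div m) + p mod m) a" by simp
  then have "poly (p mod m) a = x" unfolding poly_add poly_mult using p m' by simp
  moreover have "degree (p mod m) < degree m"
    using degree_mod_less'[of m p] min_poly_over_degree_pos[OF m] m' by force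
  ultimately obtain q where "poly_over F q" "poly q a * x = 1"
    using poly_inverse_over[OF F m, of "p mod m"] poly_over_div_mod[OF F m'(1) p(1)] x by auto
  then show ?thesis unfolding simple_extension_iff by (metis inverse_unique mult.commute)
qed

lemma simple_extension_superset: "insert a F \<subseteq> simple_extension F a"
proof -
  have "poly [:0, 1:] a \<in> simple_extension F a" "poly [:c:] a \<in> simple_extension F a"
    if "c \<in> F" for c
    using that F by (auto intro!: simple_extensionI
        simp: poly_over_pCons_iff poly_over_0 subfield_0 subfield_1 simp del: poly_pCons)
  then show ?thesis using subfield_0[OF F] by auto
qed

lemma is_subfield_simple_extension: "is_subfield (simple_extension F a)"
proof -
  have "0 \<in> simple_extension F a" "1 \<in> simple_extension F a"
    using simple_extension_superset subfield_0[OF F] subfield_1[OF F] by blast+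
  moreover have "x + y \<in> simple_extension F a" "x * y \<in> simple_extension F a"
    "- x \<in> simple_extension F a"
    if x: "x \<in> simple_extension F a" and y: "y \<in> simple_extension F a" for x y
  proof -
    obtain p q where pq: "poly_over F p" "poly_over F q" "x = poly p a" "y = poly q a"
      using x y by (auto simp: simple_extension_iff)
    show "x + y \<in> simple_extension F a" "x * y \<in> simple_extension F a" "- x \<in> simple_extension F a"
      using simple_extensionI[OF poly_over_add[OF F pq(1,2)], of a]
        simple_extensionI[OF poly_over_mult[OF F pq(1,2)], of a]
        simple_extensionI[OF poly_over_uminus[OF F pq(1)], of a]
      by (simp_all add: pq(3,4))
  qed
  ultimately show ?thesis
    by (simp add: is_subfield_def simple_extension_inverse)
qed

end

context field_hom
begin

lemma map_poly_hom_add: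
  "poly_over F p \<Longrightarrow> poly_over F q \<Longrightarrow> map_poly \<tau> (p + q) = map_poly \<tau> p + map_poly \<tau> q"
  and map_poly_hom_diff:
  "poly_over F p \<Longrightarrow> poly_over F q \<Longrightarrow> map_poly \<tau> (p - q) = map_poly \<tau> p - map_poly \<tau> q"
  and map_poly_hom_mult:
  "poly_over F p \<Longrightarrow> poly_over F q \<Longrightarrow> map_poly \<tau> (p * q) = map_poly \<tau> p * map_poly \<tau> q"
  by (auto intro!: poly_eqI sum.cong
      simp: coeff_map_poly hom_simps poly_over_def coeff_mult hom_sum closed)

context
  fixes a b :: complex and m :: "complex poly"
  assumes m: "min_poly_over F a m" and b: "poly (map_poly \<tau> m) b = 0"
begin

lemma poly_map_poly_cong:
  assumes "poly_over F p" "poly_over F q" "poly p a = poly q a"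
  shows "poly (map_poly \<tau> p) b = poly (map_poly \<tau> q) b"
proof -
  have over: "poly_over F m" "poly_over F (p - q)" "poly_over F ((p - q) div m)"
    using assms m poly_over_diff[OF subfield] poly_over_div_mod[OF subfield]
    by (auto simp: min_poly_over_def)
  have "p - q = m * ((p - q) div m)"
    using assms over by (intro min_poly_over_dvd[OF subfield m]) auto
  then have "map_poly \<tau> p - map_poly \<tau> q = map_poly \<tau> m * map_poly \<tau> ((p - q) div m)"
    using assms over by (metis map_poly_hom_diff map_poly_hom_mult)
  from arg_cong[OF this, of "\<lambda>r. poly r b"] show ?thesis using b by simp
qed

definition adjoin_hom :: "complex \<Rightarrow> complex" where
  "adjoin_hom x = poly (map_poly \<tau> (SOME p. poly_over F p \<and> x = poly p a)) b"

lemma adjoin_hom_poly: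
  assumes "poly_over F p"
  shows "adjoin_hom (poly p a) = poly (map_poly \<tau> p) b"
proof -
  let ?q = "SOME q. poly_over F q \<and> poly p a = poly q a"
  have "poly_over F ?q \<and> poly p a = poly ?q a" by (rule someI[of _ p]) (use assms in simp)
  then show ?thesis unfolding adjoin_hom_def by (intro poly_map_poly_cong[OF _ assms]) auto
qed

lemma adjoin_hom_base: "c \<in> F \<Longrightarrow> adjoin_hom c = \<tau> c"
  using adjoin_hom_poly[of "[:c:]"]
  by (simp add: poly_over_pCons_iff poly_over_0 subfield map_poly_pCons hom_0)

lemma adjoin_hom_generator: "adjoin_hom a = b"
  using adjoin_hom_poly[of "[:0, 1:]"]
  by (simp add: poly_over_pCons_iff poly_over_0 subfield closed map_poly_pCons hom_0 hom_1)

lemma field_hom_adjoin_hom: "field_hom (simple_extension F a) adjoin_hom"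
proof
  show "is_subfield (simple_extension F a)" using is_subfield_simple_extension[OF subfield m] .
  show "adjoin_hom 1 = 1" using adjoin_hom_base closed hom_1 by simp
  fix x y assume "x \<in> simple_extension F a" "y \<in> simple_extension F a"
  then obtain p q where pq: "poly_over F p" "poly_over F q" "x = poly p a" "y = poly q a"
    by (auto simp: simple_extension_iff)
  show "adjoin_hom (x + y) = adjoin_hom x + adjoin_hom y"
    using adjoin_hom_poly[OF poly_over_add[OF subfield pq(1,2)]]
    by (simp add: pq adjoin_hom_poly map_poly_hom_add)
  show "adjoin_hom (x * y) = adjoin_hom x * adjoin_hom y"
    using adjoin_hom_poly[OF poly_over_mult[OF subfield pq(1,2)]]
    by (simp add: pq adjoin_hom_poly map_poly_hom_mult)
qed

lemma field_hom_extend_root: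
  "\<exists>F' \<tau>'. field_hom F' \<tau>' \<and> insert a F \<subseteq> F' \<and> (\<forall>x\<in>F. \<tau>' x = \<tau> x) \<and> \<tau>' a = b"
  using field_hom_adjoin_hom adjoin_hom_base adjoin_hom_generator
    simple_extension_superset[OF subfield m] by blast

end

lemma field_hom_extend_algebraic:
  assumes "algebraic a"
  shows "\<exists>F' \<tau>'. field_hom F' \<tau>' \<and> insert a F \<subseteq> F' \<and> (\<forall>x\<in>F. \<tau>' x = \<tau> x)"
proof -
  obtain m where m: "min_poly_over F a m" using min_poly_over_exists[OF subfield assms] by blast
  have "\<tau> (lead_coeff m) \<noteq> 0"
    using min_poly_overD[OF m] by (simp add: hom_eq_0_iff poly_overD)
  then have "degree (map_poly \<tau> m) > 0"
    using min_poly_over_degree_pos[OF m] by (simp add: map_poly_degree_eq)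
  then obtain b where "poly (map_poly \<tau> m) b = 0" using alg_closed_imp_poly_has_root by blast
  from field_hom_extend_root[OF m this] show ?thesis by blast
qed

end

lemma field_hom_extend:
  assumes "finite S" "\<And>a. a \<in> S \<Longrightarrow> algebraic a" "field_hom F \<tau>"
  shows "\<exists>F' \<tau>'. field_hom F' \<tau>' \<and> F \<union> S \<subseteq> F' \<and> (\<forall>x\<in>F. \<tau>' x = \<tau> x)"
  using assms
proof (induction S rule: finite_induct)
  case empty
  then show ?case by auto
next
  case (insert a S)
  then obtain F1 \<tau>1 where F1: "field_hom F1 \<tau>1" "F \<union> S \<subseteq> F1" "\<forall>x\<in>F. \<tau>1 x = \<tau> x" by auto
  obtain F2 \<tau>2 where F2: "field_hom F2 \<tau>2" "insert a F1 \<subseteq> F2" "\<forall>x\<in>F1. \<tau>2 x = \<tau>1 x"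
    using field_hom.field_hom_extend_algebraic[OF F1(1), of a] insert.prems by auto
  have "F \<union> insert a S \<subseteq> F2" "\<forall>x\<in>F. \<tau>2 x = \<tau> x" using F1(2,3) F2(2,3) by auto
  with F2(1) show ?case by blast
qed

section \<open>Splitting fields of rational polynomials\<close>

lemma coeff_cpoly: "coeff (cpoly p) i = of_rat (coeff p i)"
  by (simp add: cpoly_def coeff_map_poly)

lemma degree_cpoly: "degree (cpoly p) = degree p"
  by (simp add: cpoly_def degree_map_poly)

lemma cpoly_eq_0_iff: "cpoly p = 0 \<longleftrightarrow> p = 0"
  by (auto simp: poly_eq_iff coeff_cpoly)

lemma cpoly_1: "cpoly 1 = 1"
  by (simp add: cpoly_def)

lemma cpoly_pCons: "cpoly (pCons a p) = pCons (of_rat a) (cpoly p)"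
  by (simp add: cpoly_def map_poly_pCons)

lemma cpoly_0: "cpoly 0 = 0"
  by (simp add: cpoly_def)

lemma cpoly_add: "cpoly (p + q) = cpoly p + cpoly q"
  by (simp add: poly_eq_iff coeff_cpoly of_rat_add)

lemma cpoly_mult: "cpoly (p * q) = cpoly p * cpoly q"
  by (simp add: poly_eq_iff coeff_cpoly coeff_mult of_rat_sum of_rat_mult)

lemma cpoly_diff: "cpoly (p - q) = cpoly p - cpoly q"
  by (simp add: poly_eq_iff coeff_cpoly of_rat_diff)

lemma cpoly_smult: "cpoly (smult c p) = smult (of_rat c) (cpoly p)"
  by (simp add: poly_eq_iff coeff_cpoly of_rat_mult)

lemma poly_cpoly_in_subfield: "is_subfield F \<Longrightarrow> x \<in> F \<Longrightarrow> poly (cpoly p) x \<in> F"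
  unfolding poly_altdef coeff_cpoly by (intro subfield_sum subfield_intros)

lemma algebraic_if_root_cpoly: "p \<noteq> 0 \<Longrightarrow> poly (cpoly p) x = 0 \<Longrightarrow> algebraic x"
  by (rule algebraicI'[of "cpoly p"]) (simp_all add: coeff_cpoly cpoly_eq_0_iff)

lemma (in field_hom) hom_poly_cpoly: "x \<in> F \<Longrightarrow> \<tau> (poly (cpoly p) x) = poly (cpoly p) (\<tau> x)"
  unfolding poly_altdef coeff_cpoly by (subst hom_sum) (auto simp: hom_simps closed)

definition splitting_field :: "rat poly \<Rightarrow> complex set" where
  "splitting_field f = gen_field {z. poly (cpoly f) z = 0}"

lemma is_subfield_splitting_field: "is_subfield (splitting_field f)"
  unfolding splitting_field_def by (rule is_subfield_gen_field)

lemma root_in_splitting_field: "poly (cpoly f) z = 0 \<Longrightarrow> z \<in> splitting_field f"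
  unfolding splitting_field_def using gen_field_superset[of "{z. poly (cpoly f) z = 0}"] by blast

context
  fixes f :: "rat poly"
  assumes f: "f \<noteq> 0"
begin

lemma splitting_field_hom_extend:
  assumes "field_hom F \<tau>"
  shows "\<exists>\<tau>'\<in>field_auts (splitting_field f). \<forall>x\<in>F. \<tau>' x = \<tau> x"
proof -
  let ?S = "{z. poly (cpoly f) z = 0}"
  have S: "finite ?S" using f by (simp add: poly_roots_finite cpoly_eq_0_iff)
  obtain F' \<tau>' where F': "field_hom F' \<tau>'" "F \<union> ?S \<subseteq> F'" "\<forall>x\<in>F. \<tau>' x = \<tau> x"
    using field_hom_extend[OF S _ assms] algebraic_if_root_cpoly[OF f] by blast
  interpret field_hom F' \<tau>' by (rule F'(1))
  have "poly (cpoly f) (\<tau>' z) = 0" if "z \<in> ?S" for z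
    using that F'(2) hom_poly_cpoly[of z f] by (auto simp: hom_0)
  then have "\<tau>' \<in> field_auts (splitting_field f)"
    unfolding splitting_field_def using F'(2) S
    by (intro field_hom_in_field_auts_gen_field[OF F'(1)]) auto
  then show ?thesis using F'(3) by blast
qed

lemma Rats_iff_fixed_by_auts:
  assumes z: "algebraic z"
  shows "z \<in> \<rat> \<longleftrightarrow> (\<forall>\<tau>\<in>field_auts (splitting_field f). \<tau> z = z)"
proof (intro iffI ballI)
  fix \<tau> assume "z \<in> \<rat>" "\<tau> \<in> field_auts (splitting_field f)"
  then show "\<tau> z = z"
    using field_hom.hom_Rats[of "splitting_field f"]
    by (simp add: field_auts_iff is_subfield_splitting_field)
next
  assume fixed: "\<forall>\<tau>\<in>field_auts (splitting_field f). \<tau> z = z"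
  show "z \<in> \<rat>"
  proof (rule ccontr)
    assume "z \<notin> \<rat>"
    obtain m where m: "min_poly_over \<rat> z m"
      using min_poly_over_exists[OF is_subfield_Rats z] by blast
    obtain b where b: "poly m b = 0" "b \<noteq> z"
      using min_poly_over_other_root[OF is_subfield_Rats m \<open>z \<notin> \<rat>\<close>] by blast
    interpret field_hom \<rat> "\<lambda>x. x" by (rule field_hom_id[OF is_subfield_Rats])
    obtain F \<tau> where F: "field_hom F \<tau>" "insert z \<rat> \<subseteq> F" "\<tau> z = b"
      using field_hom_extend_root[OF m, of b] b by auto
    then show False using splitting_field_hom_extend[OF F(1)] fixed b(2) by (metis insert_subset)
  qed
qed

lemma image_field_auts_gen_field:
  fixes h :: "(complex \<Rightarrow> complex) \<Rightarrow> 'a"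
  assumes Z: "finite Z" "Z \<subseteq> splitting_field f"
    and stable: "\<And>\<tau>. \<tau> \<in> field_auts (splitting_field f) \<Longrightarrow> \<tau> ` Z \<subseteq> Z"
    and cong: "\<And>\<sigma> \<tau>. (\<And>z. z \<in> Z \<Longrightarrow> \<sigma> z = \<tau> z) \<Longrightarrow> h \<sigma> = h \<tau>"
  shows "h ` field_auts (gen_field Z) = h ` field_auts (splitting_field f)"
proof (intro equalityI image_subsetI)
  fix \<sigma> assume "\<sigma> \<in> field_auts (gen_field Z)"
  then have "field_hom (gen_field Z) \<sigma>" by (simp add: field_auts_iff is_subfield_gen_field)
  then obtain \<tau> where \<tau>: "\<tau> \<in> field_auts (splitting_field f)" "\<forall>x\<in>gen_field Z. \<tau> x = \<sigma> x"
    using splitting_field_hom_extend by blast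
  then have "h \<sigma> = h \<tau>" using gen_field_superset[of Z] by (intro cong) auto
  then show "h \<sigma> \<in> h ` field_auts (splitting_field f)" using \<tau>(1) by blast
next
  fix \<tau> assume \<tau>: "\<tau> \<in> field_auts (splitting_field f)"
  then have "field_hom (splitting_field f) \<tau>"
    by (simp add: field_auts_iff is_subfield_splitting_field)
  then have "\<tau> \<in> field_auts (gen_field Z)"
    using field_hom_in_field_auts_gen_field Z stable[OF \<tau>] by blast
  then show "h \<tau> \<in> h ` field_auts (gen_field Z)" by blast
qed

end

section \<open>The projective line and its linear fractional maps\<close>

text \<open>The point with homogeneous coordinates \<open>(x : z)\<close>; the junk value at \<open>(0, 0)\<close> is the point
  at infinity.\<close>

definition hp :: "complex \<Rightarrow> complex \<Rightarrow> p1" where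
  "hp x z = (if z = 0 then None else Some (x / z))"

lemma Some_eq_hp: "Some w = hp w 1"
  and None_eq_hp: "None = hp 1 0"
  by (simp_all add: hp_def)

lemma hp_eq_iff:
  "x \<noteq> 0 \<or> z \<noteq> 0 \<Longrightarrow> x' \<noteq> 0 \<or> z' \<noteq> 0 \<Longrightarrow> hp x z = hp x' z' \<longleftrightarrow> x * z' = x' * z"
  by (auto simp: hp_def field_simps)

lemma hp_scale: "c \<noteq> 0 \<Longrightarrow> hp (c * x) (c * z) = hp x z"
  by (auto simp: hp_def)

definition proj_line :: "complex set \<Rightarrow> p1 set" where
  "proj_line F = {P. set_option P \<subseteq> F}"

lemma None_in_proj_line: "None \<in> proj_line F"
  and Some_in_proj_line_iff: "Some w \<in> proj_line F \<longleftrightarrow> w \<in> F"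
  by (auto simp: proj_line_def)

lemma hp_in_proj_line: "is_subfield F \<Longrightarrow> x \<in> F \<Longrightarrow> z \<in> F \<Longrightarrow> hp x z \<in> proj_line F"
  by (simp add: hp_def None_in_proj_line Some_in_proj_line_iff subfield_divide)

lemma proj_lineE:
  assumes "is_subfield F" "P \<in> proj_line F"
  obtains x z where "x \<in> F" "z \<in> F" "x \<noteq> 0 \<or> z \<noteq> 0" "P = hp x z"
proof (cases P)
  case None
  then show thesis using that[of 1 0] subfield_0 subfield_1 assms(1) by (simp add: hp_def)
next
  case (Some w)
  then show thesis
    using that[of w 1] subfield_1 assms by (simp add: hp_def Some_in_proj_line_iff)
qed

lemma hp_cases:
  obtains x z where "x \<noteq> 0 \<or> z \<noteq> 0" "P = hp x z"
  using proj_lineE[OF is_subfield_UNIV, of P] by (auto simp: proj_line_def)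

lemma linear_map_nonzero:
  fixes a b c d x z :: "'a :: idom"
  assumes "a * d - b * c \<noteq> 0" "x \<noteq> 0 \<or> z \<noteq> 0"
  shows "a * x + b * z \<noteq> 0 \<or> c * x + d * z \<noteq> 0"
proof (rule ccontr)
  assume "\<not> ?thesis"
  then have "(a * d - b * c) * x = 0" "(a * d - b * c) * z = 0" by algebra+
  then show False using assms by auto
qed

lemma mob_hp:
  assumes "a * d - b * c \<noteq> 0" "x \<noteq> 0 \<or> z \<noteq> 0"
  shows "mob a b c d (hp x z) = hp (a * x + b * z) (c * x + d * z)"
proof (cases "z = 0")
  case True
  then show ?thesis using assms by (auto simp: mob_def hp_def)
next
  case False
  then have "c * (x / z) + d = 0 \<longleftrightarrow> c * x + d * z = 0" by (simp add: field_simps)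
  moreover have "(a * (x / z) + b) / (c * (x / z) + d) = (a * x + b * z) / (c * x + d * z)"
    if "c * x + d * z \<noteq> 0"
    using False that by (simp add: divide_simps)
  ultimately show ?thesis using False by (auto simp: mob_def hp_def)
qed

lemma mob_comp:
  assumes det: "a * d - b * c \<noteq> 0" "a' * d' - b' * c' \<noteq> 0"
  shows "mob a b c d \<circ> mob a' b' c' d' =
      mob (a * a' + b * c') (a * b' + b * d') (c * a' + d * c') (c * b' + d * d')" (is "_ = ?M")
    and "(a * a' + b * c') * (c * b' + d * d') - (a * b' + b * d') * (c * a' + d * c') \<noteq> 0"
proof -
  have "(a * a' + b * c') * (c * b' + d * d') - (a * b' + b * d') * (c * a' + d * c') =
    (a * d - b * c) * (a' * d' - b' * c')" by algebra
  then show det':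
    "(a * a' + b * c') * (c * b' + d * d') - (a * b' + b * d') * (c * a' + d * c') \<noteq> 0"
    using det by simp
  show "mob a b c d \<circ> mob a' b' c' d' = ?M"
  proof
    fix P
    obtain x z where xz: "x \<noteq> 0 \<or> z \<noteq> 0" "P = hp x z" by (rule hp_cases)
    then show "(mob a b c d \<circ> mob a' b' c' d') P = ?M P"
      using mob_hp[OF det(1) linear_map_nonzero[OF det(2) xz(1)]] mob_hp[OF det(2) xz(1)]
        mob_hp[OF det' xz(1)] by (simp add: algebra_simps)
  qed
qed

lemma mob_scalar: "a \<noteq> 0 \<Longrightarrow> mob a 0 0 a = id"
proof
  fix P assume "a \<noteq> 0"
  then show "mob a 0 0 a P = id P" by (cases P) (auto simp: mob_def)
qed

lemma mob_adjugate:
  assumes "a * d - b * c \<noteq> 0"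
  shows "mob a b c d \<circ> mob d (- b) (- c) a = id"
proof -
  have "d * a - (- b) * (- c) \<noteq> 0" using assms by (simp add: algebra_simps)
  from mob_comp(1)[OF assms this] show ?thesis
    using assms mob_scalar[of "a * d - b * c"] by (simp add: algebra_simps)
qed

definition moebius :: "complex set \<Rightarrow> (p1 \<Rightarrow> p1) set" where
  "moebius F = {mob a b c d | a b c d. a \<in> F \<and> b \<in> F \<and> c \<in> F \<and> d \<in> F \<and> a * d - b * c \<noteq> 0}"

lemma mob_in_moebius:
  "a \<in> F \<Longrightarrow> b \<in> F \<Longrightarrow> c \<in> F \<Longrightarrow> d \<in> F \<Longrightarrow> a * d - b * c \<noteq> 0 \<Longrightarrow> mob a b c d \<in> moebius F"
  unfolding moebius_def by blast

lemma moebiusE: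
  assumes "\<sigma> \<in> moebius F"
  obtains a b c d where "a \<in> F" "b \<in> F" "c \<in> F" "d \<in> F" "a * d - b * c \<noteq> 0" "\<sigma> = mob a b c d"
  using assms by (auto simp: moebius_def)

lemma moebius_mono: "F \<subseteq> G \<Longrightarrow> moebius F \<subseteq> moebius G"
  unfolding moebius_def by blast

lemma moebius_comp:
  assumes F: "is_subfield F" and "\<sigma> \<in> moebius F" "\<tau> \<in> moebius F"
  shows "\<sigma> \<circ> \<tau> \<in> moebius F"
proof -
  obtain a b c d where \<sigma>: "a \<in> F" "b \<in> F" "c \<in> F" "d \<in> F" "a * d - b * c \<noteq> 0" "\<sigma> = mob a b c d"
    using assms(2) by (rule moebiusE)
  obtain a' b' c' d' where \<tau>: "a' \<in> F" "b' \<in> F" "c' \<in> F" "d' \<in> F" "a' * d' - b' * c' \<noteq> 0"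
    "\<tau> = mob a' b' c' d'" using assms(3) by (rule moebiusE)
  show ?thesis
    unfolding \<sigma>(6) \<tau>(6) mob_comp(1)[OF \<sigma>(5) \<tau>(5)] using \<sigma> \<tau> mob_comp(2)[OF \<sigma>(5) \<tau>(5)] F
    by (intro mob_in_moebius subfield_add subfield_mult)
qed

lemma moebius_inverse:
  assumes F: "is_subfield F" and "\<sigma> \<in> moebius F"
  obtains \<sigma>' where "\<sigma>' \<in> moebius F" "\<And>P. \<sigma> (\<sigma>' P) = P" "\<And>P. \<sigma>' (\<sigma> P) = P"
proof -
  obtain a b c d where abcd: "a \<in> F" "b \<in> F" "c \<in> F" "d \<in> F" and det: "a * d - b * c \<noteq> 0"
    and \<sigma>: "\<sigma> = mob a b c d" using assms(2) by (rule moebiusE)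
  let ?\<sigma>' = "mob d (- b) (- c) a"
  have det': "d * a - (- b) * (- c) \<noteq> 0" using det by (simp add: algebra_simps)
  show thesis
  proof (rule that)
    show "?\<sigma>' \<in> moebius F" using abcd F det' by (intro mob_in_moebius subfield_uminus)
    show "\<sigma> (?\<sigma>' P) = P" "?\<sigma>' (\<sigma> P) = P" for P
      using fun_cong[OF mob_adjugate[OF det], of P] fun_cong[OF mob_adjugate[OF det'], of P]
      by (simp_all add: \<sigma>)
  qed
qed

lemma moebius_bij: "\<sigma> \<in> moebius F \<Longrightarrow> bij \<sigma>"
  using moebius_mono[of F UNIV] moebius_inverse[OF is_subfield_UNIV, of \<sigma>]
  by (metis bij_iff subset_UNIV subset_iff)

lemma moebius_proj_line:
  assumes F: "is_subfield F" and \<sigma>: "\<sigma> \<in> moebius F" and P: "P \<in> proj_line F"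
  shows "\<sigma> P \<in> proj_line F"
proof -
  obtain x z where xz: "x \<in> F" "z \<in> F" "x \<noteq> 0 \<or> z \<noteq> 0" "P = hp x z" using F P by (rule proj_lineE)
  obtain a b c d where abcd: "a \<in> F" "b \<in> F" "c \<in> F" "d \<in> F" and det: "a * d - b * c \<noteq> 0"
    and \<sigma>: "\<sigma> = mob a b c d" using \<sigma> by (rule moebiusE)
  show ?thesis
    unfolding \<sigma> xz(4) mob_hp[OF det xz(3)] using abcd xz F
    by (intro hp_in_proj_line subfield_add subfield_mult)
qed

lemma binary_quadratic_form_three_zeros:
  fixes p q r :: "'a :: idom"
  assumes "p * x1\<^sup>2 + q * x1 * z1 + r * z1\<^sup>2 = 0"
    and "p * x2\<^sup>2 + q * x2 * z2 + r * z2\<^sup>2 = 0"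
    and "p * x3\<^sup>2 + q * x3 * z3 + r * z3\<^sup>2 = 0"
    and "x1 * z2 \<noteq> x2 * z1" "x1 * z3 \<noteq> x3 * z1" "x2 * z3 \<noteq> x3 * z2"
  shows "p = 0 \<and> q = 0 \<and> r = 0"
proof -
  let ?vandermonde = "(x1 * z2 - x2 * z1) * (x1 * z3 - x3 * z1) * (x2 * z3 - x3 * z2)"
  have "p * ?vandermonde = 0" "q * ?vandermonde = 0" "r * ?vandermonde = 0"
    using assms(1-3) by algebra+
  then show ?thesis using assms(4-6) by simp
qed

lemma moebius_three_fixed_points:
  assumes \<sigma>: "\<sigma> \<in> moebius F" and fixed: "\<sigma> P = P" "\<sigma> Q = Q" "\<sigma> R = R"
    and distinct: "P \<noteq> Q" "P \<noteq> R" "Q \<noteq> R"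
  shows "\<sigma> = id"
proof -
  obtain a b c d where det: "a * d - b * c \<noteq> 0" and \<sigma>: "\<sigma> = mob a b c d"
    using \<sigma> by (rule moebiusE)
  obtain x1 z1 where P: "x1 \<noteq> 0 \<or> z1 \<noteq> 0" "P = hp x1 z1" by (rule hp_cases)
  obtain x2 z2 where Q: "x2 \<noteq> 0 \<or> z2 \<noteq> 0" "Q = hp x2 z2" by (rule hp_cases)
  obtain x3 z3 where R: "x3 \<noteq> 0 \<or> z3 \<noteq> 0" "R = hp x3 z3" by (rule hp_cases)
  have zero: "(- c) * x\<^sup>2 + (a - d) * x * z + b * z\<^sup>2 = 0"
    if "\<sigma> (hp x z) = hp x z" "x \<noteq> 0 \<or> z \<noteq> 0" for x z
    using that linear_map_nonzero[OF det, of x z]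
    by (simp add: \<sigma> mob_hp[OF det] hp_eq_iff algebra_simps power2_eq_square)
  have "- c = 0 \<and> a - d = 0 \<and> b = 0"
    using zero[of x1 z1] zero[of x2 z2] zero[of x3 z3] fixed distinct P Q R hp_eq_iff
    by (intro binary_quadratic_form_three_zeros[of _ x1 _ z1 _ x2 z2 x3 z3]) auto
  then show ?thesis using mob_scalar[of a] det by (simp add: \<sigma>)
qed

lemma moebius_eq_if_three_points:
  assumes "\<sigma> \<in> moebius UNIV" "\<tau> \<in> moebius UNIV" and "\<sigma> P = \<tau> P" "\<sigma> Q = \<tau> Q" "\<sigma> R = \<tau> R"
    and "P \<noteq> Q" "P \<noteq> R" "Q \<noteq> R"
  shows "\<sigma> = \<tau>"
proof -
  obtain \<tau>' where \<tau>': "\<tau>' \<in> moebius UNIV" "\<And>P. \<tau> (\<tau>' P) = P" "\<And>P. \<tau>' (\<tau> P) = P"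
    using moebius_inverse[OF is_subfield_UNIV assms(2)] by blast
  have "\<tau>' \<circ> \<sigma> = id"
    using moebius_comp[OF is_subfield_UNIV \<tau>'(1) assms(1)] assms(3-8) \<tau>'(3)
    by (intro moebius_three_fixed_points[of _ UNIV P Q R]) auto
  then have "\<tau>' (\<sigma> x) = x" for x by (metis comp_apply id_apply)
  then show ?thesis using \<tau>'(2) by (metis ext)
qed

lemma moebius_through_three_points:
  assumes F: "is_subfield F" and PQR: "P \<in> proj_line F" "Q \<in> proj_line F" "R \<in> proj_line F"
    and distinct: "P \<noteq> Q" "P \<noteq> R" "Q \<noteq> R"
  obtains \<sigma> where "\<sigma> \<in> moebius F" "\<sigma> None = P" "\<sigma> (Some 0) = Q" "\<sigma> (Some 1) = R"
proof -
  obtain p1 p2 where p: "p1 \<in> F" "p2 \<in> F" "p1 \<noteq> 0 \<or> p2 \<noteq> 0" "P = hp p1 p2"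
    using F PQR(1) by (rule proj_lineE)
  obtain q1 q2 where q: "q1 \<in> F" "q2 \<in> F" "q1 \<noteq> 0 \<or> q2 \<noteq> 0" "Q = hp q1 q2"
    using F PQR(2) by (rule proj_lineE)
  obtain r1 r2 where r: "r1 \<in> F" "r2 \<in> F" "r1 \<noteq> 0 \<or> r2 \<noteq> 0" "R = hp r1 r2"
    using F PQR(3) by (rule proj_lineE)
  define \<alpha> \<beta> \<delta> where "\<alpha> = r1 * q2 - q1 * r2" and "\<beta> = p1 * r2 - r1 * p2"
    and "\<delta> = p1 * q2 - q1 * p2"
  have "\<alpha> \<noteq> 0" "\<beta> \<noteq> 0" "\<delta> \<noteq> 0"
    using distinct p q r hp_eq_iff by (auto simp: \<alpha>_def \<beta>_def \<delta>_def)
  have cramer: "\<alpha> * p1 + \<beta> * q1 = \<delta> * r1" "\<alpha> * p2 + \<beta> * q2 = \<delta> * r2"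
    by (simp_all add: \<alpha>_def \<beta>_def \<delta>_def algebra_simps)
  have "(\<alpha> * p1) * (\<beta> * q2) - (\<beta> * q1) * (\<alpha> * p2) = \<alpha> * \<beta> * \<delta>"
    by (simp add: \<delta>_def algebra_simps)
  then have det: "(\<alpha> * p1) * (\<beta> * q2) - (\<beta> * q1) * (\<alpha> * p2) \<noteq> 0"
    using \<open>\<alpha> \<noteq> 0\<close> \<open>\<beta> \<noteq> 0\<close> \<open>\<delta> \<noteq> 0\<close> by simp
  let ?\<sigma> = "mob (\<alpha> * p1) (\<beta> * q1) (\<alpha> * p2) (\<beta> * q2)"
  show thesis
  proof (rule that)
    show "?\<sigma> \<in> moebius F"
      using p q r F det unfolding \<alpha>_def \<beta>_def
      by (intro mob_in_moebius subfield_mult subfield_diff)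
    show "?\<sigma> None = P" "?\<sigma> (Some 0) = Q" "?\<sigma> (Some 1) = R"
      using mob_hp[OF det, of 1 0] mob_hp[OF det, of 0 1] mob_hp[OF det, of 1 1]
        hp_scale[OF \<open>\<alpha> \<noteq> 0\<close>] hp_scale[OF \<open>\<beta> \<noteq> 0\<close>] hp_scale[OF \<open>\<delta> \<noteq> 0\<close>]
      by (simp_all add: None_eq_hp Some_eq_hp p q r cramer)
  qed
qed

lemma (in field_hom) map_option_mob:
  assumes abcd: "a \<in> F" "b \<in> F" "c \<in> F" "d \<in> F" and P: "P \<in> proj_line F"
  shows "map_option \<tau> (mob a b c d P) = mob (\<tau> a) (\<tau> b) (\<tau> c) (\<tau> d) (map_option \<tau> P)"
proof -
  have "c * z + d = 0 \<longleftrightarrow> \<tau> c * \<tau> z + \<tau> d = 0" if "z \<in> F" for z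
    using that abcd hom_eq_0_iff[of "c * z + d"] by (simp add: hom_simps closed)
  moreover have "c = 0 \<longleftrightarrow> \<tau> c = 0" using hom_eq_0_iff[OF abcd(3)] by simp
  ultimately show ?thesis
    using abcd P by (cases P) (auto simp: mob_def hom_simps closed Some_in_proj_line_iff)
qed

lemma (in field_hom) map_option_moebius_Rats:
  assumes \<sigma>: "\<sigma> \<in> moebius \<rat>" and P: "P \<in> proj_line F"
  shows "map_option \<tau> (\<sigma> P) = \<sigma> (map_option \<tau> P)"
proof -
  obtain a b c d where "a \<in> \<rat>" "b \<in> \<rat>" "c \<in> \<rat>" "d \<in> \<rat>" "\<sigma> = mob a b c d"
    using \<sigma> by (rule moebiusE)
  then show ?thesis
    using map_option_mob[of a b c d P] P Rats_subset_subfield[OF subfield]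
    by (auto simp: hom_Rats)
qed

lemma lin_conj_Q_iff:
  "lin_conj_Q \<phi> \<psi> \<longleftrightarrow> (\<exists>\<sigma>\<in>moebius \<rat>. \<forall>P. \<sigma> (rf_eval \<psi> P) = rf_eval \<phi> (\<sigma> P))"
proof
  have det: "of_rat a * of_rat d - of_rat b * of_rat c \<noteq> (0 :: complex) \<longleftrightarrow> a * d - b * c \<noteq> 0"
    for a b c d :: rat by (simp flip: of_rat_mult of_rat_diff)
  show "\<exists>\<sigma>\<in>moebius \<rat>. \<forall>P. \<sigma> (rf_eval \<psi> P) = rf_eval \<phi> (\<sigma> P)" if "lin_conj_Q \<phi> \<psi>"
    using that unfolding lin_conj_Q_def by (meson det mob_in_moebius Rats_of_rat)
  assume "\<exists>\<sigma>\<in>moebius \<rat>. \<forall>P. \<sigma> (rf_eval \<psi> P) = rf_eval \<phi> (\<sigma> P)"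
  then obtain a b c d where "a \<in> \<rat>" "b \<in> \<rat>" "c \<in> \<rat>" "d \<in> \<rat>" and ne: "a * d - b * c \<noteq> 0"
    and conj: "\<And>P. mob a b c d (rf_eval \<psi> P) = rf_eval \<phi> (mob a b c d P)"
    by (auto elim!: moebiusE)
  then obtain a' b' c' d' where "a = of_rat a'" "b = of_rat b'" "c = of_rat c'" "d = of_rat d'"
    by (auto elim!: Rats_cases)
  with ne conj show "lin_conj_Q \<phi> \<psi>" unfolding lin_conj_Q_def using det by blast
qed

lemma aut_nontrivialE:
  assumes "aut_nontrivial \<phi>"
  obtains \<sigma> where "\<sigma> \<in> moebius UNIV" "\<sigma> \<noteq> id" "\<And>P. \<sigma> (rf_eval \<phi> P) = rf_eval \<phi> (\<sigma> P)"
proof -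
  obtain a b c d where "a * d - b * c \<noteq> 0" "\<exists>P. mob a b c d P \<noteq> P"
    "\<And>P. mob a b c d (rf_eval \<phi> P) = rf_eval \<phi> (mob a b c d P)"
    using assms unfolding aut_nontrivial_def by blast
  then show thesis by (intro that[of "mob a b c d"] mob_in_moebius) auto
qed

section \<open>Quadratic rational maps in homogeneous coordinates\<close>

definition quad_form :: "complex poly \<Rightarrow> complex \<Rightarrow> complex \<Rightarrow> complex" where
  "quad_form p x z = coeff p 2 * x\<^sup>2 + coeff p 1 * x * z + coeff p 0 * z\<^sup>2"

definition hnum :: "ratfun \<Rightarrow> complex \<Rightarrow> complex \<Rightarrow> complex" where
  "hnum \<phi> = quad_form (cpoly (fst \<phi>))"

definition hden :: "ratfun \<Rightarrow> complex \<Rightarrow> complex \<Rightarrow> complex" where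
  "hden \<phi> = quad_form (cpoly (snd \<phi>))"

lemma quad_form_eq_poly:
  assumes "degree p \<le> 2" "z \<noteq> 0"
  shows "quad_form p x z = z\<^sup>2 * poly p (x / z)"
proof -
  have "poly p y = (\<Sum>i\<le>2. coeff p i * y ^ i)" for y
    unfolding poly_altdef using assms(1)
    by (intro sum.mono_neutral_left) (auto simp: not_le coeff_eq_0)
  then show ?thesis using assms(2) by (simp add: quad_form_def numeral_2_eq_2 field_simps)
qed

lemma degree_le_2_of_rf_deg:
  assumes "rf_deg \<phi> = 2"
  shows "degree (cpoly (fst \<phi>)) \<le> 2" "degree (cpoly (snd \<phi>)) \<le> 2"
  using assms by (simp_all add: rf_deg_def degree_cpoly max_def split: if_splits)

lemma leading_coeffs_nonzero:
  assumes "rf_deg \<phi> = 2"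
  shows "coeff (cpoly (fst \<phi>)) 2 \<noteq> 0 \<or> coeff (cpoly (snd \<phi>)) 2 \<noteq> 0"
proof -
  have "degree (fst \<phi>) = 2 \<or> degree (snd \<phi>) = 2"
    using assms by (auto simp: rf_deg_def max_def split: if_splits)
  then show ?thesis
    by (metis coeff_cpoly degree_0 leading_coeff_0_iff of_rat_eq_0_iff zero_neq_numeral)
qed

lemma rf_eval_hp:
  assumes deg: "rf_deg \<phi> = 2" and xz: "x \<noteq> 0 \<or> z \<noteq> 0"
  shows "rf_eval \<phi> (hp x z) = hp (hnum \<phi> x z) (hden \<phi> x z)"
proof (cases "z = 0")
  case False
  then show ?thesis
    using degree_le_2_of_rf_deg[OF deg]
    by (auto simp: hp_def rf_eval_def Let_def hnum_def hden_def quad_form_eq_poly)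
next
  case True
  let ?p = "cpoly (fst \<phi>)" and ?q = "cpoly (snd \<phi>)"
  have "coeff r 2 = 0 \<longleftrightarrow> degree r < 2" if "degree r \<le> 2" for r :: "complex poly"
    using that leading_coeff_0_iff[of r] by (cases "degree r = 2") (auto simp: coeff_eq_0)
  then have "rf_eval \<phi> None = hp (coeff ?p 2) (coeff ?q 2)"
    using degree_le_2_of_rf_deg[OF deg] leading_coeffs_nonzero[OF deg]
    by (auto simp: hp_def rf_eval_def Let_def)
  then show ?thesis using True xz by (simp add: hp_def hnum_def hden_def quad_form_def)
qed

lemma cpoly_coprime_no_common_root:
  assumes "coprime p q"
  shows "poly (cpoly p) z \<noteq> 0 \<or> poly (cpoly q) z \<noteq> 0"
proof (rule ccontr)
  assume "\<not> ?thesis"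
  then have root: "poly (cpoly p) z = 0" "poly (cpoly q) z = 0" by auto
  let ?P = "\<lambda>r. r \<noteq> 0 \<and> poly (cpoly r) z = 0"
  have "?P p \<or> ?P q" using assms root by auto
  then obtain d where d: "?P d" and least: "\<And>r. ?P r \<Longrightarrow> degree d \<le> degree r"
    using ex_has_least_nat[of ?P _ degree] by metis
  have dvd: "d dvd r" if r: "poly (cpoly r) z = 0" for r
  proof -
    have "cpoly r = cpoly d * cpoly (r div d) + cpoly (r mod d)"
      by (simp flip: cpoly_mult cpoly_add)
    then have "poly (cpoly (r mod d)) z = 0" using r d by simp
    then have "r mod d = 0" using least[of "r mod d"] degree_mod_less'[of d r] d by fastforce
    then show ?thesis by (simp add: mod_eq_0_iff_dvd)
  qed
  have "is_unit d" using assms dvd[OF root(1)] dvd[OF root(2)] by (rule coprime_common_divisor)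
  then obtain c where "d = [:c:]" by (auto simp: is_unit_poly_iff)
  then show False using d by (simp add: cpoly_pCons cpoly_0)
qed

lemma hnum_hden_nonzero:
  assumes "rf_ok \<phi>" and deg: "rf_deg \<phi> = 2" and "x \<noteq> 0 \<or> z \<noteq> 0"
  shows "hnum \<phi> x z \<noteq> 0 \<or> hden \<phi> x z \<noteq> 0"
proof (cases "z = 0")
  case False
  then show ?thesis
    using assms(1) degree_le_2_of_rf_deg[OF deg] cpoly_coprime_no_common_root[of "fst \<phi>" "snd \<phi>"]
    by (simp add: hnum_def hden_def quad_form_eq_poly rf_ok_def)
next
  case True
  then show ?thesis
    using assms(3) leading_coeffs_nonzero[OF deg] by (simp add: hnum_def hden_def quad_form_def)
qed

lemma rf_eval_proj_line:
  assumes F: "is_subfield F" and P: "P \<in> proj_line F"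
  shows "rf_eval \<phi> P \<in> proj_line F"
  using F P by (cases P) (auto simp: rf_eval_def Let_def None_in_proj_line Some_in_proj_line_iff
      coeff_cpoly subfield_intros poly_cpoly_in_subfield)

lemma funpow_conj: "(\<And>P. \<sigma> (f P) = g (\<sigma> P)) \<Longrightarrow> (g ^^ n) (\<sigma> P) = \<sigma> ((f ^^ n) P)"
  by (induction n) simp_all

lemma periodic_pt_conj:
  assumes "\<And>P. \<sigma> (f P) = g (\<sigma> P)" and "inj \<sigma>"
  shows "periodic_pt g n (\<sigma> P) \<longleftrightarrow> periodic_pt f n P"
  using funpow_conj[of \<sigma> f g, OF assms(1)] \<open>inj \<sigma>\<close> by (simp add: periodic_pt_def inj_eq)

lemma periodic_pt_3_iff: "periodic_pt f 3 P \<longleftrightarrow> (f ^^ 3) P = P \<and> f P \<noteq> P"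
proof -
  have "(\<forall>m. 0 < m \<and> m < 3 \<longrightarrow> (f ^^ m) P \<noteq> P) \<longleftrightarrow> f P \<noteq> P \<and> f (f P) \<noteq> P"
    by (auto simp: numeral_3_eq_3 less_Suc_eq)
  then show ?thesis by (auto simp: periodic_pt_def numeral_3_eq_3)
qed

definition hlift :: "ratfun \<Rightarrow> complex \<times> complex \<Rightarrow> complex \<times> complex" where
  "hlift \<phi> = (\<lambda>(x, z). (hnum \<phi> x z, hden \<phi> x z))"

lemma rf_eval_funpow_hp:
  assumes ok: "rf_ok \<phi>" "rf_deg \<phi> = 2" and xz: "x \<noteq> 0 \<or> z \<noteq> 0"
    and iter: "(hlift \<phi> ^^ n) (x, z) = (X, Z)"
  shows "X \<noteq> 0 \<or> Z \<noteq> 0" and "(rf_eval \<phi> ^^ n) (hp x z) = hp X Z"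
proof -
  have "(X \<noteq> 0 \<or> Z \<noteq> 0) \<and> (rf_eval \<phi> ^^ n) (hp x z) = hp X Z"
    using iter
  proof (induction n arbitrary: X Z)
    case 0
    then show ?case using xz by simp
  next
    case (Suc n)
    obtain X' Z' where "(hlift \<phi> ^^ n) (x, z) = (X', Z')" by force
    with Suc show ?case
      using hnum_hden_nonzero[OF ok, of X' Z'] rf_eval_hp[OF ok(2), of X' Z']
      by (auto simp: hlift_def)
  qed
  then show "X \<noteq> 0 \<or> Z \<noteq> 0" "(rf_eval \<phi> ^^ n) (hp x z) = hp X Z" by auto
qed

lemma hlift_funpow_polynomial:
  "\<exists>X Z. \<forall>w. (hlift \<phi> ^^ n) (w, 1) = (poly (cpoly X) w, poly (cpoly Z) w)"
proof (induction n)
  case 0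
  show ?case by (intro exI[of _ "[:0, 1:]"] exI[of _ 1]) (simp add: cpoly_pCons cpoly_0 cpoly_1)
next
  case (Suc n)
  then obtain X Z where IH: "\<And>w. (hlift \<phi> ^^ n) (w, 1) = (poly (cpoly X) w, poly (cpoly Z) w)"
    by blast
  define F where
    "F p = smult (coeff p 2) (X\<^sup>2) + smult (coeff p 1) (X * Z) + smult (coeff p 0) (Z\<^sup>2)" for p
  have "quad_form (cpoly p) (poly (cpoly X) w) (poly (cpoly Z) w) = poly (cpoly (F p)) w" for p w
    by (simp add: F_def quad_form_def power2_eq_square cpoly_add cpoly_mult cpoly_smult coeff_cpoly)
  then have
    "\<forall>w. (hlift \<phi> ^^ Suc n) (w, 1) = (poly (cpoly (F (fst \<phi>))) w, poly (cpoly (F (snd \<phi>))) w)"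
    by (simp add: IH) (simp add: hlift_def hnum_def hden_def)
  then show ?case by blast
qed

lemma algebraic_if_iterate_fixed:
  assumes ok: "rf_ok \<phi>" "rf_deg \<phi> = 2" and w0: "(rf_eval \<phi> ^^ n) (Some w0) \<noteq> Some w0"
    and w: "(rf_eval \<phi> ^^ n) (Some w) = Some w"
  shows "algebraic w"
proof -
  obtain X Z where "\<And>w. (hlift \<phi> ^^ n) (w, 1) = (poly (cpoly X) w, poly (cpoly Z) w)"
    using hlift_funpow_polynomial by blast
  note iter = rf_eval_funpow_hp[OF ok _ this]
  define R where "R = X - pCons 0 Z"
  have root: "poly (cpoly R) y = 0 \<longleftrightarrow> (rf_eval \<phi> ^^ n) (Some y) = Some y" for y
    using iter[of y] hp_eq_iff[of "poly (cpoly X) y" "poly (cpoly Z) y" y 1]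
    by (simp add: R_def cpoly_diff cpoly_pCons Some_eq_hp)
  have "R \<noteq> 0" using root[of w0] w0 by (auto simp: cpoly_0)
  then show ?thesis using root[of w] w by (intro algebraic_if_root_cpoly[of R]) auto
qed

section \<open>Maps with a critical 2-cycle\<close>

lemma quad_form_double_root:
  assumes deg: "degree r \<le> 2" and ord: "order a r \<ge> 2"
  obtains k where "\<And>x z. quad_form r x z = k * (x - a * z)\<^sup>2"
proof -
  have "[:- a, 1:] ^ 2 dvd r" using ord by (simp add: order_divides)
  then obtain w where w: "r = [:- a, 1:] ^ 2 * w" by auto
  have "degree r = 2 + degree w" if "w \<noteq> 0"
    unfolding w using that by (subst degree_mult_eq) (auto simp: degree_power_eq)
  then have "degree w = 0" using deg by (cases "w = 0") auto
  then obtain k where "w = [:k:]" by (auto elim: degree_eq_zeroE)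
  then have "r = [:k * a\<^sup>2, - 2 * k * a, k:]" using w by (simp add: power2_eq_square algebra_simps)
  then show thesis
    by (intro that[of k]) (simp add: quad_form_def power2_eq_square algebra_simps numeral_2_eq_2)
qed

lemma critical_pt_fibre:
  assumes deg: "rf_deg \<phi> = 2" and crit: "critical_pt \<phi> P"
  obtains c\<^sub>1 c\<^sub>2 where "c\<^sub>1 \<noteq> 0 \<or> c\<^sub>2 \<noteq> 0" "rf_eval \<phi> P = hp c\<^sub>1 c\<^sub>2"
    "case P of Some a \<Rightarrow> 2 \<le> order a (smult c\<^sub>2 (cpoly (fst \<phi>)) - smult c\<^sub>1 (cpoly (snd \<phi>)))
      | None \<Rightarrow> degree (smult c\<^sub>2 (cpoly (fst \<phi>)) - smult c\<^sub>1 (cpoly (snd \<phi>))) = 0"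
proof -
  have ram: "2 \<le> rf_ram \<phi> P" using crit by (simp add: critical_pt_def)
  show thesis
  proof (cases "rf_eval \<phi> P")
    case (Some c)
    then show thesis
      using ram deg by (intro that[of c 1])
        (auto simp: rf_ram_def Let_def hp_def split: option.splits)
  next
    case None
    then show thesis
      using ram deg by (intro that[of "- 1" 0])
        (auto simp: rf_ram_def Let_def hp_def split: option.splits)
  qed
qed

lemma critical_pt_quad_form:
  assumes deg: "rf_deg \<phi> = 2" and crit: "critical_pt \<phi> P"
  obtains a\<^sub>1 a\<^sub>2 c\<^sub>1 c\<^sub>2 k
    where "a\<^sub>1 \<noteq> 0 \<or> a\<^sub>2 \<noteq> 0" "P = hp a\<^sub>1 a\<^sub>2" "c\<^sub>1 \<noteq> 0 \<or> c\<^sub>2 \<noteq> 0" "rf_eval \<phi> P = hp c\<^sub>1 c\<^sub>2"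
    "\<And>x z. c\<^sub>2 * hnum \<phi> x z - c\<^sub>1 * hden \<phi> x z = k * (a\<^sub>2 * x - a\<^sub>1 * z)\<^sup>2"
proof -
  let ?p = "cpoly (fst \<phi>)" and ?q = "cpoly (snd \<phi>)"
  define r where "r c\<^sub>1 c\<^sub>2 = smult c\<^sub>2 ?p - smult c\<^sub>1 ?q" for c\<^sub>1 c\<^sub>2
  have r_deg: "degree (r c\<^sub>1 c\<^sub>2) \<le> 2" for c\<^sub>1 c\<^sub>2
    unfolding r_def using degree_le_2_of_rf_deg[OF deg]
    by (intro degree_diff_le order.trans[OF degree_smult_le])
  have r_form: "quad_form (r c\<^sub>1 c\<^sub>2) x z = c\<^sub>2 * hnum \<phi> x z - c\<^sub>1 * hden \<phi> x z" for c\<^sub>1 c\<^sub>2 x z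
    by (simp add: r_def hnum_def hden_def quad_form_def algebra_simps)
  obtain c\<^sub>1 c\<^sub>2 where c: "c\<^sub>1 \<noteq> 0 \<or> c\<^sub>2 \<noteq> 0" "rf_eval \<phi> P = hp c\<^sub>1 c\<^sub>2"
    and r: "case P of Some a \<Rightarrow> 2 \<le> order a (r c\<^sub>1 c\<^sub>2) | None \<Rightarrow> degree (r c\<^sub>1 c\<^sub>2) = 0"
    using deg crit unfolding r_def by (rule critical_pt_fibre)
  show thesis
  proof (cases P)
    case (Some a)
    then have "2 \<le> order a (r c\<^sub>1 c\<^sub>2)" using r by simp
    then obtain k where "\<And>x z. quad_form (r c\<^sub>1 c\<^sub>2) x z = k * (x - a * z)\<^sup>2"
      using quad_form_double_root[OF r_deg] by blast
    with Some c show thesis by (intro that[of a 1 c\<^sub>1 c\<^sub>2 k]) (simp_all add: Some_eq_hp flip: r_form)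
  next
    case None
    then have "quad_form (r c\<^sub>1 c\<^sub>2) x z = coeff (r c\<^sub>1 c\<^sub>2) 0 * z\<^sup>2" for x z
      using r by (simp add: quad_form_def coeff_eq_0)
    with None c show thesis
      by (intro that[of 1 0 c\<^sub>1 c\<^sub>2 "coeff (r c\<^sub>1 c\<^sub>2) 0"]) (simp_all add: None_eq_hp flip: r_form)
  qed
qed

definition two_cycle_map :: "complex \<Rightarrow> complex \<Rightarrow> p1 \<Rightarrow> p1" where
  "two_cycle_map A B P = (case P of
      None \<Rightarrow> Some 0
    | Some x \<Rightarrow> if x = 0 then None else Some ((B * x + A) / x\<^sup>2))"

lemma two_cycle_map_hp:
  assumes "A \<noteq> 0" "s \<noteq> 0 \<or> t \<noteq> 0"
  shows "two_cycle_map A B (hp s t) = hp (B * s * t + A * t\<^sup>2) (s\<^sup>2)"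
  using assms by (auto simp: two_cycle_map_def hp_def field_simps power2_eq_square)

lemma quad_form_linear_combination:
  obtains b where "\<And>s t. quad_form p (s * c\<^sub>1 + t * a\<^sub>1) (s * c\<^sub>2 + t * a\<^sub>2) =
    quad_form p c\<^sub>1 c\<^sub>2 * s\<^sup>2 + b * s * t + quad_form p a\<^sub>1 a\<^sub>2 * t\<^sup>2"
proof (rule that)
  show "quad_form p (s * c\<^sub>1 + t * a\<^sub>1) (s * c\<^sub>2 + t * a\<^sub>2) = quad_form p c\<^sub>1 c\<^sub>2 * s\<^sup>2 +
    (2 * coeff p 2 * c\<^sub>1 * a\<^sub>1 + coeff p 1 * (c\<^sub>1 * a\<^sub>2 + c\<^sub>2 * a\<^sub>1) + 2 * coeff p 0 * c\<^sub>2 * a\<^sub>2) * s * t +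
    quad_form p a\<^sub>1 a\<^sub>2 * t\<^sup>2" for s t
    unfolding quad_form_def by algebra
qed

text \<open>In the coordinates \<open>(s : t)\<close> of \<open>(s c\<^sub>1 + t a\<^sub>1 : s c\<^sub>2 + t a\<^sub>2)\<close> the critical point
  \<open>(a\<^sub>1 : a\<^sub>2)\<close> is \<open>0\<close> and its image \<open>(c\<^sub>1 : c\<^sub>2)\<close> is \<open>\<infinity>\<close>.\<close>

lemma critical_2_cycle_coordinates:
  assumes ok: "rf_ok \<phi>" and deg: "rf_deg \<phi> = 2" and D: "c\<^sub>1 * a\<^sub>2 - a\<^sub>1 * c\<^sub>2 \<noteq> 0"
    and double: "\<And>x z. c\<^sub>2 * hnum \<phi> x z - c\<^sub>1 * hden \<phi> x z = \<alpha> * (a\<^sub>2 * x - a\<^sub>1 * z)\<^sup>2"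
    and cycle: "a\<^sub>2 * hnum \<phi> c\<^sub>1 c\<^sub>2 - a\<^sub>1 * hden \<phi> c\<^sub>1 c\<^sub>2 = 0"
  obtains A B k where "A \<noteq> 0" "k \<noteq> 0"
    "\<And>s t. a\<^sub>2 * hnum \<phi> (c\<^sub>1 * s + a\<^sub>1 * t) (c\<^sub>2 * s + a\<^sub>2 * t) +
      - a\<^sub>1 * hden \<phi> (c\<^sub>1 * s + a\<^sub>1 * t) (c\<^sub>2 * s + a\<^sub>2 * t) = B * s * t + A * t\<^sup>2"
    "\<And>s t. - c\<^sub>2 * hnum \<phi> (c\<^sub>1 * s + a\<^sub>1 * t) (c\<^sub>2 * s + a\<^sub>2 * t) +
      c\<^sub>1 * hden \<phi> (c\<^sub>1 * s + a\<^sub>1 * t) (c\<^sub>2 * s + a\<^sub>2 * t) = k * s\<^sup>2"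
proof -
  define X where "X s t = hnum \<phi> (c\<^sub>1 * s + a\<^sub>1 * t) (c\<^sub>2 * s + a\<^sub>2 * t)" for s t
  define Z where "Z s t = hden \<phi> (c\<^sub>1 * s + a\<^sub>1 * t) (c\<^sub>2 * s + a\<^sub>2 * t)" for s t
  define k where "k = - (\<alpha> * (c\<^sub>1 * a\<^sub>2 - a\<^sub>1 * c\<^sub>2)\<^sup>2)"
  have k: "- c\<^sub>2 * X s t + c\<^sub>1 * Z s t = k * s\<^sup>2" for s t
    using double[of "c\<^sub>1 * s + a\<^sub>1 * t" "c\<^sub>2 * s + a\<^sub>2 * t"] unfolding X_def Z_def k_def by algebra
  obtain b\<^sub>X where X: "\<And>s t. X s t = hnum \<phi> c\<^sub>1 c\<^sub>2 * s\<^sup>2 + b\<^sub>X * s * t + hnum \<phi> a\<^sub>1 a\<^sub>2 * t\<^sup>2"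
    using quad_form_linear_combination[of "cpoly (fst \<phi>)" c\<^sub>1 a\<^sub>1 c\<^sub>2 a\<^sub>2]
    by (auto simp: X_def hnum_def mult.commute)
  obtain b\<^sub>Z where Z: "\<And>s t. Z s t = hden \<phi> c\<^sub>1 c\<^sub>2 * s\<^sup>2 + b\<^sub>Z * s * t + hden \<phi> a\<^sub>1 a\<^sub>2 * t\<^sup>2"
    using quad_form_linear_combination[of "cpoly (snd \<phi>)" c\<^sub>1 a\<^sub>1 c\<^sub>2 a\<^sub>2]
    by (auto simp: Z_def hden_def mult.commute)
  define A B where "A = a\<^sub>2 * X 0 1 - a\<^sub>1 * Z 0 1" and "B = a\<^sub>2 * b\<^sub>X - a\<^sub>1 * b\<^sub>Z"
  have AB: "a\<^sub>2 * X s t + - a\<^sub>1 * Z s t = B * s * t + A * t\<^sup>2" for s t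
    using cycle X[of s t] Z[of s t] X[of 0 1] Z[of 0 1] unfolding A_def B_def
    by (simp add: algebra_simps)
  have D': "a\<^sub>2 * c\<^sub>1 - (- a\<^sub>1) * (- c\<^sub>2) \<noteq> 0" using D by (simp add: mult.commute)
  have XZ_nonzero: "X s t \<noteq> 0 \<or> Z s t \<noteq> 0" if "s \<noteq> 0 \<or> t \<noteq> 0" for s t
    unfolding X_def Z_def by (intro hnum_hden_nonzero ok deg linear_map_nonzero D that)
  have "A \<noteq> 0" "k \<noteq> 0"
    using linear_map_nonzero[OF D' XZ_nonzero, of 0 1] linear_map_nonzero[OF D' XZ_nonzero, of 1 0]
    unfolding AB k by simp_all
  then show thesis using AB k unfolding X_def Z_def by (rule that)
qed

lemma critical_2_cycle_conj:
  assumes ok: "rf_ok \<phi>" and deg: "rf_deg \<phi> = 2"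
    and crit: "critical_pt \<phi> P" and per: "periodic_pt (rf_eval \<phi>) 2 P"
  obtains \<sigma> A B where "\<sigma> \<in> moebius UNIV" "A \<noteq> 0" "\<And>P. rf_eval \<phi> (\<sigma> P) = \<sigma> (two_cycle_map A B P)"
proof -
  obtain a\<^sub>1 a\<^sub>2 c\<^sub>1 c\<^sub>2 \<alpha> where a: "a\<^sub>1 \<noteq> 0 \<or> a\<^sub>2 \<noteq> 0" "P = hp a\<^sub>1 a\<^sub>2"
    and c: "c\<^sub>1 \<noteq> 0 \<or> c\<^sub>2 \<noteq> 0" "rf_eval \<phi> P = hp c\<^sub>1 c\<^sub>2"
    and double: "\<And>x z. c\<^sub>2 * hnum \<phi> x z - c\<^sub>1 * hden \<phi> x z = \<alpha> * (a\<^sub>2 * x - a\<^sub>1 * z)\<^sup>2"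
    using critical_pt_quad_form[OF deg crit] by metis
  have cycle: "rf_eval \<phi> (hp c\<^sub>1 c\<^sub>2) = hp a\<^sub>1 a\<^sub>2" "hp c\<^sub>1 c\<^sub>2 \<noteq> hp a\<^sub>1 a\<^sub>2"
    using per a(2) c(2) by (auto simp: periodic_pt_def numeral_2_eq_2 dest: spec[of _ 1])
  have D: "c\<^sub>1 * a\<^sub>2 - a\<^sub>1 * c\<^sub>2 \<noteq> 0" using cycle(2) hp_eq_iff[OF c(1) a(1)] by simp
  then have D': "a\<^sub>2 * c\<^sub>1 - (- a\<^sub>1) * (- c\<^sub>2) \<noteq> 0" by (simp add: mult.commute)
  have "a\<^sub>2 * hnum \<phi> c\<^sub>1 c\<^sub>2 - a\<^sub>1 * hden \<phi> c\<^sub>1 c\<^sub>2 = 0"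
    using cycle(1) rf_eval_hp[OF deg c(1)] hp_eq_iff[OF hnum_hden_nonzero[OF ok deg c(1)] a(1)]
    by (simp add: mult.commute)
  from critical_2_cycle_coordinates[OF ok deg D double this]
  obtain A B k where Ak: "A \<noteq> 0" "k \<noteq> 0"
    and coordinates: "\<And>s t. a\<^sub>2 * hnum \<phi> (c\<^sub>1 * s + a\<^sub>1 * t) (c\<^sub>2 * s + a\<^sub>2 * t) +
      - a\<^sub>1 * hden \<phi> (c\<^sub>1 * s + a\<^sub>1 * t) (c\<^sub>2 * s + a\<^sub>2 * t) = B * s * t + A * t\<^sup>2"
    "\<And>s t. - c\<^sub>2 * hnum \<phi> (c\<^sub>1 * s + a\<^sub>1 * t) (c\<^sub>2 * s + a\<^sub>2 * t) +
      c\<^sub>1 * hden \<phi> (c\<^sub>1 * s + a\<^sub>1 * t) (c\<^sub>2 * s + a\<^sub>2 * t) = k * s\<^sup>2" by metis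
  let ?\<sigma> = "mob c\<^sub>1 a\<^sub>1 c\<^sub>2 a\<^sub>2" and ?\<sigma>' = "mob a\<^sub>2 (- a\<^sub>1) (- c\<^sub>2) c\<^sub>1"
  show thesis
  proof (rule that)
    show "?\<sigma> \<in> moebius UNIV" using D by (intro mob_in_moebius) simp_all
    show "A / k \<noteq> 0" using Ak by simp
    fix P
    obtain s t where st: "s \<noteq> 0 \<or> t \<noteq> 0" "P = hp s t" by (rule hp_cases)
    have "?\<sigma>' (rf_eval \<phi> (?\<sigma> P)) = hp (B * s * t + A * t\<^sup>2) (k * s\<^sup>2)"
      unfolding st(2) mob_hp[OF D st(1)] rf_eval_hp[OF deg linear_map_nonzero[OF D st(1)]]
        mob_hp[OF D' hnum_hden_nonzero[OF ok deg linear_map_nonzero[OF D st(1)]]] coordinates ..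
    also have "\<dots> = hp (k * (B / k * s * t + A / k * t\<^sup>2)) (k * s\<^sup>2)"
      using Ak by (simp add: distrib_left)
    also have "\<dots> = two_cycle_map (A / k) (B / k) P"
      using two_cycle_map_hp[OF _ st(1)] Ak unfolding st(2) hp_scale[OF Ak(2)] by simp
    finally show "rf_eval \<phi> (?\<sigma> P) = ?\<sigma> (two_cycle_map (A / k) (B / k) P)"
      using fun_cong[OF mob_adjugate[OF D], of "rf_eval \<phi> (?\<sigma> P)"] by simp
  qed
qed

lemma two_cycle_map_2_cycle:
  assumes "A \<noteq> 0" and cycle: "two_cycle_map A B (two_cycle_map A B P) = P" "two_cycle_map A B P \<noteq> P"
  shows "P \<in> {None, Some 0}"
proof (rule ccontr)
  assume "P \<notin> {None, Some 0}"
  then obtain x where x: "P = Some x" "x \<noteq> 0" by (cases P) auto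
  define y where "y = (B * x + A) / x\<^sup>2"
  have y: "two_cycle_map A B P = Some y" using x by (simp add: two_cycle_map_def y_def)
  then have "y \<noteq> 0" "x \<noteq> y" "(B * y + A) / y\<^sup>2 = x"
    using cycle x by (auto simp: two_cycle_map_def split: if_splits)
  then have "x * y\<^sup>2 = B * y + A" by (auto simp: field_simps)
  moreover have "y * x\<^sup>2 = B * x + A" using x by (simp add: y_def)
  ultimately have "(x - y) * (x * y - B) = 0" "A = x * (x * y - B)" by algebra+
  then show False using \<open>x \<noteq> y\<close> \<open>A \<noteq> 0\<close> by simp
qed

text \<open>An automorphism preserves the only 2-cycle \<open>{0, \<infinity>}\<close>. If \<open>B \<noteq> 0\<close> then \<open>0\<close> has the second preimage
  \<open>-A/B\<close> besides \<open>\<infinity>\<close> while \<open>\<infinity>\<close> has only the preimage \<open>0\<close>, so these three points are fixed.\<close>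

lemma two_cycle_map_aut_trivial:
  assumes AB: "A \<noteq> 0" "B \<noteq> 0" and \<sigma>: "\<sigma> \<in> moebius UNIV"
    and comm: "\<And>P. \<sigma> (two_cycle_map A B P) = two_cycle_map A B (\<sigma> P)"
  shows "\<sigma> = id"
proof -
  let ?f = "two_cycle_map A B" and ?w = "Some (- A / B)"
  have f: "?f None = Some 0" "?f (Some 0) = None" "?f ?w = Some 0"
    using AB by (simp_all add: two_cycle_map_def)
  have preimage_0: "P = None \<or> P = ?w" if "?f P = Some 0" for P
  proof (cases P)
    case (Some x)
    then have "B * x = - A"
      using that AB by (auto simp: two_cycle_map_def add_eq_0_iff split: if_splits)
    then show ?thesis using Some AB by (simp add: field_simps)
  qed simp
  have preimage_infinity: "P = Some 0" if "?f P = None" for P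
    using that by (auto simp: two_cycle_map_def split: option.splits if_splits)
  have inj: "\<sigma> P = \<sigma> Q \<longleftrightarrow> P = Q" for P Q using moebius_bij[OF \<sigma>] by (simp add: bij_def inj_eq)
  have "\<sigma> (Some 0) \<in> {None, Some 0}"
    using f comm inj
    by (intro two_cycle_map_2_cycle[OF AB(1), of B]) (metis, metis option.distinct(1))
  moreover have "\<sigma> (Some 0) \<noteq> None"
  proof
    assume infinity: "\<sigma> (Some 0) = None"
    have "?f (\<sigma> ?w) = None" using comm[of ?w] infinity f by simp
    then have "\<sigma> ?w = Some 0" by (rule preimage_infinity)
    moreover have "\<sigma> None = Some 0" using comm[of "Some 0"] infinity f by simp
    ultimately show False using inj[of ?w None] by simp
  qed
  ultimately have fix_0: "\<sigma> (Some 0) = Some 0" by blast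
  have fix_infinity: "\<sigma> None = None" using comm[of "Some 0"] fix_0 f by simp
  have "?f (\<sigma> ?w) = Some 0" using comm[of ?w] fix_0 f by simp
  then have "\<sigma> ?w = ?w" using preimage_0[of "\<sigma> ?w"] fix_infinity inj[of ?w None] by auto
  then show ?thesis
    using AB by (intro moebius_three_fixed_points[OF \<sigma> fix_0 fix_infinity]) auto
qed

lemma conj_inverse_square:
  assumes ok: "rf_ok \<phi>" and deg: "rf_deg \<phi> = 2"
    and crit: "critical_pt \<phi> P" and per: "periodic_pt (rf_eval \<phi>) 2 P" and aut: "aut_nontrivial \<phi>"
  obtains \<sigma> where "\<sigma> \<in> moebius UNIV" "\<And>P. rf_eval \<phi> (\<sigma> P) = \<sigma> (two_cycle_map 1 0 P)"
proof -
  obtain \<sigma> A B where \<sigma>: "\<sigma> \<in> moebius UNIV" "A \<noteq> 0"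
    and conj: "\<And>P. rf_eval \<phi> (\<sigma> P) = \<sigma> (two_cycle_map A B P)"
    using critical_2_cycle_conj[OF ok deg crit per] by blast
  obtain \<sigma>' where \<sigma>': "\<sigma>' \<in> moebius UNIV" "\<And>P. \<sigma> (\<sigma>' P) = P" "\<And>P. \<sigma>' (\<sigma> P) = P"
    using moebius_inverse[OF is_subfield_UNIV \<sigma>(1)] by blast
  obtain \<tau> where \<tau>: "\<tau> \<in> moebius UNIV" "\<tau> \<noteq> id" "\<And>P. \<tau> (rf_eval \<phi> P) = rf_eval \<phi> (\<tau> P)"
    using aut_nontrivialE[OF aut] by blast
  have "B = 0"
  proof (rule ccontr)
    assume "B \<noteq> 0"
    have "\<sigma>' \<circ> \<tau> \<circ> \<sigma> \<in> moebius UNIV" using \<sigma> \<sigma>' \<tau> by (intro moebius_comp is_subfield_UNIV)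
    moreover have "(\<sigma>' \<circ> \<tau> \<circ> \<sigma>) (two_cycle_map A B P) = two_cycle_map A B ((\<sigma>' \<circ> \<tau> \<circ> \<sigma>) P)" for P
      using conj \<sigma>' \<tau>(3) by (metis comp_apply)
    ultimately have "\<sigma>' \<circ> \<tau> \<circ> \<sigma> = id" using two_cycle_map_aut_trivial \<open>A \<noteq> 0\<close> \<open>B \<noteq> 0\<close> by blast
    then have "\<tau> P = P" for P using \<sigma>'(2,3) by (metis comp_apply id_apply)
    then show False using \<tau>(2) by auto
  qed
  obtain w where w: "w ^ 3 = A" using nth_root_exists[of 3 A] by auto
  then have "w \<noteq> 0" using \<open>A \<noteq> 0\<close> by auto
  have scale: "two_cycle_map A 0 (mob w 0 0 1 P) = mob w 0 0 1 (two_cycle_map 1 0 P)" for P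
    using \<open>w \<noteq> 0\<close> w by (cases P)
      (auto simp: two_cycle_map_def mob_def field_simps power2_eq_square power3_eq_cube)
  show thesis
  proof (rule that)
    show "\<sigma> \<circ> mob w 0 0 1 \<in> moebius UNIV"
      using \<sigma>(1) \<open>w \<noteq> 0\<close> by (intro moebius_comp mob_in_moebius is_subfield_UNIV) simp_all
    show "rf_eval \<phi> ((\<sigma> \<circ> mob w 0 0 1) P) = (\<sigma> \<circ> mob w 0 0 1) (two_cycle_map 1 0 P)" for P
      using conj scale \<open>B = 0\<close> by simp
  qed
qed

section \<open>Rational conjugation to the normal form\<close>

definition psi_map :: "complex \<Rightarrow> p1 \<Rightarrow> p1" where
  "psi_map v P = (case P of
      None \<Rightarrow> Some 0
    | Some x \<Rightarrow> if v * x\<^sup>2 = 1 then None else Some ((2 * x - 1) / (v * x\<^sup>2 - 1)))"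

lemma rf_eval_psi: "v \<noteq> 0 \<Longrightarrow> rf_eval (psi v) = psi_map (of_rat v)"
  by (auto simp: fun_eq_iff rf_eval_def psi_def psi_map_def Let_def cpoly_pCons cpoly_0
      of_rat_minus power2_eq_square algebra_simps degree_cpoly split: option.splits)

lemma psi_map_hp:
  assumes "v \<noteq> 0" "x \<noteq> 0 \<or> z \<noteq> 0"
  shows "psi_map v (hp x z) = hp (2 * x * z - z\<^sup>2) (v * x\<^sup>2 - z\<^sup>2)"
proof (cases "z = 0")
  case False
  then have "v * (x / z)\<^sup>2 - 1 = (v * x\<^sup>2 - z\<^sup>2) / z\<^sup>2" "2 * (x / z) - 1 = (2 * x * z - z\<^sup>2) / z\<^sup>2"
    by (simp_all add: field_simps power2_eq_square)
  then show ?thesis using False by (auto simp: psi_map_def hp_def)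
qed (use assms in \<open>simp add: psi_map_def hp_def\<close>)

text \<open>The map carrying a point \<open>s\<close>, its image and its second image under \<open>y \<mapsto> 1/y\<^sup>2\<close> to \<open>\<infinity>, 0, 1\<close>.\<close>

definition orbit_normaliser :: "complex \<Rightarrow> p1 \<Rightarrow> p1" where
  "orbit_normaliser s = mob (s ^ 3) (- s) (1 + s ^ 3) (- (s * (1 + s ^ 3)))"

context
  fixes s :: complex
  assumes s: "s \<noteq> 0" "s ^ 6 \<noteq> 1"
begin

lemma cube_plus_minus_1_nonzero: "1 + s ^ 3 \<noteq> 0" "1 - s ^ 3 \<noteq> 0"
proof -
  have "(1 + s ^ 3) * (1 - s ^ 3) = 1 - s ^ 6" by algebra
  then show "1 + s ^ 3 \<noteq> 0" "1 - s ^ 3 \<noteq> 0" using s by auto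
qed

lemma orbit_normaliser_det: "s ^ 3 * (- (s * (1 + s ^ 3))) - (- s) * (1 + s ^ 3) \<noteq> 0"
proof -
  have "s ^ 3 * (- (s * (1 + s ^ 3))) - (- s) * (1 + s ^ 3) = s * (1 + s ^ 3) * (1 - s ^ 3)"
    by algebra
  then show ?thesis using s cube_plus_minus_1_nonzero by simp
qed

lemma orbit_normaliser_in_moebius: "orbit_normaliser s \<in> moebius UNIV"
  unfolding orbit_normaliser_def using orbit_normaliser_det by (intro mob_in_moebius) simp_all

lemma orbit_normaliser_orbit:
  "orbit_normaliser s (Some s) = None"
  "orbit_normaliser s (Some (1 / s\<^sup>2)) = Some 0"
  "orbit_normaliser s (Some (s ^ 4)) = Some 1"
proof -
  note mob = mob_hp[OF orbit_normaliser_det]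
  show "orbit_normaliser s (Some s) = None"
    using mob[of s 1] by (simp add: orbit_normaliser_def Some_eq_hp hp_def[of _ 0] algebra_simps)
  have "Some (1 / s\<^sup>2) = hp 1 (s\<^sup>2)" using s by (simp add: hp_def)
  then show "orbit_normaliser s (Some (1 / s\<^sup>2)) = Some 0"
    using mob[of 1 "s\<^sup>2"] linear_map_nonzero[OF orbit_normaliser_det, of 1 "s\<^sup>2"]
    by (simp add: orbit_normaliser_def hp_def power2_eq_square power3_eq_cube)
  have "s ^ 3 * s ^ 4 + - s = (1 + s ^ 3) * s ^ 4 + - (s * (1 + s ^ 3))" by algebra
  then show "orbit_normaliser s (Some (s ^ 4)) = Some 1"
    using mob[of "s ^ 4" 1] linear_map_nonzero[OF orbit_normaliser_det, of "s ^ 4" 1]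
    by (simp add: orbit_normaliser_def Some_eq_hp) (simp add: hp_def)
qed

lemma orbit_normaliser_conj:
  assumes v: "v = (1 + s ^ 3)\<^sup>2 / s ^ 3"
  shows "orbit_normaliser s (two_cycle_map 1 0 P) = psi_map v (orbit_normaliser s P)"
proof -
  obtain y t where yt: "y \<noteq> 0 \<or> t \<noteq> 0" "P = hp y t" by (rule hp_cases)
  define x where "x = s ^ 3 * y + - s * t"
  define z where "z = (1 + s ^ 3) * y + - (s * (1 + s ^ 3)) * t"
  define c where "c = (1 + s ^ 3) * (1 - s ^ 3)"
  have v3: "v * s ^ 3 = (1 + s ^ 3)\<^sup>2" and "v \<noteq> 0"
    using s cube_plus_minus_1_nonzero by (simp_all add: v)
  have "s * (2 * x * z - z\<^sup>2) = c * (s ^ 3 * t\<^sup>2 + - s * y\<^sup>2)"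
    unfolding x_def z_def c_def by algebra
  moreover have "s * (v * x\<^sup>2 - z\<^sup>2) = c * ((1 + s ^ 3) * t\<^sup>2 + - (s * (1 + s ^ 3)) * y\<^sup>2)"
    using v3 unfolding x_def z_def c_def by algebra
  moreover have "c \<noteq> 0" using cube_plus_minus_1_nonzero by (simp add: c_def)
  ultimately have "hp (2 * x * z - z\<^sup>2) (v * x\<^sup>2 - z\<^sup>2) =
      hp (s ^ 3 * t\<^sup>2 + - s * y\<^sup>2) ((1 + s ^ 3) * t\<^sup>2 + - (s * (1 + s ^ 3)) * y\<^sup>2)"
    using hp_scale s(1) by metis
  moreover have "psi_map v (orbit_normaliser s P) = hp (2 * x * z - z\<^sup>2) (v * x\<^sup>2 - z\<^sup>2)"
    unfolding yt(2) orbit_normaliser_def mob_hp[OF orbit_normaliser_det yt(1)] x_def z_def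
    by (intro psi_map_hp \<open>v \<noteq> 0\<close> linear_map_nonzero orbit_normaliser_det yt(1))
  moreover have "two_cycle_map 1 0 P = hp (t\<^sup>2) (y\<^sup>2)"
    using two_cycle_map_hp[OF _ yt(1), of 1 0] by (simp add: yt(2))
  moreover have "t\<^sup>2 \<noteq> 0 \<or> y\<^sup>2 \<noteq> 0" using yt(1) by auto
  ultimately show ?thesis
    by (simp only: orbit_normaliser_def mob_hp[OF orbit_normaliser_det])
qed

end

lemma exists_rat_avoiding_finite:
  assumes "finite X" "inj \<sigma>"
  obtains w where "w \<in> (\<rat> :: complex set)" "\<sigma> (Some w) \<notin> X"
proof -
  have "infinite ((\<lambda>w. \<sigma> (Some w)) ` (\<rat> :: complex set))"
    using assms(2) Rats_infinite by (subst finite_image_iff) (auto simp: inj_on_def)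
  then have "\<not> (\<lambda>w. \<sigma> (Some w)) ` (\<rat> :: complex set) \<subseteq> X" using assms(1) finite_subset by blast
  then show thesis using that by blast
qed

lemma exists_rational_orbit:
  assumes conj: "\<And>P. rf_eval \<phi> (\<tau> P) = \<tau> (two_cycle_map 1 0 P)" and \<tau>: "\<tau> \<in> moebius UNIV"
  obtains s where "s \<noteq> 0" "s ^ 6 \<noteq> 1" "\<tau> (Some s) \<in> proj_line \<rat>" "\<tau> (Some (1 / s\<^sup>2)) \<in> proj_line \<rat>"
    "\<tau> (Some (s ^ 4)) \<in> proj_line \<rat>"
proof -
  obtain \<tau>' where \<tau>': "\<tau>' \<in> moebius UNIV" "\<And>P. \<tau> (\<tau>' P) = P"
    using moebius_inverse[OF is_subfield_UNIV \<tau>] by blast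
  have "finite ({None, Some 0} \<union> Some ` {y :: complex. y ^ 6 = 1})"
    using finite_roots_unity[of 6, where 'a = complex] by simp
  moreover have "inj \<tau>'" using moebius_bij[OF \<tau>'(1)] by (rule bij_is_inj)
  ultimately obtain w where w: "w \<in> \<rat>" "\<tau>' (Some w) \<notin> {None, Some 0} \<union> Some ` {y. y ^ 6 = 1}"
    by (rule exists_rat_avoiding_finite)
  then obtain s where s: "\<tau>' (Some w) = Some s" "s \<noteq> 0" "s ^ 6 \<noteq> 1" by (cases "\<tau>' (Some w)") auto
  have step: "\<tau> (two_cycle_map 1 0 P) \<in> proj_line \<rat>" if "\<tau> P \<in> proj_line \<rat>" for P
    using rf_eval_proj_line[OF is_subfield_Rats that, of \<phi>] by (simp add: conj)
  have "two_cycle_map 1 0 (Some s) = Some (1 / s\<^sup>2)"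
    "two_cycle_map 1 0 (Some (1 / s\<^sup>2)) = Some (s ^ 4)"
    using s(2) by (simp_all add: two_cycle_map_def power_divide)
  moreover have "\<tau> (Some s) \<in> proj_line \<rat>"
    using \<tau>'(2)[of "Some w"] s(1) w(1) by (simp add: Some_in_proj_line_iff)
  ultimately show thesis using step[of "Some s"] step[of "Some (1 / s\<^sup>2)"] s by (intro that) simp_all
qed

lemma rational_conj_psi_map:
  assumes conj: "\<And>P. rf_eval \<phi> (\<tau> P) = \<tau> (two_cycle_map 1 0 P)" and \<tau>: "\<tau> \<in> moebius UNIV"
  obtains \<sigma> v where "\<sigma> \<in> moebius \<rat>" "v \<noteq> 0" "v \<noteq> 4" "\<And>P. \<sigma> (psi_map v P) = rf_eval \<phi> (\<sigma> P)"
proof -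
  obtain s where s: "s \<noteq> 0" "s ^ 6 \<noteq> 1" and orbit: "\<tau> (Some s) \<in> proj_line \<rat>"
    "\<tau> (Some (1 / s\<^sup>2)) \<in> proj_line \<rat>" "\<tau> (Some (s ^ 4)) \<in> proj_line \<rat>"
    using conj \<tau> by (rule exists_rational_orbit)
  let ?N = "orbit_normaliser s"
  note N = orbit_normaliser_orbit[OF s] and N_moebius = orbit_normaliser_in_moebius[OF s]
  have distinct: "Some s \<noteq> Some (1 / s\<^sup>2)" "Some s \<noteq> Some (s ^ 4)" "Some (1 / s\<^sup>2) \<noteq> Some (s ^ 4)"
    using N by (metis option.distinct(1) option.inject zero_neq_one)+
  obtain \<sigma> where \<sigma>: "\<sigma> \<in> moebius \<rat>" "\<sigma> None = \<tau> (Some s)" "\<sigma> (Some 0) = \<tau> (Some (1 / s\<^sup>2))"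
    "\<sigma> (Some 1) = \<tau> (Some (s ^ 4))"
    by (rule moebius_through_three_points[OF is_subfield_Rats orbit])
      (use distinct in \<open>auto simp: inj_eq[OF bij_is_inj[OF moebius_bij[OF \<tau>]]]\<close>)
  have "\<sigma> \<in> moebius UNIV" using \<sigma>(1) moebius_mono[of \<rat> UNIV] by blast
  then have "\<sigma> \<circ> ?N \<in> moebius UNIV" using N_moebius by (rule moebius_comp[OF is_subfield_UNIV])
  then have \<tau>_eq: "\<sigma> (?N P) = \<tau> P" for P
    using \<sigma> N moebius_eq_if_three_points[OF _ \<tau> _ _ _ distinct, of "\<sigma> \<circ> ?N"]
    by (auto simp: fun_eq_iff)
  define v where "v = (1 + s ^ 3)\<^sup>2 / s ^ 3"
  show thesis
  proof (rule that)
    show "\<sigma> \<in> moebius \<rat>" by (rule \<sigma>(1))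
    have "(v - 4) * s ^ 3 = (1 - s ^ 3)\<^sup>2"
      using s(1) by (simp add: v_def field_simps power2_eq_square)
    then show "v \<noteq> 0" "v \<noteq> 4" using s(1) cube_plus_minus_1_nonzero[OF s] by (auto simp: v_def)
    fix P
    obtain Q where P: "P = ?N Q" using bij_is_surj[OF moebius_bij[OF N_moebius]] by (metis surjD)
    have "\<sigma> (psi_map v P) = \<tau> (two_cycle_map 1 0 Q)"
      unfolding P orbit_normaliser_conj[OF s v_def, symmetric] by (rule \<tau>_eq)
    also have "\<dots> = rf_eval \<phi> (\<tau> Q)" using conj by simp
    also have "\<tau> Q = \<sigma> P" unfolding P by (rule \<tau>_eq[symmetric])
    finally show "\<sigma> (psi_map v P) = rf_eval \<phi> (\<sigma> P)" .
  qed
qed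

lemma psi_map_parameter_rational:
  assumes \<sigma>: "\<sigma> \<in> moebius \<rat>" and conj: "\<And>P. \<sigma> (psi_map v P) = rf_eval \<phi> (\<sigma> P)"
  shows "v \<in> \<rat>"
proof (cases "v = 1")
  case False
  obtain \<sigma>' where \<sigma>': "\<sigma>' \<in> moebius \<rat>" "\<And>P. \<sigma>' (\<sigma> P) = P"
    using moebius_inverse[OF is_subfield_Rats \<sigma>] by blast
  have "Some 1 \<in> proj_line \<rat>" by (simp add: Some_in_proj_line_iff)
  then have "rf_eval \<phi> (\<sigma> (Some 1)) \<in> proj_line \<rat>"
    using \<sigma> rf_eval_proj_line moebius_proj_line is_subfield_Rats by blast
  then have "\<sigma>' (rf_eval \<phi> (\<sigma> (Some 1))) \<in> proj_line \<rat>"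
    by (rule moebius_proj_line[OF is_subfield_Rats \<sigma>'(1)])
  also have "\<sigma>' (rf_eval \<phi> (\<sigma> (Some 1))) = Some (inverse (v - 1))"
    using False conj[of "Some 1", symmetric] \<sigma>'(2) by (simp add: psi_map_def divide_inverse)
  finally have "inverse (inverse (v - 1)) \<in> \<rat>"
    unfolding Some_in_proj_line_iff by (rule Rats_inverse)
  then have "(v - 1) + 1 \<in> \<rat>" by (intro Rats_add) simp_all
  then show ?thesis by simp
qed simp

lemma lin_conj_psi_exists:
  assumes "rf_ok \<phi>" "rf_deg \<phi> = 2"
    and "critical_pt \<phi> P" "periodic_pt (rf_eval \<phi>) 2 P" and "aut_nontrivial \<phi>"
  shows "\<exists>v. v \<notin> {0, 4} \<and> lin_conj_Q \<phi> (psi v)"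
proof -
  obtain \<tau> where "\<tau> \<in> moebius UNIV" "\<And>P. rf_eval \<phi> (\<tau> P) = \<tau> (two_cycle_map 1 0 P)"
    using conj_inverse_square[OF assms] by blast
  then obtain \<sigma> v where \<sigma>: "\<sigma> \<in> moebius \<rat>" "\<And>P. \<sigma> (psi_map v P) = rf_eval \<phi> (\<sigma> P)"
    and v: "v \<noteq> 0" "v \<noteq> 4" using rational_conj_psi_map by metis
  obtain r where r: "v = of_rat r" using psi_map_parameter_rational[OF \<sigma>] by (auto elim: Rats_cases)
  with v have "r \<noteq> 0" "r \<noteq> 4" by auto
  moreover from this have "lin_conj_Q \<phi> (psi r)"
    unfolding lin_conj_Q_iff using \<sigma> by (auto simp: rf_eval_psi r)
  ultimately show ?thesis by blast
qed

section \<open>The form with rational fixed points and its 3-periodic points\<close>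

lemma mod_3_cases: "n = 0 \<or> n = 1 \<or> n = 2" for n :: 3
proof (cases n rule: bit1_cases)
  case (of_int z)
  then have "z = 0 \<or> z = 1 \<or> z = 2" by auto
  then show ?thesis using of_int by auto
qed

abbreviation "signs \<equiv> {1, - 1 :: 3}"

lemma mod_3_nonzero_cases: "n \<noteq> 0 \<Longrightarrow> n = 1 \<or> n = - 1" for n :: 3
  using mod_3_cases[of n] by auto

text \<open>The form of \<open>y \<mapsto> 1/y\<^sup>2\<close> with fixed points \<open>1, 0, \<infinity>\<close>: its automorphisms, the substitutions
  permuting these points, are defined over \<open>\<rat>\<close>.\<close>

definition split_form :: ratfun where
  "split_form = ([:0, - 2, 1:], [:1, - 2:])"

lemma split_form_ok: "rf_ok split_form"
proof -
  have "coprime [:0, - 2, 1 :: rat:] [:1, - 2:]"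
  proof (rule coprimeI)
    fix d :: "rat poly" assume "d dvd [:0, - 2, 1:]" "d dvd [:1, - 2:]"
    then have "d dvd [:1, - 2:] * [:3, - 2:] - smult 4 [:0, - 2, 1:]"
      by (intro dvd_diff dvd_mult2 dvd_smult)
    also have "[:1, - 2:] * [:3, - 2:] - smult 4 [:0, - 2, 1:] = [:3 :: rat:]" by simp
    finally show "is_unit d" by (rule dvd_trans) (simp add: is_unit_const_poly_iff dvd_field_iff)
  qed
  then show ?thesis by (simp add: rf_ok_def split_form_def)
qed

lemma split_form_deg: "rf_deg split_form = 2"
  by (simp add: rf_deg_def split_form_def)

lemma hnum_split_form: "hnum split_form x z = x\<^sup>2 - 2 * x * z"
  and hden_split_form: "hden split_form x z = z\<^sup>2 - 2 * x * z"
  by (simp_all add: hnum_def hden_def split_form_def quad_form_def coeff_cpoly numeral_2_eq_2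
      of_rat_minus)

lemma rf_eval_split_form_hp:
  "x \<noteq> 0 \<or> z \<noteq> 0 \<Longrightarrow> rf_eval split_form (hp x z) = hp (x\<^sup>2 - 2 * x * z) (z\<^sup>2 - 2 * x * z)"
  using rf_eval_hp[OF split_form_deg] by (simp add: hnum_split_form hden_split_form)

lemma split_form_nonzero:
  "x \<noteq> 0 \<or> z \<noteq> 0 \<Longrightarrow> x\<^sup>2 - 2 * x * z \<noteq> 0 \<or> z\<^sup>2 - 2 * x * z \<noteq> 0" for x z :: complex
  using hnum_hden_nonzero[OF split_form_ok split_form_deg]
  by (simp add: hnum_split_form hden_split_form)

lemma rf_eval_split_form_infinity: "rf_eval split_form None = None"
  using rf_eval_split_form_hp[of 1 0] by (simp add: hp_def)

lemma rf_eval_split_form_fixed_iff: "rf_eval split_form (Some a) = Some a \<longleftrightarrow> a = 0 \<or> a = 1"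
proof -
  have "rf_eval split_form (Some a) = Some a \<longleftrightarrow> a\<^sup>2 - 2 * a = a * (1 - 2 * a)"
    using rf_eval_split_form_hp[of a 1] split_form_nonzero[of a 1]
    by (simp add: Some_eq_hp hp_eq_iff)
  also have "\<dots> \<longleftrightarrow> 3 * (a * (a - 1)) = 0" by (auto simp: algebra_simps power2_eq_square)
  finally show ?thesis by auto
qed

lemma split_form_cube_fixed_iff:
  "(rf_eval split_form ^^ 3) (Some a) = Some a \<longleftrightarrow>
    a = 0 \<or> a = 1 \<or> a ^ 3 - 3 * a + 1 = 0 \<or> a ^ 3 - 3 * a\<^sup>2 + 1 = 0"
proof -
  obtain X Z where XZ: "(hlift split_form ^^ 3) (a, 1) = (X, Z)" by force
  have factorization: "X - a * Z = 9 * (a * (a - 1) * ((a ^ 3 - 3 * a + 1) * (a ^ 3 - 3 * a\<^sup>2 + 1)))"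
  proof -
    define l where "l = (\<lambda>(x, z). (x\<^sup>2 - 2 * x * z, z\<^sup>2 - 2 * x * z :: complex))"
    have "(X, Z) = l (l (l (a, 1)))"
      unfolding XZ[symmetric] numeral_3_eq_3
      by (simp add: hlift_def l_def hnum_split_form hden_split_form)
    then have "X - a * Z = fst (l (l (l (a, 1)))) - a * snd (l (l (l (a, 1))))"
      by (metis fst_conv snd_conv)
    then show ?thesis unfolding l_def prod.case fst_conv snd_conv power_one mult_1_right by algebra
  qed
  have "(rf_eval split_form ^^ 3) (Some a) = Some a \<longleftrightarrow> X - a * Z = 0"
    using rf_eval_funpow_hp[OF split_form_ok split_form_deg _ XZ]
    by (simp add: Some_eq_hp hp_eq_iff)
  then show ?thesis unfolding factorization by auto
qed

lemma finite_split_form_cube_fixed: "finite {P. (rf_eval split_form ^^ 3) P = P}"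
proof (rule finite_subset)
  let ?p = "[:0, 1:] * [:- 1, 1:] * [:1, - 3, 0, 1:] * [:1, 0, - 3, 1 :: complex:]"
  show "finite (insert None (Some ` {a. poly ?p a = 0}))"
    by (intro finite.insertI finite_imageI poly_roots_finite) simp
  have root: "poly ?p a = 0" if "(rf_eval split_form ^^ 3) (Some a) = Some a" for a
    using that unfolding split_form_cube_fixed_iff poly_mult mult_eq_0_iff
    by (auto simp: algebra_simps power2_eq_square power3_eq_cube)
  show "{P. (rf_eval split_form ^^ 3) P = P} \<subseteq> insert None (Some ` {a. poly ?p a = 0})"
  proof
    fix P assume "P \<in> {P. (rf_eval split_form ^^ 3) P = P}"
    then show "P \<in> insert None (Some ` {a. poly ?p a = 0})" using root by (cases P) blast+
  qed
qed

lemma split_form_periodic_3_iff: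
  "periodic_pt (rf_eval split_form) 3 P \<longleftrightarrow>
    (\<exists>a. P = Some a \<and> (a ^ 3 - 3 * a + 1 = 0 \<or> a ^ 3 - 3 * a\<^sup>2 + 1 = 0))"
  by (cases P) (auto simp: periodic_pt_3_iff split_form_cube_fixed_iff rf_eval_split_form_fixed_iff
      rf_eval_split_form_infinity)

text \<open>The roots of \<open>x\<^sup>3 - 3x + 1\<close> are permuted cyclically by \<open>x \<mapsto> 1 - 1/x\<close>.\<close>

definition gamma :: "complex \<Rightarrow> 3 \<Rightarrow> complex" where
  "gamma g n = (if n = 0 then g else if n = 1 then 1 - 1 / g else 1 / (1 - g))"

locale gamma_root =
  fixes g :: complex
  assumes g_root: "g ^ 3 - 3 * g + 1 = 0"
begin

abbreviation "\<gamma> \<equiv> gamma g"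

lemma gamma_add_1: "\<gamma> (n + 1) = 1 - 1 / \<gamma> n"
proof -
  have "g \<noteq> 0" "g \<noteq> 1" using g_root by auto
  then show ?thesis using mod_3_cases[of n] by (auto simp: gamma_def field_simps)
qed

lemma gamma_root: "\<gamma> n ^ 3 - 3 * \<gamma> n + 1 = 0"
proof -
  have step: "\<gamma> (m + 1) ^ 3 - 3 * \<gamma> (m + 1) + 1 = 0" if root: "\<gamma> m ^ 3 - 3 * \<gamma> m + 1 = 0" for m
  proof -
    have "\<gamma> m \<noteq> 0" using root by auto
    then have "\<gamma> m ^ 3 * (\<gamma> (m + 1) ^ 3 - 3 * \<gamma> (m + 1) + 1) = - (\<gamma> m ^ 3 - 3 * \<gamma> m + 1)"
      unfolding gamma_add_1 by (simp add: field_simps power3_eq_cube)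
    then show ?thesis using root \<open>\<gamma> m \<noteq> 0\<close> by simp
  qed
  have "\<gamma> 0 ^ 3 - 3 * \<gamma> 0 + 1 = 0" using g_root by (simp add: gamma_def)
  from this step[OF this] step[OF step[OF this]] show ?thesis
    using mod_3_cases[of n] by auto
qed

lemma gamma_nonzero: "\<gamma> n \<noteq> 0" and gamma_neq_1: "\<gamma> n \<noteq> 1"
  using gamma_root[of n] by auto

lemma gamma_diff_1: "\<gamma> (n - 1) = 1 / (1 - \<gamma> n)"
  using gamma_add_1[of "n - 1"] gamma_nonzero[of "n - 1"] by simp

lemma gamma_mult_gamma_add_1: "\<gamma> n * \<gamma> (n + 1) = \<gamma> n - 1"
  using gamma_nonzero[of n] by (simp add: gamma_add_1 right_diff_distrib)

lemma gamma_eq_iff: "\<gamma> m = \<gamma> n \<longleftrightarrow> m = n"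
proof
  have neq: "\<gamma> (k + 1) \<noteq> \<gamma> k" for k
  proof
    assume "\<gamma> (k + 1) = \<gamma> k"
    then have "\<gamma> k * \<gamma> k = \<gamma> k - 1" using gamma_mult_gamma_add_1[of k] by simp
    then have "3 * \<gamma> k = 0" using gamma_root[of k] by algebra
    then show False using gamma_nonzero by simp
  qed
  assume eq: "\<gamma> m = \<gamma> n"
  show "m = n"
  proof (rule ccontr)
    assume "m \<noteq> n"
    then have "m = n + 1 \<or> n = m + 1"
      using mod_3_nonzero_cases[of "m - n"] by (auto simp: algebra_simps)
    then show False using eq neq by metis
  qed
qed simp

lemma gamma_factorization: "z ^ 3 - 3 * z + 1 = (z - \<gamma> 0) * (z - \<gamma> 1) * (z - \<gamma> 2)"
proof -
  have \<gamma>: "\<gamma> 0 = g" "g * \<gamma> 1 = g - 1" "(1 - g) * \<gamma> 2 = 1"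
    using gamma_nonzero[of 0] gamma_neq_1[of 0] by (simp_all add: gamma_def field_simps)
  have "g * (1 - g) * ((z - \<gamma> 0) * (z - \<gamma> 1) * (z - \<gamma> 2)) =
      (z - \<gamma> 0) * (g * z - g * \<gamma> 1) * ((1 - g) * z - (1 - g) * \<gamma> 2)"
    by (simp add: algebra_simps)
  also have "\<dots> = g * (1 - g) * (z ^ 3 - 3 * z + 1)" unfolding \<gamma> using g_root by algebra
  finally show ?thesis using gamma_nonzero[of 0] gamma_neq_1[of 0] \<gamma>(1) by simp
qed

lemma root_iff_gamma: "z ^ 3 - 3 * z + 1 = 0 \<longleftrightarrow> z \<in> range \<gamma>"
  using gamma_root unfolding gamma_factorization by auto

definition cycle_pt :: "3 \<Rightarrow> 3 \<Rightarrow> complex" where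
  "cycle_pt n s = (if s = 1 then \<gamma> n else 1 / \<gamma> n)"

lemma cycle_pt_nonzero: "cycle_pt n s \<noteq> 0"
  using gamma_nonzero by (simp add: cycle_pt_def)

lemma inverse_cycle_pt: "s \<in> signs \<Longrightarrow> 1 / cycle_pt n s = cycle_pt n (- s)"
  by (auto simp: cycle_pt_def)

lemma rotate_cycle_pt: "s \<in> signs \<Longrightarrow> 1 - 1 / cycle_pt n s = cycle_pt (n + s) s"
  using gamma_neq_1[of n] by (auto simp: cycle_pt_def gamma_add_1 gamma_diff_1)

lemma inverse_root_iff:
  fixes z :: complex
  assumes "z \<noteq> 0"
  shows "z ^ 3 - 3 * z\<^sup>2 + 1 = 0 \<longleftrightarrow> (1 / z) ^ 3 - 3 * (1 / z) + 1 = 0"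
proof -
  have "z ^ 3 * ((1 / z) ^ 3 - 3 * (1 / z) + 1) = z ^ 3 - 3 * z\<^sup>2 + 1"
    using assms by (simp add: field_simps power2_eq_square power3_eq_cube)
  then show ?thesis using assms by (metis mult_eq_0_iff power_eq_0_iff)
qed

lemma cycle_pt_range:
  "(\<exists>n. \<exists>s\<in>signs. z = cycle_pt n s) \<longleftrightarrow> z ^ 3 - 3 * z + 1 = 0 \<or> z ^ 3 - 3 * z\<^sup>2 + 1 = 0"
proof -
  have "z ^ 3 - 3 * z\<^sup>2 + 1 = 0 \<longleftrightarrow> (\<exists>n. z = 1 / \<gamma> n)"
  proof (cases "z = 0")
    case False
    then have "z = 1 / \<gamma> n \<longleftrightarrow> 1 / z = \<gamma> n" for n using gamma_nonzero[of n]
      by (auto simp: field_simps)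
    then show ?thesis unfolding inverse_root_iff[OF False] root_iff_gamma image_iff by simp
  qed (use gamma_nonzero in simp)
  then show ?thesis using root_iff_gamma by (auto simp: cycle_pt_def)
qed

lemma cycle_pt_eq_iff:
  assumes "s \<in> signs" "s' \<in> signs"
  shows "cycle_pt n s = cycle_pt n' s' \<longleftrightarrow> n = n' \<and> s = s'"
proof -
  have "\<gamma> m \<noteq> 1 / \<gamma> n" for m n
  proof
    assume "\<gamma> m = 1 / \<gamma> n"
    then have "\<gamma> m ^ 3 - 3 * (\<gamma> m)\<^sup>2 + 1 = 0"
      using inverse_root_iff[of "\<gamma> m"] gamma_nonzero[of n] gamma_root[of n] by simp
    then have "3 * (\<gamma> m * (\<gamma> m - 1)) = 0" using gamma_root[of m] by algebra
    then show False using gamma_nonzero gamma_neq_1 by simp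
  qed
  then show ?thesis using assms gamma_eq_iff by (auto simp: cycle_pt_def) metis+
qed

lemma split_form_cycle_pt:
  assumes "s \<in> signs"
  shows "rf_eval split_form (Some (cycle_pt n s)) = Some (cycle_pt (n + 1) s)"
proof -
  let ?a = "\<gamma> n"
  have "(?a\<^sup>2 - 2 * ?a) * ?a = (?a - 1) * (1 - 2 * ?a)" using gamma_root[of n] by algebra
  moreover have "\<gamma> (n + 1) = (?a - 1) / ?a"
    using gamma_nonzero[of n] by (simp add: gamma_add_1 diff_divide_distrib)
  ultimately have "rf_eval split_form (Some ?a) = Some (\<gamma> (n + 1))"
    "rf_eval split_form (Some (1 / ?a)) = Some (1 / \<gamma> (n + 1))"
    using rf_eval_split_form_hp[of ?a 1] rf_eval_split_form_hp[of 1 ?a] split_form_nonzero[of ?a 1]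
      hp_eq_iff[of "?a\<^sup>2 - 2 * ?a" "1 - 2 * ?a" "?a - 1" ?a]
      hp_eq_iff[of "1 - 2 * ?a" "?a\<^sup>2 - 2 * ?a" ?a "?a - 1"]
      gamma_nonzero[of n] gamma_neq_1[of n]
    by (auto simp: hp_def algebra_simps split: if_splits)
  then show ?thesis using assms by (auto simp: cycle_pt_def)
qed

end

section \<open>Frames adapted to the fixed points\<close>

definition discriminant_root :: "(3 \<Rightarrow> complex) \<Rightarrow> complex" where
  "discriminant_root t = (t 0 - t 1) * (t 1 - t 2) * (t 2 - t 0)"

lemma discriminant_root_nonzero_iff: "discriminant_root t \<noteq> 0 \<longleftrightarrow> inj t"
proof
  assume nonzero: "discriminant_root t \<noteq> 0"
  show "inj t"
  proof (rule injI)
    fix m n assume "t m = t n"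
    then show "m = n"
      using nonzero mod_3_cases[of m] mod_3_cases[of n] by (auto simp: discriminant_root_def)
  qed
qed (simp add: discriminant_root_def inj_eq)

text \<open>The map carrying \<open>1, 0, \<infinity>\<close> to \<open>1/t\<^sub>0, 1/t\<^sub>1, 1/t\<^sub>2\<close>.\<close>

definition frame :: "(3 \<Rightarrow> complex) \<Rightarrow> p1 \<Rightarrow> p1" where
  "frame t = mob (t 0 - t 1) (t 2 - t 0) (t 2 * (t 0 - t 1)) (t 1 * (t 2 - t 0))"

context
  fixes t :: "3 \<Rightarrow> complex"
  assumes t: "inj t"
begin

lemma frame_det: "(t 0 - t 1) * (t 1 * (t 2 - t 0)) - (t 2 - t 0) * (t 2 * (t 0 - t 1)) \<noteq> 0"
proof -
  have "(t 0 - t 1) * (t 1 * (t 2 - t 0)) - (t 2 - t 0) * (t 2 * (t 0 - t 1)) =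
    discriminant_root t" unfolding discriminant_root_def by algebra
  then show ?thesis using t by (simp add: discriminant_root_nonzero_iff)
qed

lemma frame_hp:
  assumes "x \<noteq> 0 \<or> z \<noteq> 0"
  shows "frame t (hp x z) = hp ((t 0 - t 1) * x + (t 2 - t 0) * z)
    (t 2 * (t 0 - t 1) * x + t 1 * (t 2 - t 0) * z)"
  unfolding frame_def using mob_hp[OF frame_det assms] .

lemma frame_in_moebius: "frame t \<in> moebius UNIV"
  unfolding frame_def using frame_det by (intro mob_in_moebius) simp_all

end

lemma frame_reflect:
  assumes "inj t" "x \<noteq> 0 \<or> z \<noteq> 0"
  shows "frame (\<lambda>n. t (- n)) (hp x z) = frame t (hp z x)"
proof -
  have "inj (\<lambda>n. t (- n))" by (rule injI) (simp add: inj_eq[OF assms(1)])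
  note frame_hp[OF this assms(2)]
  moreover have "frame t (hp z x) =
      hp ((t 0 - t 1) * z + (t 2 - t 0) * x) (t 2 * (t 0 - t 1) * z + t 1 * (t 2 - t 0) * x)"
    using assms by (intro frame_hp) auto
  moreover have "- 1 = (2 :: 3)" "- 2 = (1 :: 3)" by simp_all
  ultimately show ?thesis
    using hp_scale[of "- 1" "(t 0 - t 1) * z + (t 2 - t 0) * x"
      "t 2 * (t 0 - t 1) * z + t 1 * (t 2 - t 0) * x"]
    by (simp add: algebra_simps)
qed

lemma frame_rotate:
  assumes "inj t" "x \<noteq> 0 \<or> z \<noteq> 0"
  shows "frame (\<lambda>n. t (n + 1)) (hp x z) = frame t (hp (x - z) x)"
proof -
  have "inj (\<lambda>n. t (n + 1))" by (rule injI) (simp add: inj_eq[OF assms(1)])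
  note frame_hp[OF this assms(2)]
  moreover have "frame t (hp (x - z) x) =
      hp ((t 0 - t 1) * (x - z) + (t 2 - t 0) * x)
        (t 2 * (t 0 - t 1) * (x - z) + t 1 * (t 2 - t 0) * x)"
    using assms by (intro frame_hp) auto
  moreover have "1 + 1 = (2 :: 3)" "2 + 1 = (0 :: 3)" by simp_all
  ultimately show ?thesis
    using hp_scale[of "- 1" "(t 0 - t 1) * (x - z) + (t 2 - t 0) * x"
      "t 2 * (t 0 - t 1) * (x - z) + t 1 * (t 2 - t 0) * x"]
    by (simp only: add_0_left) (simp add: algebra_simps)
qed

context gamma_root
begin

lemma frame_reflect_cycle_pt:
  assumes "inj t" "s \<in> signs"
  shows "frame (\<lambda>n. t (- n)) (Some (cycle_pt m s)) = frame t (Some (cycle_pt m (- s)))"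
  using frame_reflect[OF assms(1), of "cycle_pt m s" 1] inverse_cycle_pt[OF assms(2), of m]
    cycle_pt_nonzero[of m s] by (simp add: hp_def)

lemma frame_rotate_cycle_pt:
  assumes "inj t" "s \<in> signs"
  shows "frame (\<lambda>n. t (n + c)) (Some (cycle_pt m s)) = frame t (Some (cycle_pt (m + s * c) s))"
proof -
  have rotate: "frame (\<lambda>n. t' (n + 1)) (Some (cycle_pt m s)) = frame t' (Some (cycle_pt (m + s) s))"
    if "inj t'" for t' m
    using frame_rotate[OF that, of "cycle_pt m s" 1] rotate_cycle_pt[OF assms(2), of m]
      cycle_pt_nonzero[of m s] by (simp add: hp_def diff_divide_distrib)
  have "inj (\<lambda>n. t (n + 1))" by (rule injI) (simp add: inj_eq[OF assms(1)])
  from rotate[OF this, of m] rotate[OF assms(1)]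
  have "frame (\<lambda>n. t (n + 2)) (Some (cycle_pt m s)) = frame t (Some (cycle_pt (m + s * 2) s))"
    by (simp add: add.assoc mult_2_right)
  then show ?thesis using mod_3_cases[of c] rotate[OF assms(1)] by auto
qed

lemma frame_affine_cycle_pt:
  assumes "inj t" "u \<in> signs" "s \<in> signs"
  shows "frame (\<lambda>n. t (u * n + c)) (Some (cycle_pt m s)) =
    frame t (Some (cycle_pt (m + u * s * c) (u * s)))"
proof -
  have "inj (\<lambda>n. t (n + c))" by (rule injI) (simp add: inj_eq[OF assms(1)])
  from frame_reflect_cycle_pt[OF this assms(3)]
  have "frame (\<lambda>n. t (u * n + c)) (Some (cycle_pt m s)) =
      frame (\<lambda>n. t (n + c)) (Some (cycle_pt m (u * s)))" using assms(2) by auto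
  then show ?thesis using frame_rotate_cycle_pt[OF assms(1), of "u * s"] assms(2,3) by auto
qed

end

lemma frame_conj_psi_map:
  assumes t_sum: "t 0 + t 1 + t 2 = 3" and t_pair_sum: "t 0 * t 1 + t 1 * t 2 + t 2 * t 0 = 0"
    and t_prod: "t 0 * t 1 * t 2 = - v" and "v \<noteq> 0" and t: "inj t"
  shows "frame t (rf_eval split_form P) = psi_map v (frame t P)"
proof -
  obtain x z where xz: "x \<noteq> 0 \<or> z \<noteq> 0" "P = hp x z" by (rule hp_cases)
  define X where "X = (t 0 - t 1) * x + (t 2 - t 0) * z"
  define Z where "Z = t 2 * (t 0 - t 1) * x + t 1 * (t 2 - t 0) * z"
  have P: "frame t P = hp X Z" and XZ: "X \<noteq> 0 \<or> Z \<noteq> 0"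
    using frame_hp[OF t xz(1)] linear_map_nonzero[OF frame_det[OF t] xz(1)]
    by (simp_all add: xz X_def Z_def)
  have t2: "t 2 = 3 - t 0 - t 1" using t_sum by (simp add: algebra_simps)
  have num: "3 * (2 * X * Z - Z\<^sup>2) =
      discriminant_root t * ((t 0 - t 1) * (x\<^sup>2 - 2 * x * z) + (t 2 - t 0) * (z\<^sup>2 - 2 * x * z))"
    using t_pair_sum unfolding X_def Z_def discriminant_root_def t2 by algebra
  have den: "3 * (v * X\<^sup>2 - Z\<^sup>2) =
      discriminant_root t *
        (t 2 * (t 0 - t 1) * (x\<^sup>2 - 2 * x * z) + t 1 * (t 2 - t 0) * (z\<^sup>2 - 2 * x * z))"
    using t_pair_sum t_prod unfolding X_def Z_def discriminant_root_def t2 by algebra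
  have nonzero: "discriminant_root t \<noteq> 0" using t by (simp add: discriminant_root_nonzero_iff)
  have "psi_map v (frame t P) = hp (3 * (2 * X * Z - Z\<^sup>2)) (3 * (v * X\<^sup>2 - Z\<^sup>2))"
    unfolding P psi_map_hp[OF \<open>v \<noteq> 0\<close> XZ] by (rule hp_scale[symmetric]) simp
  also have "\<dots> = frame t (rf_eval split_form P)"
    unfolding num den hp_scale[OF nonzero] xz(2) rf_eval_split_form_hp[OF xz(1)]
      frame_hp[OF t split_form_nonzero[OF xz(1)]] ..
  finally show ?thesis ..
qed

section \<open>Labelling the 3-periodic points\<close>

definition cycle_sign :: "nat \<Rightarrow> 3" where
  "cycle_sign i = (if i < 3 then 1 else - 1)"

definition label :: "3 \<Rightarrow> 3 \<Rightarrow> nat" where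
  "label n s = (if n = 0 then 0 else if n = 1 then 1 else 2) + (if s = 1 then 0 else 3)"

lemma cycle_sign_in_signs: "cycle_sign i \<in> signs"
  by (simp add: cycle_sign_def)

lemma less_6_cases: "(i::nat) < 6 \<Longrightarrow> i = 0 \<or> i = 1 \<or> i = 2 \<or> i = 3 \<or> i = 4 \<or> i = 5"
  by linarith

lemma label_less_6: "label n s < 6"
  by (simp add: label_def)

lemma of_nat_label: "of_nat (label n s) = n"
  using mod_3_cases[of n] by (auto simp: label_def)

lemma cycle_sign_label: "s \<in> signs \<Longrightarrow> cycle_sign (label n s) = s"
  by (auto simp: label_def cycle_sign_def)

lemma label_of_nat_cycle_sign: "i < 6 \<Longrightarrow> label (of_nat i) (cycle_sign i) = i"
  by (drule less_6_cases) (auto simp: label_def cycle_sign_def)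

lemma pi6_label: "s \<in> signs \<Longrightarrow> pi6 (label n s) = label (n + 1) s"
  using mod_3_cases[of n] by (auto simp: label_def pi6_def perm_of_list_def)

text \<open>The data turning \<open>\<phi>\<close> into \<open>\<psi>\<^sub>v\<close> over \<open>\<rat>\<close> and \<open>\<psi>\<^sub>v\<close> into the form with rational fixed points
  over \<open>\<complex>\<close>; the numbers \<open>t\<^sub>0, t\<^sub>1, t\<^sub>2\<close> are the roots of \<open>x\<^sup>3 - 3x\<^sup>2 + v\<close>.\<close>

locale psi_frame = gamma_root g for g +
  fixes \<phi> :: ratfun and v :: rat and \<sigma> :: "p1 \<Rightarrow> p1" and t :: "3 \<Rightarrow> complex"
  assumes ok: "rf_ok \<phi>" and deg: "rf_deg \<phi> = 2" and v: "v \<noteq> 0" "v \<noteq> 4"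
    and \<sigma>: "\<sigma> \<in> moebius \<rat>" and \<sigma>_conj: "\<sigma> (psi_map (of_rat v) P) = rf_eval \<phi> (\<sigma> P)"
    and t_sum: "t 0 + t 1 + t 2 = 3" and t_pair_sum: "t 0 * t 1 + t 1 * t 2 + t 2 * t 0 = 0"
    and t_prod: "t 0 * t 1 * t 2 = - of_rat v"
begin

lemma t_factorization: "z ^ 3 - 3 * z\<^sup>2 + of_rat v = (z - t 0) * (z - t 1) * (z - t 2)"
proof -
  have "(z - t 0) * (z - t 1) * (z - t 2) = z ^ 3 - (t 0 + t 1 + t 2) * z\<^sup>2 +
      (t 0 * t 1 + t 1 * t 2 + t 2 * t 0) * z - t 0 * t 1 * t 2"
    by algebra
  then show ?thesis unfolding t_sum t_pair_sum t_prod by simp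
qed

lemma root_iff_t: "z ^ 3 - 3 * z\<^sup>2 + of_rat v = 0 \<longleftrightarrow> z \<in> range t"
proof -
  have "range t = {t 0, t 1, t 2}" using mod_3_cases by (auto simp: image_def) metis
  then show ?thesis unfolding t_factorization by auto
qed

lemma discriminant_root_square: "(discriminant_root t)\<^sup>2 = of_rat (27 * v * (4 - v))"
proof -
  let ?s1 = "t 0 + t 1 + t 2" and ?s2 = "t 0 * t 1 + t 1 * t 2 + t 2 * t 0"
    and ?s3 = "t 0 * t 1 * t 2"
  have "(discriminant_root t)\<^sup>2 =
      ?s1\<^sup>2 * ?s2\<^sup>2 - 4 * ?s2 ^ 3 - 4 * ?s1 ^ 3 * ?s3 + 18 * ?s1 * ?s2 * ?s3 - 27 * ?s3\<^sup>2"
    unfolding discriminant_root_def by algebra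
  also have "\<dots> = of_rat (27 * v * (4 - v))"
    unfolding t_sum t_pair_sum t_prod
    by (simp add: of_rat_mult of_rat_diff power2_eq_square algebra_simps)
  finally show ?thesis .
qed

lemma discriminant_root_nonzero: "discriminant_root t \<noteq> 0"
proof -
  have "27 * v * (4 - v) \<noteq> 0" using v by simp
  then have "(discriminant_root t)\<^sup>2 \<noteq> 0" unfolding discriminant_root_square of_rat_eq_0_iff .
  then show ?thesis by simp
qed

lemma inj_t: "inj t"
  using discriminant_root_nonzero by (simp only: discriminant_root_nonzero_iff)

definition chart :: "p1 \<Rightarrow> p1" where
  "chart P = \<sigma> (frame t P)"

lemma chart_conj: "chart (rf_eval split_form P) = rf_eval \<phi> (chart P)"
  unfolding chart_def using frame_conj_psi_map[OF t_sum t_pair_sum t_prod _ inj_t] v \<sigma>_conj by simp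

lemma bij_chart: "bij chart"
  using bij_comp[OF moebius_bij[OF frame_in_moebius[OF inj_t]] moebius_bij[OF \<sigma>]]
  by (simp add: chart_def[abs_def] comp_def)

lemmas chart_eq_iff = inj_eq[OF bij_is_inj[OF bij_chart]]

definition per3_pt :: "3 \<Rightarrow> 3 \<Rightarrow> p1" where
  "per3_pt n s = chart (Some (cycle_pt n s))"

lemma periodic_pt_3_iff_per3_pt: "periodic_pt (rf_eval \<phi>) 3 P \<longleftrightarrow> (\<exists>n. \<exists>s\<in>signs. P = per3_pt n s)"
proof -
  obtain Q where Q: "P = chart Q" using bij_chart by (metis bij_pointE)
  have "periodic_pt (rf_eval \<phi>) 3 P \<longleftrightarrow> periodic_pt (rf_eval split_form) 3 Q"
    unfolding Q
    by (rule periodic_pt_conj[of chart "rf_eval split_form"])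
      (simp_all add: chart_conj bij_is_inj[OF bij_chart])
  also have "\<dots> \<longleftrightarrow> (\<exists>n. \<exists>s\<in>signs. Q = Some (cycle_pt n s))"
    unfolding split_form_periodic_3_iff cycle_pt_range[symmetric] by blast
  finally show ?thesis unfolding Q per3_pt_def chart_eq_iff .
qed

lemma per3_pt_eq_iff:
  "s \<in> signs \<Longrightarrow> s' \<in> signs \<Longrightarrow> per3_pt n s = per3_pt n' s' \<longleftrightarrow> n = n' \<and> s = s'"
  unfolding per3_pt_def chart_eq_iff using cycle_pt_eq_iff by simp

lemma rf_eval_per3_pt: "s \<in> signs \<Longrightarrow> rf_eval \<phi> (per3_pt n s) = per3_pt (n + 1) s"
  using split_form_cycle_pt[of s n] by (simp add: per3_pt_def flip: chart_conj)

lemma alg_pt_if_cube_fixed: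
  assumes "(rf_eval \<phi> ^^ 3) P = P"
  shows "alg_pt P"
proof -
  have "{P. (rf_eval \<phi> ^^ 3) P = P} \<subseteq> chart ` {Q. (rf_eval split_form ^^ 3) Q = Q}"
  proof
    fix P assume P: "P \<in> {P. (rf_eval \<phi> ^^ 3) P = P}"
    obtain Q where Q: "P = chart Q" using bij_chart by (metis bij_pointE)
    have "chart ((rf_eval split_form ^^ 3) Q) = chart Q"
      using P by (simp add: Q funpow_conj[of chart "rf_eval split_form", OF chart_conj])
    then show "P \<in> chart ` {Q. (rf_eval split_form ^^ 3) Q = Q}" using Q by (simp add: chart_eq_iff)
  qed
  then have "finite {P. (rf_eval \<phi> ^^ 3) P = P}"
    using finite_split_form_cube_fixed finite_subset by blast
  then obtain w where "(rf_eval \<phi> ^^ 3) (Some w) \<noteq> Some w"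
    using exists_rat_avoiding_finite[OF _ inj_on_id] by auto
  then show ?thesis
    unfolding alg_pt_def using algebraic_if_iterate_fixed[OF ok deg] assms by blast
qed

lemma per3_eq: "per3 \<phi> = {per3_pt n s | n s. s \<in> signs}"
proof -
  have "P \<in> per3 \<phi> \<longleftrightarrow> periodic_pt (rf_eval \<phi>) 3 P" for P
    using alg_pt_if_cube_fixed by (auto simp: per3_def periodic_pt_3_iff)
  then show ?thesis unfolding periodic_pt_3_iff_per3_pt by blast
qed

definition labelled_pt :: "nat \<Rightarrow> p1" where
  "labelled_pt i = per3_pt (of_nat i) (cycle_sign i)"

lemma labelled_pt_label: "s \<in> signs \<Longrightarrow> labelled_pt (label n s) = per3_pt n s"
  by (simp add: labelled_pt_def of_nat_label cycle_sign_label)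

lemma bij_labelled_pt: "bij_betw labelled_pt {0..<6} (per3 \<phi>)"
proof (rule bij_betwI')
  fix i j :: nat assume "i \<in> {0..<6}" "j \<in> {0..<6}"
  then show "labelled_pt i = labelled_pt j \<longleftrightarrow> i = j"
    unfolding labelled_pt_def per3_pt_eq_iff[OF cycle_sign_in_signs cycle_sign_in_signs]
    using label_of_nat_cycle_sign by (metis atLeastLessThan_iff)
next
  show "labelled_pt i \<in> per3 \<phi>" for i using cycle_sign_in_signs
    by (auto simp: labelled_pt_def per3_eq)
next
  fix P assume "P \<in> per3 \<phi>"
  then obtain n s where "s \<in> signs" "P = per3_pt n s" by (auto simp: per3_eq)
  then show "\<exists>i\<in>{0..<6}. P = labelled_pt i"
    using label_less_6 labelled_pt_label by (intro bexI[of _ "label n s"]) auto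
qed

lemma rf_eval_labelled_pt: "i < 6 \<Longrightarrow> rf_eval \<phi> (labelled_pt i) = labelled_pt (pi6 i)"
  using rf_eval_per3_pt[OF cycle_sign_in_signs] labelled_pt_label[OF cycle_sign_in_signs]
    pi6_label[OF cycle_sign_in_signs] label_of_nat_cycle_sign by (metis labelled_pt_def)

end

section \<open>Subgroups of W\<close>

text \<open>The triple \<open>(a, u, c)\<close> with \<open>u = \<plusminus>1\<close> stands for the pair of the rotation \<open>n \<mapsto> n + a\<close> and the
  affine permutation \<open>n \<mapsto> u n + c\<close> of \<open>\<int>/3\<close>; in this way \<open>W\<close> is the product of \<open>\<int>/3\<close> and \<open>S\<^sub>3\<close>.\<close>

fun label_perm :: "3 \<times> 3 \<times> 3 \<Rightarrow> nat \<Rightarrow> nat" where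
  "label_perm (a, u, c) i =
    (if i < 6 then label (of_nat i + a + u * cycle_sign i * c) (u * cycle_sign i) else i)"

declare label_perm.simps [simp del]

definition line_group :: "3 \<Rightarrow> (3 \<times> 3 \<times> 3) set" where
  "line_group k = (\<lambda>a. (a, 1, k * a)) ` UNIV"

definition index_stabiliser :: "3 \<Rightarrow> (3 \<times> 3 \<times> 3) set" where
  "index_stabiliser j = {(a, u, c). u \<in> signs \<and> u * j + c = j}"

lemma UNIV_mod_3: "(UNIV :: 3 set) = {0, 1, 2}"
  using mod_3_cases by blast

lemma triple_mod_3: "3 * a = 0" for a :: 3
  using mod_3_cases[of a] by auto

lemma sign_mult_closed: "u \<in> signs \<Longrightarrow> s \<in> signs \<Longrightarrow> u * s \<in> signs" for u s :: 3
  by auto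

lemma label_perm_label:
  assumes "s \<in> signs"
  shows "label_perm (a, u, c) (label n s) = label (n + a + u * s * c) (u * s)"
  using label_less_6 assms by (simp add: label_perm.simps of_nat_label cycle_sign_label)

lemma label_perm_ge_6: "i \<ge> 6 \<Longrightarrow> label_perm g i = i"
  by (cases g) (simp add: label_perm.simps)

lemma labelE:
  assumes "i < 6"
  obtains n s where "s \<in> signs" "i = label n s"
  using label_of_nat_cycle_sign[OF assms] cycle_sign_in_signs by metis

lemma label_eq_iff:
  "s \<in> signs \<Longrightarrow> s' \<in> signs \<Longrightarrow> label n s = label n' s' \<longleftrightarrow> n = n' \<and> s = s'"
  by (metis of_nat_label cycle_sign_label)

lemma label_perm_in_W6:
  assumes u: "u \<in> signs"
  shows "label_perm (a, u, c) \<in> W6"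
proof -
  let ?f = "label_perm (a, u, c)"
  have "inj_on ?f {0..<6}"
  proof (rule inj_onI)
    fix i j :: nat assume ij: "i \<in> {0..<6}" "j \<in> {0..<6}" and eq: "?f i = ?f j"
    from ij have "i < 6" "j < 6" by simp_all
    obtain n s where i: "s \<in> signs" "i = label n s" using \<open>i < 6\<close> by (rule labelE)
    obtain m r where j: "r \<in> signs" "j = label m r" using \<open>j < 6\<close> by (rule labelE)
    have "label (n + a + u * s * c) (u * s) = label (m + a + u * r * c) (u * r)"
      using eq unfolding i(2) j(2) label_perm_label[OF i(1)] label_perm_label[OF j(1)] .
    then have "n + a + u * s * c = m + a + u * r * c \<and> u * s = u * r"
      by (rule label_eq_iff[OF sign_mult_closed[OF u i(1)] sign_mult_closed[OF u j(1)], THEN iffD1])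
    then show "i = j" using u i j by auto
  qed
  moreover have "?f ` {0..<6} \<subseteq> {0..<6}" using label_less_6 by (auto simp: label_perm.simps)
  ultimately have "bij_betw ?f {0..<6} {0..<6}" by (simp add: bij_betw_def endo_inj_surj)
  moreover have "?f (pi6 i) = pi6 (?f i)" for i
  proof (cases "i < 6")
    case True
    then obtain n s where "s \<in> signs" "i = label n s" by (rule labelE)
    then show ?thesis
      using sign_mult_closed[OF u, of s] by (simp add: pi6_label label_perm_label algebra_simps)
  qed (simp add: label_perm_ge_6 pi6_def perm_of_list_def)
  ultimately show ?thesis by (auto simp: W6_def label_perm_ge_6)
qed

lemma W6_shift_label:
  assumes "f \<in> W6" "s \<in> signs" "s' \<in> signs" and base: "f (label 0 s) = label n s'"
  shows "f (label k s) = label (n + k) s'"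
proof -
  have "f (pi6 i) = pi6 (f i)" for i using assms(1) by (auto simp: W6_def fun_eq_iff)
  then have step: "f (label (i + 1) s) = label (j + 1) s'" if "f (label i s) = label j s'" for i j
    using that assms(2,3) by (simp flip: pi6_label)
  show ?thesis
    using base step[OF base] step[OF step[OF base]] mod_3_cases[of k] by (auto simp: add.assoc)
qed

text \<open>An element of \<open>W\<close> is determined by the images of the labels \<open>0\<close> and \<open>3\<close>.\<close>

lemma W6_subset_label_perm: "W6 \<subseteq> label_perm ` (UNIV \<times> signs \<times> UNIV)"
proof
  fix f assume f: "f \<in> W6"
  then have bij: "bij_betw f {0..<6} {0..<6}" and ge_6: "\<And>i. i \<ge> 6 \<Longrightarrow> f i = i"
    by (auto simp: W6_def)
  have "f (label 0 1) < 6" "f (label 0 (- 1)) < 6"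
    using bij_betwE[OF bij] label_less_6 by auto
  then obtain n u m r where n: "u \<in> signs" "f (label 0 1) = label n u"
    and m: "r \<in> signs" "f (label 0 (- 1)) = label m r" by (metis labelE)
  note cycles = W6_shift_label[OF f _ n] W6_shift_label[OF f _ m]
  have "r = - u"
  proof (rule ccontr)
    assume "r \<noteq> - u"
    then have "f (label (m - n) 1) = f (label 0 (- 1))"
      using cycles(1)[of "m - n"] n m by auto
    then have "label (m - n) 1 = label 0 (- 1)"
      using bij_betw_imp_inj_on[OF bij] label_less_6 by (auto dest: inj_onD)
    then show False by (simp add: label_eq_iff)
  qed
  have "f = label_perm (- (n + m), u, u * (m - n))"
  proof
    fix i
    show "f i = label_perm (- (n + m), u, u * (m - n)) i"
    proof (cases "i < 6")
      case True
      then obtain k s where ks: "s \<in> signs" "i = label k s" by (rule labelE)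
      have "k + - (n + m) + u * s * (u * (m - n)) = (if s = 1 then n else m) + k"
        using ks(1) n(1) mod_3_cases[of n] mod_3_cases[of m] by (auto simp: algebra_simps)
      then have
        "label_perm (- (n + m), u, u * (m - n)) i = label ((if s = 1 then n else m) + k) (u * s)"
        unfolding ks(2) label_perm_label[OF ks(1)] by (simp only:)
      also have "\<dots> = f i"
        using ks n m \<open>r = - u\<close> cycles(1)[of k] cycles(2)[of k] by auto
      finally show ?thesis ..
    qed (simp add: ge_6 label_perm_ge_6)
  qed
  then show "f \<in> label_perm ` (UNIV \<times> signs \<times> UNIV)" using n(1) by blast
qed

lemma label_perm_W6: "label_perm ` (UNIV \<times> signs \<times> UNIV) = W6"
  using W6_subset_label_perm label_perm_in_W6 by auto

lemma label_perm_eq_perm_of_list: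
  assumes "map (label_perm g) [0, 1, 2, 3, 4, 5] = xs"
  shows "label_perm g = perm_of_list xs"
proof
  fix i
  show "label_perm g i = perm_of_list xs i"
  proof (cases "i < 6")
    case True
    with less_6_cases[OF True] show ?thesis
      by (auto simp: perm_of_list_def simp flip: assms)
  next
    case False
    then show ?thesis by (auto simp: perm_of_list_def label_perm_ge_6 simp flip: assms)
  qed
qed

lemma label_perm_M6: "label_perm ` line_group 0 = M6"
proof -
  have "label_perm (0, 1, 0) = perm_of_list [0, 1, 2, 3, 4, 5]"
    "label_perm (1, 1, 0) = perm_of_list [1, 2, 0, 4, 5, 3]"
    "label_perm (2, 1, 0) = perm_of_list [2, 0, 1, 5, 3, 4]"
    by (rule label_perm_eq_perm_of_list, simp add: label_perm.simps label_def cycle_sign_def)+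
  then show ?thesis by (simp add: M6_def line_group_def UNIV_mod_3)
qed

lemma label_perm_K6: "label_perm ` line_group 1 = K6"
proof -
  have "label_perm (0, 1, 0) = perm_of_list [0, 1, 2, 3, 4, 5]"
    "label_perm (1, 1, 1) = perm_of_list [2, 0, 1, 3, 4, 5]"
    "label_perm (2, 1, 2) = perm_of_list [1, 2, 0, 3, 4, 5]"
    by (rule label_perm_eq_perm_of_list, simp add: label_perm.simps label_def cycle_sign_def)+
  then show ?thesis by (simp add: K6_def line_group_def UNIV_mod_3 insert_commute)
qed

lemma label_perm_B6: "label_perm ` index_stabiliser 2 = B6"
proof -
  have "(a, u, c) \<in> index_stabiliser 2 \<longleftrightarrow> u = 1 \<and> c = 0 \<or> u = - 1 \<and> c = 1" for a u c
    using mod_3_cases[of c] by (auto simp: index_stabiliser_def)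
  then have "index_stabiliser 2 = range (\<lambda>a. (a, 1, 0)) \<union> range (\<lambda>a. (a, - 1, 1))" by auto
  moreover have "label_perm (0, 1, 0) = perm_of_list [0, 1, 2, 3, 4, 5]"
    "label_perm (1, 1, 0) = perm_of_list [1, 2, 0, 4, 5, 3]"
    "label_perm (2, 1, 0) = perm_of_list [2, 0, 1, 5, 3, 4]"
    "label_perm (0, - 1, 1) = perm_of_list [5, 3, 4, 1, 2, 0]"
    "label_perm (1, - 1, 1) = perm_of_list [3, 4, 5, 2, 0, 1]"
    "label_perm (2, - 1, 1) = perm_of_list [4, 5, 3, 0, 1, 2]"
    by (rule label_perm_eq_perm_of_list, simp add: label_perm.simps label_def cycle_sign_def)+
  ultimately show ?thesis by (simp add: B6_def UNIV_mod_3 insert_commute)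
qed

lemma label_perm_A6: "label_perm ` (UNIV \<times> {1} \<times> UNIV) = A6"
proof -
  let ?perm = "\<lambda>i j. perm_of_list
    [i, (i + 1) mod 3, (i + 2) mod 3, 3 + j, 3 + (j + 1) mod 3, 3 + (j + 2) mod 3]"
  have perm_eq: "label_perm (- (x + y), 1, y - x) = ?perm (label x 1) (label y 1)" for x y
    using mod_3_cases[of x] mod_3_cases[of y]
    by (intro label_perm_eq_perm_of_list)
      (auto simp: label_perm.simps label_def cycle_sign_def)
  have label_range: "i < 3 \<longleftrightarrow> (\<exists>x. i = label x 1)" for i
  proof
    assume "i < 3"
    then show "\<exists>x. i = label x 1"
      using label_of_nat_cycle_sign[of i] by (intro exI[of _ "of_nat i"]) (simp add: cycle_sign_def)
  qed (auto simp: label_def)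
  show ?thesis
  proof (intro equalityI subsetI)
    fix f assume "f \<in> label_perm ` (UNIV \<times> {1} \<times> UNIV)"
    then obtain a c where f: "f = label_perm (a, 1, c)" by auto
    have "- ((a + c) + (a - c)) = a" "(a - c) - (a + c) = c"
      using mod_3_cases[of a] mod_3_cases[of c] by auto
    then have "f = ?perm (label (a + c) 1) (label (a - c) 1)"
      using perm_eq[of "a + c" "a - c"] f by argo
    then show "f \<in> A6" unfolding A6_def using label_range by blast
  next
    fix f assume "f \<in> A6"
    then obtain i j where "i < 3" "j < 3" "f = ?perm i j" by (auto simp: A6_def)
    then obtain x y where "f = ?perm (label x 1) (label y 1)" using label_range by auto
    then show "f \<in> label_perm ` (UNIV \<times> {1} \<times> UNIV)" unfolding perm_eq[symmetric] by simp
  qed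
qed

locale triple_group =
  fixes G :: "(3 \<times> 3 \<times> 3) set"
  assumes sign: "(a, u, c) \<in> G \<Longrightarrow> u \<in> signs"
    and mult: "(a, u, c) \<in> G \<Longrightarrow> (a', u', c') \<in> G \<Longrightarrow> (a + a', u * u', c + u * c') \<in> G"
    and moves: "\<exists>a u c. (a, u, c) \<in> G \<and> a \<noteq> 0"
begin

lemma even_scale:
  assumes "(a, 1, c) \<in> G"
  shows "(k * a, 1, k * c) \<in> G"
proof -
  have "(2 * a, 1, 2 * c) \<in> G" using mult[OF assms assms] by (simp flip: mult_2)
  from mult[OF assms this] have "(3 * a, 1, 3 * c) \<in> G" by (simp add: algebra_simps)
  then have "(0, 1, 0) \<in> G" by (simp only: triple_mod_3)
  with assms \<open>(2 * a, 1, 2 * c) \<in> G\<close> show ?thesis using mod_3_cases[of k] by auto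
qed

lemma odd_powers:
  assumes "(a, - 1, c) \<in> G"
  shows "(a, 1, 0) \<in> G" "(0, - 1, c) \<in> G"
proof -
  have square: "(2 * a, 1, 0) \<in> G" using mult[OF assms assms] by (simp flip: mult_2)
  have "2 * (2 * a) = a" "2 * a + a = 0" using mod_3_cases[of a] by auto
  then show "(a, 1, 0) \<in> G" "(0, - 1, c) \<in> G"
    using even_scale[OF square, of 2] mult[OF square assms]
    by (simp_all only: mult_zero_right mult_1 add_0_left)
qed

lemma even_generator: "\<exists>k. (1, 1, k) \<in> G"
proof -
  obtain a u c where auc: "(a, u, c) \<in> G" "a \<noteq> 0" using moves by blast
  then have "a * a = 1" using mod_3_nonzero_cases[of a] by auto
  obtain c' where "(a, 1, c') \<in> G" using auc(1) sign[OF auc(1)] odd_powers(1) by auto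
  from even_scale[OF this, of a] show ?thesis using \<open>a * a = 1\<close> by auto
qed

lemma line_group_subset: "(1, 1, k) \<in> G \<Longrightarrow> line_group k \<subseteq> G"
  using even_scale[of 1 k] by (auto simp: line_group_def mult.commute)

lemma eq_line_group:
  assumes "G \<subseteq> line_group k"
  shows "G = line_group k"
proof -
  obtain c where c: "(1, 1, c) \<in> G" using even_generator by blast
  then have "c = k" using assms by (auto simp: line_group_def)
  then show ?thesis using line_group_subset c assms by blast
qed

lemma even_full:
  assumes k: "(1, 1, k) \<in> G" and ac: "(a, 1, c) \<in> G" "c \<noteq> k * a"
  shows "(x, 1, y) \<in> G"
proof -
  define d where "d = c - k * a"
  have "(0, 1, d) \<in> G"
    using mult[OF ac(1) even_scale[OF k, of "- a"]] by (simp add: d_def mult.commute)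
  moreover have "d * d = 1" using ac(2) mod_3_nonzero_cases[of d] by (auto simp: d_def)
  ultimately have "(0, 1, y - x * k) \<in> G"
    using even_scale[of 0 d "(y - x * k) * d"] by (simp add: mult.assoc)
  from mult[OF even_scale[OF k, of x] this] show ?thesis by simp
qed

lemma even_cases:
  assumes even: "\<And>a u c. (a, u, c) \<in> G \<Longrightarrow> u = 1"
  shows "G = UNIV \<times> {1} \<times> UNIV \<or> (\<exists>k. G = line_group k)"
proof -
  obtain k where k: "(1, 1, k) \<in> G" using even_generator by blast
  show ?thesis
  proof (cases "G \<subseteq> line_group k")
    case True
    then show ?thesis using eq_line_group by blast
  next
    case False
    then obtain a u c where auc: "(a, u, c) \<in> G" "(a, u, c) \<notin> line_group k" by auto
    then have "(a, 1, c) \<in> G" "c \<noteq> k * a" using even[OF auc(1)] by (auto simp: line_group_def)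
    then have "UNIV \<times> {1} \<times> UNIV \<subseteq> G" using even_full[OF k] by auto
    then show ?thesis using even by fastforce
  qed
qed

text \<open>Conjugating \<open>(a, 1, c)\<close> by an odd element gives \<open>(a, 1, -c)\<close>, and the two do not lie on the same
  line.\<close>

lemma eq_full:
  assumes even: "(a, 1, c) \<in> G" "c \<noteq> 0" and odd: "(b, - 1, d) \<in> G"
  shows "G = UNIV \<times> signs \<times> UNIV"
proof -
  obtain k where k: "(1, 1, k) \<in> G" using even_generator by blast
  note reflection = odd_powers(2)[OF odd]
  have conj: "(a, 1, - c) \<in> G" using mult[OF mult[OF reflection even(1)] reflection] by simp
  have "c \<noteq> - c" using even(2) mod_3_nonzero_cases[of c] by auto
  then have evens: "(x, 1, y) \<in> G" for x y
    using even_full[OF k even(1)] even_full[OF k conj] by metis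
  moreover have "(x, - 1, y) \<in> G" for x y using mult[OF evens[of x "y - d"] reflection] by simp
  ultimately have "UNIV \<times> signs \<times> UNIV \<subseteq> G" by auto
  moreover have "G \<subseteq> UNIV \<times> signs \<times> UNIV" by (auto dest: sign)
  ultimately show ?thesis by blast
qed

lemma index_stabiliser_cases:
  assumes stab: "G \<subseteq> index_stabiliser j"
  shows "G = index_stabiliser j \<or> G = line_group 0"
proof (cases "\<exists>a c. (a, - 1, c) \<in> G")
  case True
  then obtain a c where odd: "(a, - 1, c) \<in> G" by blast
  then have "c = j + j" using stab by (auto simp: index_stabiliser_def algebra_simps)
  obtain k where k: "(1, 1, k) \<in> G" using even_generator by blast
  then have "k = 0" using stab by (auto simp: index_stabiliser_def)
  then have evens: "(x, 1, 0) \<in> G" for x using even_scale[OF k, of x] by simp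
  moreover have "(x, - 1, j + j) \<in> G" for x
    using mult[OF evens[of x] odd_powers(2)[OF odd]] \<open>c = j + j\<close> by simp
  ultimately have "index_stabiliser j \<subseteq> G" by (auto simp: index_stabiliser_def algebra_simps)
  then show ?thesis using stab by blast
next
  case False
  have "c = 0 \<and> u = 1" if "(a, u, c) \<in> G" for a u c
    using that False stab sign[OF that] by (auto simp: index_stabiliser_def)
  then have "G \<subseteq> line_group 0" by (fastforce simp: line_group_def)
  then show ?thesis using eq_line_group by blast
qed

end

section \<open>The Galois action on the 3-periodic points\<close>

lemma inj_mod_3_affine:
  fixes f :: "3 \<Rightarrow> 3"
  assumes "inj f"
  obtains u c where "u \<in> signs" "\<And>n. f n = u * n + c"
proof (rule that)
  have distinct: "f 0 \<noteq> f 1" "f 0 \<noteq> f 2" "f 1 \<noteq> f 2" by (simp_all add: inj_eq[OF assms])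
  show "f 1 - f 0 \<in> signs" using mod_3_nonzero_cases[of "f 1 - f 0"] distinct by auto
  have "f 2 = (f 1 - f 0) * 2 + f 0"
    using distinct mod_3_cases[of "f 0"] mod_3_cases[of "f 1"] mod_3_cases[of "f 2"] by auto
  then show "f n = (f 1 - f 0) * n + f 0" for n using mod_3_cases[of n] by auto
qed

text \<open>Clearing denominators gives \<open>x\<^sup>3 - 3xy\<^sup>2 + y\<^sup>3 = 0\<close> with \<open>x, y\<close> coprime, but that number is odd.\<close>

lemma gamma_cubic_no_rat_root:
  fixes r :: rat
  shows "r ^ 3 - 3 * r + 1 \<noteq> 0"
proof
  assume r: "r ^ 3 - 3 * r + 1 = 0"
  obtain x y where "quotient_of r = (x, y)" by (cases "quotient_of r")
  then have y: "y > 0" and cop: "coprime x y" and rxy: "r = of_int x / of_int y"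
    by (simp_all add: quotient_of_denom_pos quotient_of_coprime quotient_of_div)
  have "of_int (x ^ 3 - 3 * x * y\<^sup>2 + y ^ 3) = (of_int y :: rat) ^ 3 * (r ^ 3 - 3 * r + 1)"
    using y unfolding rxy by (simp add: field_simps power2_eq_square power3_eq_cube)
  then have "x ^ 3 - 3 * x * y\<^sup>2 + y ^ 3 = 0"
    unfolding r by (simp only: mult_zero_right of_int_eq_0_iff)
  moreover have "odd x \<or> odd y" using cop by (metis coprime_common_divisor odd_one)
  then have "odd (x ^ 3 - 3 * x * y\<^sup>2 + y ^ 3)" by auto
  ultimately show False by simp
qed

definition resolvent :: "rat \<Rightarrow> rat poly" where
  "resolvent v = [:1, - 3, 0, 1:] * [:v, 0, - 3, 1:]"

lemma resolvent_nonzero: "resolvent v \<noteq> 0"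
  by (simp add: resolvent_def)

lemma poly_cpoly_resolvent:
  "poly (cpoly (resolvent v)) z = (z ^ 3 - 3 * z + 1) * (z ^ 3 - 3 * z\<^sup>2 + of_rat v)"
  unfolding resolvent_def cpoly_mult poly_mult
  by (simp add: cpoly_pCons cpoly_0 of_rat_minus algebra_simps power2_eq_square power3_eq_cube)

context psi_frame
begin

abbreviation "E \<equiv> splitting_field (resolvent v)"

lemma subfield_E: "is_subfield E"
  by (rule is_subfield_splitting_field)

lemma field_hom_if_aut: "\<tau> \<in> field_auts E \<Longrightarrow> field_hom E \<tau>"
  by (simp add: field_auts_iff[OF subfield_E])

lemma gamma_resolvent_root: "poly (cpoly (resolvent v)) (\<gamma> n) = 0"
  and t_resolvent_root: "poly (cpoly (resolvent v)) (t n) = 0"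
  using gamma_root[of n] root_iff_t[of "t n"] by (simp_all add: poly_cpoly_resolvent)

lemmas gamma_in_E = root_in_splitting_field[OF gamma_resolvent_root]
  and t_in_E = root_in_splitting_field[OF t_resolvent_root]

lemma cycle_pt_in_E: "cycle_pt n s \<in> E"
  using gamma_in_E[of n] subfield_E by (simp add: cycle_pt_def subfield_divide subfield_1)

lemma frame_proj_line:
  assumes "P \<in> proj_line E"
  shows "frame t P \<in> proj_line E"
proof -
  have "frame t \<in> moebius E"
    unfolding frame_def using t_in_E subfield_E frame_det[OF inj_t]
    by (intro mob_in_moebius subfield_mult subfield_diff)
  then show ?thesis using moebius_proj_line[OF subfield_E] assms by blast
qed

lemma per3_pt_proj_line: "per3_pt n s \<in> proj_line E"
proof -
  have "\<sigma> \<in> moebius E" using \<sigma> moebius_mono[OF Rats_subset_subfield[OF subfield_E]] by blast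
  moreover have "frame t (Some (cycle_pt n s)) \<in> proj_line E"
    by (intro frame_proj_line) (simp add: Some_in_proj_line_iff cycle_pt_in_E)
  ultimately show ?thesis unfolding per3_pt_def chart_def by (rule moebius_proj_line[OF subfield_E])
qed

definition acts :: "(complex \<Rightarrow> complex) \<Rightarrow> 3 \<Rightarrow> 3 \<Rightarrow> 3 \<Rightarrow> bool" where
  "acts \<tau> a u c \<longleftrightarrow> u \<in> signs \<and> (\<forall>n. \<tau> (\<gamma> n) = \<gamma> (n + a)) \<and> (\<forall>n. \<tau> (t n) = t (u * n + c))"

lemma actsD:
  assumes "acts \<tau> a u c"
  shows "u \<in> signs" "\<tau> (\<gamma> n) = \<gamma> (n + a)" "\<tau> (t n) = t (u * n + c)"
  using assms unfolding acts_def by blast+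

lemma aut_acts:
  assumes "\<tau> \<in> field_auts E"
  obtains a u c where "acts \<tau> a u c"
proof -
  interpret field_hom E \<tau> using assms by (rule field_hom_if_aut)
  have "\<tau> (\<gamma> 0) ^ 3 - 3 * \<tau> (\<gamma> 0) + 1 = \<tau> (\<gamma> 0 ^ 3 - 3 * \<gamma> 0 + 1)"
    using gamma_in_E[of 0] by (simp add: hom_simps closed)
  then have "\<tau> (\<gamma> 0) \<in> range \<gamma>" unfolding gamma_root root_iff_gamma[symmetric] by (simp add: hom_0)
  then obtain a where a: "\<tau> (\<gamma> 0) = \<gamma> a" by blast
  have step: "\<tau> (\<gamma> (n + 1)) = \<gamma> (n + 1 + a)" if "\<tau> (\<gamma> n) = \<gamma> (n + a)" for n
  proof -
    have "\<tau> (\<gamma> (n + 1)) = 1 - 1 / \<tau> (\<gamma> n)"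
      using gamma_in_E[of n] by (simp add: gamma_add_1 hom_simps closed)
    also have "\<dots> = \<gamma> (n + a + 1)" unfolding that gamma_add_1 ..
    finally show ?thesis by (simp add: add_ac)
  qed
  have \<gamma>: "\<tau> (\<gamma> n) = \<gamma> (n + a)" for n
    using mod_3_cases[of n] a step[of 0] step[of 1] by auto
  have "\<tau> (t n) \<in> range t" for n
  proof -
    have "\<tau> (t n) ^ 3 - 3 * (\<tau> (t n))\<^sup>2 + of_rat v = \<tau> (t n ^ 3 - 3 * (t n)\<^sup>2 + of_rat v)"
      using t_in_E[of n] by (simp add: hom_simps closed)
    then show ?thesis using root_iff_t[of "t n"] root_iff_t[of "\<tau> (t n)"] by (simp add: hom_0)
  qed
  then have "\<forall>n. \<exists>m. \<tau> (t n) = t m" by blast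
  then obtain f where f: "\<And>n. \<tau> (t n) = t (f n)" by (auto dest: choice)
  have "inj f"
  proof (rule injI)
    fix m n assume "f m = f n"
    then have "\<tau> (t m) = \<tau> (t n)" by (simp add: f)
    then show "m = n" using inj_onD[OF hom_inj_on] t_in_E inj_eq[OF inj_t] by blast
  qed
  then obtain u c where "u \<in> signs" "\<And>n. f n = u * n + c" by (rule inj_mod_3_affine) blast
  then show thesis using that[of a u c] \<gamma> f by (simp add: acts_def)
qed

lemma acts_per3_pt:
  assumes \<tau>: "\<tau> \<in> field_auts E" and acts: "acts \<tau> a u c" and s: "s \<in> signs"
  shows "map_option \<tau> (per3_pt n s) = per3_pt (n + a + u * s * c) (u * s)"
proof -
  interpret field_hom E \<tau> using \<tau> by (rule field_hom_if_aut)
  have pt: "\<tau> (cycle_pt n s) = cycle_pt (n + a) s"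
    using actsD(2)[OF acts] gamma_in_E by (simp add: cycle_pt_def hom_simps closed)
  have line: "Some (cycle_pt n s) \<in> proj_line E" by (simp add: Some_in_proj_line_iff cycle_pt_in_E)
  have "map_option \<tau> (per3_pt n s) = \<sigma> (map_option \<tau> (frame t (Some (cycle_pt n s))))"
    unfolding per3_pt_def chart_def by (rule map_option_moebius_Rats[OF \<sigma> frame_proj_line[OF line]])
  also have "map_option \<tau> (frame t (Some (cycle_pt n s))) =
      frame (\<lambda>m. \<tau> (t m)) (Some (\<tau> (cycle_pt n s)))"
    unfolding frame_def using t_in_E line
    by (subst map_option_mob) (auto simp: hom_simps closed)
  also have "\<dots> = frame t (Some (cycle_pt (n + a + u * s * c) (u * s)))"
    unfolding pt actsD(3)[OF acts] by (rule frame_affine_cycle_pt[OF inj_t actsD(1)[OF acts] s])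
  finally show ?thesis by (simp add: per3_pt_def chart_def)
qed

lemma map_option_labelled_pt:
  assumes "\<tau> \<in> field_auts E" "acts \<tau> a u c" "i < 6"
  shows "map_option \<tau> (labelled_pt i) = labelled_pt (label_perm (a, u, c) i)"
proof -
  obtain n s where i: "s \<in> signs" "i = label n s" using assms(3) by (rule labelE)
  then show ?thesis
    using acts_per3_pt[OF assms(1,2) i(1)] sign_mult_closed[OF actsD(1)[OF assms(2)] i(1)]
    by (simp add: labelled_pt_label label_perm_label)
qed

definition galois_group :: "(3 \<times> 3 \<times> 3) set" where
  "galois_group = {(a, u, c). \<exists>\<tau>\<in>field_auts E. acts \<tau> a u c}"

lemma galois_groupE:
  assumes "(a, u, c) \<in> galois_group"
  obtains \<tau> where "\<tau> \<in> field_auts E" "acts \<tau> a u c"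
  using assms by (auto simp: galois_group_def)

definition induced_perm :: "(complex \<Rightarrow> complex) \<Rightarrow> nat \<Rightarrow> nat" where
  "induced_perm \<tau> i =
    (if i < 6 then the_inv_into {0..<6} labelled_pt (map_option \<tau> (labelled_pt i)) else i)"

lemma induced_perm_eq_label_perm:
  assumes "\<tau> \<in> field_auts E" "acts \<tau> a u c"
  shows "induced_perm \<tau> = label_perm (a, u, c)"
proof
  fix i
  show "induced_perm \<tau> i = label_perm (a, u, c) i"
  proof (cases "i < 6")
    case True
    then have "label_perm (a, u, c) i < 6" by (simp add: label_perm.simps label_less_6)
    then have "the_inv_into {0..<6} labelled_pt (labelled_pt (label_perm (a, u, c) i)) =
        label_perm (a, u, c) i"
      using bij_betw_imp_inj_on[OF bij_labelled_pt] by (intro the_inv_into_f_f) simp_all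
    then show ?thesis using True map_option_labelled_pt[OF assms True]
      by (simp add: induced_perm_def)
  qed (simp add: induced_perm_def label_perm_ge_6)
qed

lemma image_induced_perm_eq:
  "induced_perm ` field_auts E = label_perm ` galois_group"
proof (intro equalityI subsetI)
  fix h assume "h \<in> induced_perm ` field_auts E"
  then obtain \<tau> where \<tau>: "\<tau> \<in> field_auts E" "h = induced_perm \<tau>" by blast
  obtain a u c where "acts \<tau> a u c" using \<tau>(1) by (rule aut_acts)
  with \<tau> have "(a, u, c) \<in> galois_group" "h = label_perm (a, u, c)"
    by (auto simp: galois_group_def induced_perm_eq_label_perm)
  then show "h \<in> label_perm ` galois_group" by blast
next
  fix h assume "h \<in> label_perm ` galois_group"
  then obtain a u c \<tau> where "\<tau> \<in> field_auts E" "acts \<tau> a u c" "h = label_perm (a, u, c)"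
    by (auto elim: galois_groupE)
  then show "h \<in> induced_perm ` field_auts E" by (auto simp flip: induced_perm_eq_label_perm)
qed

lemma aut_per3:
  assumes \<tau>: "\<tau> \<in> field_auts E" and z: "Some z \<in> per3 \<phi>"
  shows "Some (\<tau> z) \<in> per3 \<phi>"
proof -
  obtain n s where s: "s \<in> signs" and "Some z = per3_pt n s" using z unfolding per3_eq by blast
  then have "Some (\<tau> z) = map_option \<tau> (per3_pt n s)" by (simp flip: \<open>Some z = per3_pt n s\<close>)
  moreover obtain a u c where "acts \<tau> a u c" using \<tau> by (rule aut_acts)
  ultimately have "Some (\<tau> z) = per3_pt (n + a + u * s * c) (u * s)" "u * s \<in> signs"
    using acts_per3_pt[OF \<tau> _ s] sign_mult_closed[OF actsD(1) s] by simp_all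
  then show ?thesis unfolding per3_eq by blast
qed

lemma induced_perm_cong:
  assumes "\<And>z. Some z \<in> per3 \<phi> \<Longrightarrow> \<tau> z = \<tau>' z"
  shows "induced_perm \<tau> = induced_perm \<tau>'"
proof -
  have "map_option \<tau> (labelled_pt i) = map_option \<tau>' (labelled_pt i)" if "i < 6" for i
  proof -
    have "labelled_pt i \<in> per3 \<phi>" using bij_betwE[OF bij_labelled_pt] that by simp
    then show ?thesis using assms by (cases "labelled_pt i") simp_all
  qed
  then show ?thesis by (auto simp: induced_perm_def)
qed

lemma G3_is_galois_group: "G3_is \<phi> (label_perm ` galois_group)"
proof -
  let ?Z = "{z. Some z \<in> per3 \<phi>}"
  have "finite (per3 \<phi>)" using bij_betw_finite[OF bij_labelled_pt] by simp
  moreover have "Some ` ?Z \<subseteq> per3 \<phi>" by auto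
  ultimately have "finite (Some ` ?Z)" by (rule finite_subset[rotated])
  then have "finite ?Z" by (simp add: finite_image_iff)
  moreover have "?Z \<subseteq> E"
  proof
    fix z assume "z \<in> ?Z"
    then obtain n s where "Some z = per3_pt n s" by (auto simp: per3_eq)
    then show "z \<in> E" using per3_pt_proj_line[of n s] by (simp flip: Some_in_proj_line_iff)
  qed
  moreover have "\<tau> ` ?Z \<subseteq> ?Z" if "\<tau> \<in> field_auts E" for \<tau> using aut_per3[OF that] by auto
  moreover have "induced_perm \<tau> = induced_perm \<tau>'" if "\<And>z. z \<in> ?Z \<Longrightarrow> \<tau> z = \<tau>' z" for \<tau> \<tau>'
    using that by (intro induced_perm_cong) simp
  ultimately have "induced_perm ` field_auts (Q3 \<phi>) = induced_perm ` field_auts E"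
    unfolding Q3_def by (rule image_field_auts_gen_field[OF resolvent_nonzero])
  then have "induced_perm ` field_auts (Q3 \<phi>) = label_perm ` galois_group"
    unfolding image_induced_perm_eq .
  then show ?thesis
    unfolding G3_is_def induced_perm_def[abs_def] using bij_labelled_pt rf_eval_labelled_pt by blast
qed

lemma galois_group_mult:
  assumes "(a, u, c) \<in> galois_group" "(a', u', c') \<in> galois_group"
  shows "(a + a', u * u', c + u * c') \<in> galois_group"
proof -
  obtain \<tau> where \<tau>: "\<tau> \<in> field_auts E" "acts \<tau> a u c" using assms(1) by (rule galois_groupE)
  obtain \<tau>' where \<tau>': "\<tau>' \<in> field_auts E" "acts \<tau>' a' u' c'" using assms(2) by (rule galois_groupE)
  have "acts (\<tau> \<circ> \<tau>') (a + a') (u * u') (c + u * c')"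
    using \<tau>(2) \<tau>'(2) sign_mult_closed[of u u'] by (simp add: acts_def algebra_simps)
  then show ?thesis using field_auts_comp[OF \<tau>(1) \<tau>'(1)] by (auto simp: galois_group_def)
qed

lemma Rats_iff_fixed:
  assumes "algebraic z"
  shows "z \<in> \<rat> \<longleftrightarrow> (\<forall>\<tau> a u c. \<tau> \<in> field_auts E \<longrightarrow> acts \<tau> a u c \<longrightarrow> \<tau> z = z)"
  using Rats_iff_fixed_by_auts[OF resolvent_nonzero assms, of v] aut_acts by metis

lemma t_rational_iff: "t j \<in> \<rat> \<longleftrightarrow> galois_group \<subseteq> index_stabiliser j"
proof -
  have "\<tau> (t j) = t j \<longleftrightarrow> u * j + c = j" if "acts \<tau> a u c" for \<tau> a u c
    using actsD(3)[OF that] inj_eq[OF inj_t] by simp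
  then show ?thesis
    unfolding Rats_iff_fixed[OF algebraic_if_root_cpoly[OF resolvent_nonzero t_resolvent_root]]
    using actsD(1) by (fastforce simp: galois_group_def index_stabiliser_def)
qed

lemma discriminant_root_rational_iff:
  "discriminant_root t \<in> \<rat> \<longleftrightarrow> (\<forall>a u c. (a, u, c) \<in> galois_group \<longrightarrow> u = 1)"
proof -
  let ?d = "discriminant_root t"
  have "algebraic ?d"
  proof (rule algebraic_if_root_cpoly)
    show "poly (cpoly [:- (27 * v * (4 - v)), 0, 1:]) ?d = 0"
      using discriminant_root_square
      by (simp add: cpoly_pCons cpoly_0 of_rat_minus power2_eq_square)
  qed simp
  moreover have "\<tau> ?d = ?d \<longleftrightarrow> u = 1" if \<tau>: "\<tau> \<in> field_auts E" "acts \<tau> a u c" for \<tau> a u c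
  proof -
    interpret field_hom E \<tau> using \<tau>(1) by (rule field_hom_if_aut)
    have "\<tau> ?d = (t c - t (u + c)) * (t (u + c) - t (u * 2 + c)) * (t (u * 2 + c) - t c)"
      using actsD(3)[OF \<tau>(2)] t_in_E by (simp add: discriminant_root_def hom_simps closed)
    also have "\<dots> = (if u = 1 then ?d else - ?d)"
    proof -
      have mod_3: "3 = (0 :: 3)" "4 = (1 :: 3)" "- 1 = (2 :: 3)" "- 2 = (1 :: 3)" by simp_all
      show ?thesis
        using actsD(1)[OF \<tau>(2)] mod_3_cases[of c]
        by (auto simp: discriminant_root_def mod_3 algebra_simps)
    qed
    finally show ?thesis using discriminant_root_nonzero by simp
  qed
  ultimately show ?thesis
    using Rats_iff_fixed[of ?d] by (simp add: galois_group_def) blast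
qed

lemma galois_group_moves_gamma: "\<exists>a u c. (a, u, c) \<in> galois_group \<and> a \<noteq> 0"
proof -
  have "\<gamma> 0 \<notin> \<rat>"
  proof
    assume "\<gamma> 0 \<in> \<rat>"
    then obtain r :: rat where r: "\<gamma> 0 = of_rat r" by (auto elim: Rats_cases)
    have "of_rat (r ^ 3 - 3 * r + 1) = (0 :: complex)"
      using gamma_root[of 0] unfolding r
      by (simp add: of_rat_add of_rat_diff of_rat_mult of_rat_power)
    then show False using gamma_cubic_no_rat_root by (simp only: of_rat_eq_0_iff)
  qed
  then obtain \<tau> a u c where "\<tau> \<in> field_auts E" "acts \<tau> a u c" "\<tau> (\<gamma> 0) \<noteq> \<gamma> 0"
    using Rats_iff_fixed[OF algebraic_if_root_cpoly[OF resolvent_nonzero gamma_resolvent_root]]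
    by blast
  moreover from this have "a \<noteq> 0" using actsD(2)[of \<tau> a u c 0] by auto
  ultimately show ?thesis by (auto simp: galois_group_def)
qed

sublocale triple_group galois_group
  using galois_group_mult galois_group_moves_gamma
  by unfold_locales (auto elim: galois_groupE dest: actsD(1))

lemma rational_per3_pt_fixed:
  assumes rat: "per3_pt n s \<in> proj_line \<rat>" and s: "s \<in> signs" and "(a, u, c) \<in> galois_group"
  shows "u = 1 \<and> c = - (s * a)"
proof -
  obtain \<tau> where \<tau>: "\<tau> \<in> field_auts E" "acts \<tau> a u c" using assms(3) by (rule galois_groupE)
  interpret field_hom E \<tau> using \<tau>(1) by (rule field_hom_if_aut)
  have "map_option \<tau> (per3_pt n s) = per3_pt n s"
    using rat by (cases "per3_pt n s") (auto simp: Some_in_proj_line_iff hom_Rats)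
  then have "per3_pt (n + a + u * s * c) (u * s) = per3_pt n s" using acts_per3_pt[OF \<tau> s] by simp
  then have "n + a + u * s * c = n" "u * s = s"
    using per3_pt_eq_iff[OF sign_mult_closed[OF actsD(1)[OF \<tau>(2)] s] s] by blast+
  moreover from this have "u = 1" using s actsD(1)[OF \<tau>(2)] by auto
  moreover have "a + s * c = 0" using calculation by simp
  then have "c = - (s * a)" using s by (auto simp: add_eq_0_iff)
  ultimately show ?thesis by simp
qed

end

section \<open>The Galois group in terms of the parameter\<close>

context psi_frame
begin

lemma psi_frame_reflect: "psi_frame g \<phi> v \<sigma> (\<lambda>n. t (- n))"
proof
  have neg: "- 1 = (2 :: 3)" "- 2 = (1 :: 3)" by simp_all
  show "t (- 0) + t (- 1) + t (- 2) = 3"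
    "t (- 0) * t (- 1) + t (- 1) * t (- 2) + t (- 2) * t (- 0) = 0"
    "t (- 0) * t (- 1) * t (- 2) = - of_rat v"
    using t_sum t_pair_sum t_prod unfolding neg by (simp_all add: ac_simps)
qed (use ok deg v \<sigma> \<sigma>_conj in auto)

lemma galois_group_reflect:
  "(a, u, c) \<in> psi_frame.galois_group g v (\<lambda>n. t (- n)) \<longleftrightarrow> (a, u, - c) \<in> galois_group"
proof -
  interpret reflected: psi_frame g \<phi> v \<sigma> "\<lambda>n. t (- n)" by (rule psi_frame_reflect)
  have "(\<forall>n. \<tau> (t (- n)) = t (- (u * n + c))) \<longleftrightarrow> (\<forall>n. \<tau> (t n) = t (u * n + - c))" for \<tau>
    by (metis (no_types, opaque_lifting) minus_add_distrib minus_minus mult_minus_right)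
  then show ?thesis
    by (simp add: galois_group_def reflected.galois_group_def acts_def reflected.acts_def)
qed

lemma G3_is_M6_if_line: "galois_group = line_group 0 \<Longrightarrow> G3_is \<phi> M6"
  using G3_is_galois_group by (simp add: label_perm_M6)

lemma G3_is_K6_if_line:
  assumes "galois_group = line_group k" "k \<in> signs"
  shows "G3_is \<phi> K6"
proof (cases "k = 1")
  case True
  then show ?thesis using G3_is_galois_group assms(1) by (simp add: label_perm_K6)
next
  case False
  interpret reflected: psi_frame g \<phi> v \<sigma> "\<lambda>n. t (- n)" by (rule psi_frame_reflect)
  have "reflected.galois_group = line_group 1"
    using assms False galois_group_reflect by (auto simp: line_group_def image_iff)
  then show ?thesis using reflected.G3_is_galois_group by (simp add: label_perm_K6)
qed

lemma G3_is_W6_if_irrational: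
  assumes "discriminant_root t \<notin> \<rat>" "\<And>j. t j \<notin> \<rat>"
  shows "G3_is \<phi> W6"
proof -
  obtain b u' d where "(b, u', d) \<in> galois_group" "u' \<noteq> 1"
    using assms(1) discriminant_root_rational_iff by blast
  then have odd: "(b, - 1, d) \<in> galois_group" using sign by auto
  \<comment> \<open>The odd element fixes the index \<open>-d\<close>, some other element moves it.\<close>
  have "\<not> galois_group \<subseteq> index_stabiliser (- d)" using assms(2) t_rational_iff by blast
  then obtain a u c where auc: "(a, u, c) \<in> galois_group" "(a, u, c) \<notin> index_stabiliser (- d)"
    by auto
  have "\<exists>a' c'. (a', 1, c') \<in> galois_group \<and> c' \<noteq> 0"
  proof (cases "u = 1")
    case True
    then show ?thesis using auc by (auto simp: index_stabiliser_def)
  next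
    case False
    then have "u = - 1" using sign[OF auc(1)] by simp
    then have "d - c \<noteq> 0" using auc(2) mod_3_cases[of d] by (auto simp: index_stabiliser_def)
    moreover have "(b + a, 1, d - c) \<in> galois_group" using mult[OF odd auc(1)] \<open>u = - 1\<close> by simp
    ultimately show ?thesis by blast
  qed
  then have "galois_group = UNIV \<times> signs \<times> UNIV" using eq_full odd by blast
  then show ?thesis using G3_is_galois_group label_perm_W6 by simp
qed

lemma G3_is_A6_K6_M6_if_discriminant_root_rational:
  assumes "discriminant_root t \<in> \<rat>"
  shows "G3_is \<phi> A6 \<or> G3_is \<phi> K6 \<or> G3_is \<phi> M6"
proof -
  have "galois_group = UNIV \<times> {1} \<times> UNIV \<or> (\<exists>k. galois_group = line_group k)"
    using assms discriminant_root_rational_iff by (intro even_cases) blast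
  then consider (even) "galois_group = UNIV \<times> {1} \<times> UNIV" | (line) k
    where "galois_group = line_group k"
    by blast
  then show ?thesis
  proof cases
    case even
    then show ?thesis using G3_is_galois_group label_perm_A6 by simp
  next
    case (line k)
    then show ?thesis
      using mod_3_nonzero_cases[of k] G3_is_M6_if_line G3_is_K6_if_line by (cases "k = 0") auto
  qed
qed

lemma G3_is_B6_M6_if_rational_root:
  assumes "t 2 \<in> \<rat>"
  shows "G3_is \<phi> B6 \<or> G3_is \<phi> M6"
proof -
  have "galois_group \<subseteq> index_stabiliser 2" using assms t_rational_iff by blast
  then have "galois_group = index_stabiliser 2 \<or> galois_group = line_group 0"
    by (rule index_stabiliser_cases)
  then show ?thesis using G3_is_galois_group label_perm_B6 G3_is_M6_if_line by auto
qed

lemma G3_is_M6_if_rational_roots: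
  assumes "\<And>j. t j \<in> \<rat>"
  shows "G3_is \<phi> M6"
proof -
  have "galois_group \<subseteq> index_stabiliser 0 \<inter> index_stabiliser 1" using assms t_rational_iff by blast
  also have "\<dots> \<subseteq> line_group 0" by (auto simp: index_stabiliser_def line_group_def)
  finally show ?thesis using eq_line_group G3_is_M6_if_line by blast
qed

lemma G3_is_K6_if_rational_per3_pt:
  assumes "P \<in> per3 \<phi>" "P \<in> proj_line \<rat>"
  shows "G3_is \<phi> K6"
proof -
  obtain n s where ns: "s \<in> signs" "per3_pt n s \<in> proj_line \<rat>" using assms by (auto simp: per3_eq)
  have "galois_group \<subseteq> line_group (- s)"
    using rational_per3_pt_fixed[OF ns(2,1)] by (auto simp: line_group_def)
  then have "galois_group = line_group (- s)" by (rule eq_line_group)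
  then show ?thesis using G3_is_K6_if_line ns(1) by auto
qed

end

lemma Im_alpha_if_discriminant_square:
  assumes "v \<noteq> 0" and s: "s\<^sup>2 = 27 * v * (4 - v)"
  shows "v \<in> Im_alpha"
proof -
  define m where "m = s / (3 * v)"
  have "v * (v * (3 + m\<^sup>2)) = 3 * v\<^sup>2 + s\<^sup>2 / 9"
    using \<open>v \<noteq> 0\<close> by (simp add: m_def power2_eq_square field_simps)
  also have "\<dots> = v * 12" unfolding s by (simp add: power2_eq_square field_simps)
  finally have vm: "v * (3 + m\<^sup>2) = 12" using \<open>v \<noteq> 0\<close> by simp
  show ?thesis
  proof (cases "m = - 3")
    case True
    then have "v = alpha 0" using vm by (simp add: alpha_def)
    then show ?thesis unfolding Im_alpha_def by force
  next
    case False
    then have "3 + m \<noteq> 0" by (simp add: add_eq_0_iff2 add_eq_0_iff)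
    define u where "u = (3 - m) / (3 + m)"
    have "(3 + m) * u = 3 - m" using \<open>3 + m \<noteq> 0\<close> by (simp add: u_def)
    then have num: "(3 + m) * (1 + u) = 6" and den: "(3 + m)\<^sup>2 * (1 - u + u\<^sup>2) = 3 * (3 + m\<^sup>2)"
      by algebra+
    have "3 + m\<^sup>2 \<noteq> 0" using vm by auto
    then have "1 - u + u\<^sup>2 \<noteq> 0" using den by (metis mult_eq_0_iff zero_neq_numeral)
    moreover have "(3 + m)\<^sup>2 * (v * (1 - u + u\<^sup>2)) = (3 + m)\<^sup>2 * (1 + u)\<^sup>2"
    proof -
      have "(3 + m)\<^sup>2 * (v * (1 - u + u\<^sup>2)) = v * (3 * (3 + m\<^sup>2))"
        by (simp only: mult.left_commute den)
      also have "\<dots> = 3 * (v * (3 + m\<^sup>2))" by (rule mult.left_commute)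
      also have "\<dots> = 6\<^sup>2" unfolding vm by simp
      finally show ?thesis unfolding power_mult_distrib[symmetric] num .
    qed
    then have "v * (1 - u + u\<^sup>2) = (1 + u)\<^sup>2" using \<open>3 + m \<noteq> 0\<close> by simp
    ultimately have "v = alpha u" unfolding alpha_def by (metis nonzero_eq_divide_eq)
    then show ?thesis unfolding Im_alpha_def using \<open>1 - u + u\<^sup>2 \<noteq> 0\<close> by blast
  qed
qed

lemma Im_alpha_discriminant_square:
  assumes "v \<in> Im_alpha"
  obtains s where "s\<^sup>2 = 27 * v * (4 - v)"
proof -
  obtain u where u: "1 - u + u\<^sup>2 \<noteq> 0" "v = alpha u" using assms by (auto simp: Im_alpha_def)
  define q where "q = 1 - u + u\<^sup>2"
  have v: "v * q = (1 + u)\<^sup>2" using u by (simp add: alpha_def q_def)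
  then have "(4 - v) * q = 3 * (1 - u)\<^sup>2" unfolding q_def by algebra
  with v have "(9 * (1 + u) * (1 - u))\<^sup>2 = 27 * v * (4 - v) * q\<^sup>2" by algebra
  then show thesis
    using u(1) by (intro that[of "9 * (1 + u) * (1 - u) / q"]) (simp add: q_def power_divide)
qed

lemma Im_beta_iff: "v \<in> Im_beta \<longleftrightarrow> (\<exists>r. r ^ 3 - 3 * r\<^sup>2 + v = 0)"
proof -
  have "v = beta r \<longleftrightarrow> r ^ 3 - 3 * r\<^sup>2 + v = 0" for r
    by (auto simp: beta_def algebra_simps power2_eq_square power3_eq_cube)
  then show ?thesis by (auto simp: Im_beta_def)
qed

lemma of_rat_cubic_root_iff:
  "of_rat r ^ 3 - 3 * (of_rat r)\<^sup>2 + of_rat v = (0 :: complex) \<longleftrightarrow> r ^ 3 - 3 * r\<^sup>2 + v = 0"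
proof -
  have "of_rat r ^ 3 - 3 * (of_rat r)\<^sup>2 + of_rat v = (of_rat (r ^ 3 - 3 * r\<^sup>2 + v) :: complex)"
    by (simp add: of_rat_add of_rat_diff of_rat_mult of_rat_power)
  then show ?thesis by (simp only: of_rat_eq_0_iff)
qed

context psi_frame
begin

lemma discriminant_root_rational_iff_Im_alpha: "discriminant_root t \<in> \<rat> \<longleftrightarrow> v \<in> Im_alpha"
proof
  assume "discriminant_root t \<in> \<rat>"
  then obtain s :: rat where "discriminant_root t = of_rat s" by (auto elim: Rats_cases)
  then have "of_rat (s\<^sup>2) = (of_rat (27 * v * (4 - v)) :: complex)"
    using discriminant_root_square by (simp add: of_rat_power)
  then show "v \<in> Im_alpha" using Im_alpha_if_discriminant_square v(1) by (simp only: of_rat_eq_iff)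
next
  assume "v \<in> Im_alpha"
  then obtain s where "s\<^sup>2 = 27 * v * (4 - v)" by (rule Im_alpha_discriminant_square)
  then have "(discriminant_root t)\<^sup>2 = (of_rat s)\<^sup>2"
    using discriminant_root_square by (simp flip: of_rat_power)
  then have "discriminant_root t = of_rat s \<or> discriminant_root t = - of_rat s"
    by (simp add: power2_eq_iff)
  then show "discriminant_root t \<in> \<rat>" by auto
qed

lemma Im_beta_if_rational_root:
  assumes "t j \<in> \<rat>"
  shows "v \<in> Im_beta"
proof -
  obtain r where "t j = of_rat r" using assms by (auto elim: Rats_cases)
  then have "of_rat r ^ 3 - 3 * (of_rat r)\<^sup>2 + of_rat v = (0 :: complex)"
    unfolding root_iff_t by (metis rangeI)
  then show ?thesis unfolding of_rat_cubic_root_iff Im_beta_iff by blast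
qed

end

lemma cyclotomic_quadratic_pos: "1 + u + u\<^sup>2 > (0 :: rat)"
proof -
  have "1 + u + u\<^sup>2 = (u + 1 / 2)\<^sup>2 + 3 / 4" by (simp add: power2_eq_square field_simps)
  then show ?thesis using zero_le_power2[of "u + 1 / 2"] by linarith
qed

lemma mu_roots:
  fixes u :: rat
  assumes v: "v = mu u" "u ^ 3 + 3 * u\<^sup>2 - 1 \<noteq> 0"
  obtains r0 r1 r2 where "[:v, 0, - 3, 1:] = [:- r0, 1:] * [:- r1, 1:] * [:- r2, 1:]"
proof -
  define q N D where "q = 1 + u + u\<^sup>2" and "N = u ^ 3 - 3 * u - 1" and "D = u ^ 3 + 3 * u\<^sup>2 - 1"
  have "q \<noteq> 0" using cyclotomic_quadratic_pos[of u] by (simp add: q_def)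
  have "D \<noteq> 0" using v(2) by (simp add: D_def)
  have "v = (1 + N / D)\<^sup>2 / (1 - N / D + (N / D)\<^sup>2)"
    using v(1) by (simp add: mu_def alpha_def N_def D_def)
  also have "\<dots> = (D\<^sup>2 * (1 + N / D)\<^sup>2) / (D\<^sup>2 * (1 - N / D + (N / D)\<^sup>2))" using \<open>D \<noteq> 0\<close> by simp
  also have "D\<^sup>2 * (1 + N / D)\<^sup>2 = (D + N)\<^sup>2"
    using \<open>D \<noteq> 0\<close> by (simp add: field_simps flip: power_mult_distrib)
  also have "D\<^sup>2 * (1 - N / D + (N / D)\<^sup>2) = D\<^sup>2 - N * D + N\<^sup>2"
    using \<open>D \<noteq> 0\<close> by (simp add: field_simps power2_eq_square)
  also have "D\<^sup>2 - N * D + N\<^sup>2 = q ^ 3" unfolding D_def N_def q_def by algebra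
  also have "D + N = (2 * u + 1) * (u + 2) * (u - 1)" unfolding D_def N_def by algebra
  finally have "v * q ^ 3 = ((2 * u + 1) * (u + 2) * (u - 1))\<^sup>2" using \<open>q \<noteq> 0\<close> by simp
  moreover define r0 r1 r2
    where "r0 = (2 * u + 1) * (u + 2) / q" and "r1 = (2 * u + 1) * (u - 1) / q"
    and "r2 = - ((u + 2) * (u - 1)) / q"
  then have "q * r0 = (2 * u + 1) * (u + 2)" "q * r1 = (2 * u + 1) * (u - 1)"
    "q * r2 = - ((u + 2) * (u - 1))"
    using \<open>q \<noteq> 0\<close> by simp_all
  moreover note q_def
  ultimately have "q ^ 3 * (z ^ 3 - 3 * z\<^sup>2 + v) = q ^ 3 * ((z - r0) * (z - r1) * (z - r2))" for z
    by algebra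
  then have factorization: "z ^ 3 - 3 * z\<^sup>2 + v = (z - r0) * (z - r1) * (z - r2)" for z
    using \<open>q \<noteq> 0\<close> by simp
  have "poly [:v, 0, - 3, 1:] z = poly ([:- r0, 1:] * [:- r1, 1:] * [:- r2, 1:]) z" for z
    using factorization[of z] unfolding poly_mult
    by (simp add: algebra_simps power2_eq_square power3_eq_cube)
  then show thesis by (intro that poly_ext)
qed

lemma psi_map_eqI:
  assumes "v \<noteq> 4" and eq: "y * (v * x\<^sup>2 - 1) = 2 * x - 1"
  shows "psi_map v (Some x) = Some y"
proof -
  have "v * x\<^sup>2 \<noteq> 1"
  proof
    assume "v * x\<^sup>2 = 1"
    moreover from this have "2 * x = 1" using eq by simp
    ultimately have "v = 4" by algebra
    then show False using \<open>v \<noteq> 4\<close> by simp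
  qed
  then show ?thesis using eq by (simp add: psi_map_def field_simps)
qed

lemma kappa_orbit_step:
  fixes q R X Y v :: "'a :: field"
  assumes "q \<noteq> 0" "R \<noteq> 0" "v = R\<^sup>2 / q ^ 3" and "Y * (X\<^sup>2 - q) = 2 * X * q - R"
  shows "(Y * q / R) * (v * (X * q / R)\<^sup>2 - 1) = 2 * (X * q / R) - 1"
proof -
  have "q * (v * (X * q / R)\<^sup>2 - 1) = X\<^sup>2 - q"
    using assms(1-3) by (simp add: field_simps power2_eq_square power3_eq_cube)
  then have "(Y * q / R) * (v * (X * q / R)\<^sup>2 - 1) = Y * (X\<^sup>2 - q) / R"
    by (metis mult.assoc times_divide_eq_left)
  then show ?thesis using assms(2,4) by (simp add: diff_divide_distrib)
qed

lemma kappa_orbit: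
  assumes v: "v = kappa u" "v \<noteq> 0" "v \<noteq> 1"
  obtains x y z where "y * (v * x\<^sup>2 - 1) = 2 * x - 1" "z * (v * y\<^sup>2 - 1) = 2 * y - 1"
    "x * (v * z\<^sup>2 - 1) = 2 * z - 1" "x \<noteq> y"
proof -
  define q R where "q = 1 + u + u\<^sup>2" and "R = u ^ 3 - 3 * u\<^sup>2 - 6 * u - 1"
  have "q \<noteq> 0" using cyclotomic_quadratic_pos[of u] by (simp add: q_def)
  have vR: "v = R\<^sup>2 / q ^ 3" using v(1) by (simp add: kappa_def R_def q_def)
  then have "R \<noteq> 0" using v(2) by auto
  have "kappa 0 = 1" "kappa (- 1) = 1" by (simp_all add: kappa_def)
  then have "u \<noteq> 0" "u + 1 \<noteq> 0" using v(1,3) by (auto simp: add_eq_0_iff2)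
  define X Y Z where "X = - (u * (u + 2))" and "Y = - (2 * u + 1) / (u + 1)" and "Z = (u\<^sup>2 - 1) / u"
  have Y: "(u + 1) * Y = - (2 * u + 1)" and Z: "u * Z = u\<^sup>2 - 1"
    using \<open>u \<noteq> 0\<close> \<open>u + 1 \<noteq> 0\<close> by (simp_all add: Y_def Z_def)
  have "(u + 1) * (Y * (X\<^sup>2 - q)) = (u + 1) * (2 * X * q - R)"
    using Y unfolding X_def q_def R_def by algebra
  then have XY: "Y * (X\<^sup>2 - q) = 2 * X * q - R" using \<open>u + 1 \<noteq> 0\<close> by simp
  have "(u * (u + 1)\<^sup>2) * (Z * (Y\<^sup>2 - q)) = (u * (u + 1)\<^sup>2) * (2 * Y * q - R)"
    using Y Z unfolding q_def R_def by algebra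
  then have YZ: "Z * (Y\<^sup>2 - q) = 2 * Y * q - R" using \<open>u \<noteq> 0\<close> \<open>u + 1 \<noteq> 0\<close> by simp
  have "u\<^sup>2 * (X * (Z\<^sup>2 - q)) = u\<^sup>2 * (2 * Z * q - R)"
    using Z unfolding X_def q_def R_def by algebra
  then have ZX: "X * (Z\<^sup>2 - q) = 2 * Z * q - R" using \<open>u \<noteq> 0\<close> by simp
  have "X \<noteq> Y"
  proof
    assume "X = Y"
    then have "(u + 1) * - (u * (u + 2)) = - (2 * u + 1)" using Y by (simp only: X_def)
    then have "u ^ 3 + 3 * u\<^sup>2 - 1 = 0" by algebra
    moreover have "u ^ 3 * ((- 1 / u) ^ 3 - 3 * (- 1 / u) + 1) = u ^ 3 + 3 * u\<^sup>2 - 1"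
      using \<open>u \<noteq> 0\<close> by (simp add: field_simps power2_eq_square power3_eq_cube)
    ultimately show False using gamma_cubic_no_rat_root[of "- 1 / u"] \<open>u \<noteq> 0\<close> by simp
  qed
  then have "X * q / R \<noteq> Y * q / R" using \<open>q \<noteq> 0\<close> \<open>R \<noteq> 0\<close> by simp
  with XY YZ ZX show thesis
    using that[OF kappa_orbit_step kappa_orbit_step kappa_orbit_step] \<open>q \<noteq> 0\<close> \<open>R \<noteq> 0\<close> vR by blast
qed

locale psi_conjugate =
  fixes \<phi> :: ratfun and v :: rat
  assumes ok: "rf_ok \<phi>" and deg: "rf_deg \<phi> = 2" and v: "v \<noteq> 0" "v \<noteq> 4"
    and conj: "lin_conj_Q \<phi> (psi v)"
begin

lemma psi_frame_through_root:
  assumes z: "z ^ 3 - 3 * z\<^sup>2 + of_rat v = 0"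
  obtains g \<sigma> t where "psi_frame g \<phi> v \<sigma> t" "t 2 = z"
proof -
  obtain \<sigma> where \<sigma>: "\<sigma> \<in> moebius \<rat>" "\<And>P. \<sigma> (psi_map (of_rat v) P) = rf_eval \<phi> (\<sigma> P)"
    using conj v(1) by (auto simp: lin_conj_Q_iff rf_eval_psi)
  obtain g :: complex where "poly [:1, - 3, 0, 1:] g = 0"
    using alg_closed_imp_poly_has_root[of "[:1, - 3, 0, 1 :: complex:]"] by auto
  then have g: "g ^ 3 - 3 * g + 1 = 0" by (simp add: power3_eq_cube algebra_simps)
  obtain x where "poly [:z * (z - 3), z - 3, 1:] x = 0"
    using alg_closed_imp_poly_has_root[of "[:z * (z - 3), z - 3, 1:]"] by auto
  then have x: "x\<^sup>2 + (z - 3) * x + z * (z - 3) = 0" by (simp add: power2_eq_square algebra_simps)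
  define t :: "3 \<Rightarrow> complex"
    where "t n = (if n = 0 then x else if n = 1 then 3 - z - x else z)" for n
  have t: "t 0 = x" "t 1 = 3 - z - x" "t 2 = z" by (simp_all add: t_def)
  have "psi_frame g \<phi> v \<sigma> t"
  proof
    show "t 0 + t 1 + t 2 = 3" unfolding t by simp
    show "t 0 * t 1 + t 1 * t 2 + t 2 * t 0 = 0" "t 0 * t 1 * t 2 = - of_rat v"
      unfolding t using x z by algebra+
  qed (use ok deg v \<sigma> g in auto)
  then show thesis using that t(3) by blast
qed

lemma psi_frame_exists: obtains g \<sigma> t where "psi_frame g \<phi> v \<sigma> t"
proof -
  obtain z where "poly [:of_rat v, 0, - 3, 1 :: complex:] z = 0"
    using alg_closed_imp_poly_has_root[of "[:of_rat v, 0, - 3, 1 :: complex:]"] by auto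
  then have "z ^ 3 - 3 * z\<^sup>2 + of_rat v = 0"
    by (simp add: power2_eq_square power3_eq_cube algebra_simps)
  then show thesis by (rule psi_frame_through_root) (rule that)
qed

lemma G3_is_W6:
  assumes "v \<notin> Im_alpha \<union> Im_beta"
  shows "G3_is \<phi> W6"
proof -
  obtain g \<sigma> t where "psi_frame g \<phi> v \<sigma> t" by (rule psi_frame_exists)
  then interpret psi_frame g \<phi> v \<sigma> t .
  show ?thesis
    using assms discriminant_root_rational_iff_Im_alpha Im_beta_if_rational_root
    by (intro G3_is_W6_if_irrational) auto
qed

lemma G3_is_A6_K6_M6:
  assumes "v \<in> Im_alpha"
  shows "G3_is \<phi> A6 \<or> G3_is \<phi> K6 \<or> G3_is \<phi> M6"
proof -
  obtain g \<sigma> t where "psi_frame g \<phi> v \<sigma> t" by (rule psi_frame_exists)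
  then interpret psi_frame g \<phi> v \<sigma> t .
  show ?thesis
    using assms G3_is_A6_K6_M6_if_discriminant_root_rational discriminant_root_rational_iff_Im_alpha
    by blast
qed

lemma G3_is_B6_M6:
  assumes "v \<in> Im_beta"
  shows "G3_is \<phi> B6 \<or> G3_is \<phi> M6"
proof -
  obtain r where "r ^ 3 - 3 * r\<^sup>2 + v = 0" using assms Im_beta_iff by blast
  then obtain g \<sigma> t where t: "psi_frame g \<phi> v \<sigma> t" "t 2 = of_rat r"
    using psi_frame_through_root of_rat_cubic_root_iff by metis
  interpret psi_frame g \<phi> v \<sigma> t by (rule t(1))
  show ?thesis using G3_is_B6_M6_if_rational_root t(2) by simp
qed

lemma G3_is_M6:
  assumes "v \<in> Im_mu"
  shows "G3_is \<phi> M6"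
proof -
  obtain u where u: "v = mu u" "u ^ 3 + 3 * u\<^sup>2 - 1 \<noteq> 0" using assms by (auto simp: Im_mu_def)
  then obtain r0 r1 r2 where roots: "[:v, 0, - 3, 1:] = [:- r0, 1:] * [:- r1, 1:] * [:- r2, 1:]"
    by (rule mu_roots)
  obtain g \<sigma> t where "psi_frame g \<phi> v \<sigma> t" by (rule psi_frame_exists)
  then interpret psi_frame g \<phi> v \<sigma> t .
  have "t j \<in> \<rat>" for j
  proof -
    have "poly (cpoly [:v, 0, - 3, 1:]) (t j) = 0"
      using root_iff_t[of "t j"]
      by (simp add: cpoly_pCons cpoly_0 of_rat_minus power2_eq_square power3_eq_cube algebra_simps)
    then have "t j \<in> {of_rat r0, of_rat r1, of_rat r2}"
      unfolding roots cpoly_mult poly_mult by (simp add: cpoly_pCons cpoly_0 of_rat_minus)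
    then show ?thesis by auto
  qed
  then show ?thesis by (rule G3_is_M6_if_rational_roots)
qed

lemma G3_is_K6:
  assumes "v \<in> Im_kappa" "v \<noteq> 1"
  shows "G3_is \<phi> K6"
proof -
  obtain u where "v = kappa u" using assms(1) by (auto simp: Im_kappa_def)
  then obtain x y z where orbit: "y * (v * x\<^sup>2 - 1) = 2 * x - 1" "z * (v * y\<^sup>2 - 1) = 2 * y - 1"
    "x * (v * z\<^sup>2 - 1) = 2 * z - 1" "x \<noteq> y"
    using kappa_orbit v(1) assms(2) by metis
  have psi: "psi_map (of_rat v) (Some (of_rat p)) = Some (of_rat q)"
    if "q * (v * p\<^sup>2 - 1) = 2 * p - 1" for p q
  proof (rule psi_map_eqI)
    have "(of_rat (q * (v * p\<^sup>2 - 1)) :: complex) = of_rat (2 * p - 1)" using that by simp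
    then show "of_rat q * (of_rat v * (of_rat p)\<^sup>2 - 1) = (2 * of_rat p - 1 :: complex)"
      by (simp add: of_rat_mult of_rat_diff of_rat_power)
    show "of_rat v \<noteq> (4 :: complex)" using v(2) of_rat_eq_iff[of v 4, where 'a = complex] by simp
  qed
  obtain g \<sigma> t where "psi_frame g \<phi> v \<sigma> t" by (rule psi_frame_exists)
  then interpret psi_frame g \<phi> v \<sigma> t .
  let ?P = "Some (of_rat x) :: p1"
  have "periodic_pt (psi_map (of_rat v)) 3 ?P"
    unfolding periodic_pt_3_iff
    using orbit(4) by (simp add: numeral_3_eq_3 psi[OF orbit(1)] psi[OF orbit(2)] psi[OF orbit(3)])
  then have "periodic_pt (rf_eval \<phi>) 3 (\<sigma> ?P)"
    using periodic_pt_conj[of \<sigma> "psi_map (of_rat v)", OF \<sigma>_conj bij_is_inj[OF moebius_bij[OF \<sigma>]]]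
    by blast
  then have "\<sigma> ?P \<in> per3 \<phi>" unfolding per3_eq periodic_pt_3_iff_per3_pt by blast
  moreover have "\<sigma> ?P \<in> proj_line \<rat>"
    by (rule moebius_proj_line[OF is_subfield_Rats \<sigma>]) (simp add: Some_in_proj_line_iff)
  ultimately show ?thesis by (rule G3_is_K6_if_rational_per3_pt)
qed

end

theorem theorem1p2:
  fixes \<phi> :: ratfun
  assumes "rf_ok \<phi>" and "rf_deg \<phi> = 2"
    and "\<exists>P. alg_pt P \<and> critical_pt \<phi> P \<and> periodic_pt (rf_eval \<phi>) 2 P"
    and "aut_nontrivial \<phi>"
  shows "(\<exists>v::rat. v \<notin> {0, 4} \<and> lin_conj_Q \<phi> (psi v)) \<and>
    (\<forall>v::rat. v \<notin> {0, 4} \<and> lin_conj_Q \<phi> (psi v) \<and> v \<noteq> 1 \<longrightarrow>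
       (v \<notin> Im_alpha \<union> Im_beta \<longrightarrow> G3_is \<phi> W6) \<and>
       (v \<in> Im_alpha \<longrightarrow> G3_is \<phi> A6 \<or> G3_is \<phi> K6 \<or> G3_is \<phi> M6) \<and>
       (v \<in> Im_beta \<longrightarrow> G3_is \<phi> B6 \<or> G3_is \<phi> M6) \<and>
       (v \<in> Im_mu \<longrightarrow> G3_is \<phi> M6) \<and>
       (v \<in> Im_kappa \<longrightarrow> G3_is \<phi> K6))"
proof (intro conjI allI impI)
  show "\<exists>v. v \<notin> {0, 4} \<and> lin_conj_Q \<phi> (psi v)" using lin_conj_psi_exists assms by blast
next
  fix v :: rat assume parameter: "v \<notin> {0, 4} \<and> lin_conj_Q \<phi> (psi v) \<and> v \<noteq> 1"
  then interpret psi_conjugate \<phi> v by unfold_locales (use assms in auto)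
  show "v \<notin> Im_alpha \<union> Im_beta \<Longrightarrow> G3_is \<phi> W6" by (rule G3_is_W6)
  show "v \<in> Im_alpha \<Longrightarrow> G3_is \<phi> A6 \<or> G3_is \<phi> K6 \<or> G3_is \<phi> M6" by (rule G3_is_A6_K6_M6)
  show "v \<in> Im_beta \<Longrightarrow> G3_is \<phi> B6 \<or> G3_is \<phi> M6" by (rule G3_is_B6_M6)
  show "v \<in> Im_mu \<Longrightarrow> G3_is \<phi> M6" by (rule G3_is_M6)
  show "v \<in> Im_kappa \<Longrightarrow> G3_is \<phi> K6" using G3_is_K6 parameter by blast
qed

end
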